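(* For $\mathbb{P}$-almost every $\omega\in\Omega$, the normalized eigenvalue counting measures $\mu_k^\omega=|B_k|^{-1}\sum_{j=1}^{|B_k|}\delta(e_j^{\omega,k})$ converge to $\mu^{av}$ in the weak-* topology as $k\to\infty$; i.e. there is $\widetilde\Omega\in\mathcal{F}$ with $\mathbb{P}(\widetilde\Omega)=1$ such that for all $\omega\in\widetilde\Omega$ and all continuous $f:\mathbb{R}\to\mathbb{C}$ vanishing at infinity, $\lim_{k\to\infty}\int f\,d\mu_k^\omega=\int f\,d\mu^{av}$.
   Context: Hierarchical Anderson model. Let $n\geq2$ be an integer, $\rho>1$, and $(p_r)_{r\geq1}$ with $p_r>0$, $\sum_rp_r=1$, $C_1\rho^{-r}\leq p_r\leq C_2\rho^{-r}$ for constants $C_1,C_2>0$. Let $\mathbb{X}=\{0,1,2,\dots\}$ with metric $d(x,y)=\min\{r:q(x,n^r)=q(y,n^r)\}$, where $q(x,n^r)$ is the quotient of the division of $x$ by $n^r$; $B(x,r)=\{y:d(x,y)\leq r\}$. For $r\geq1$, $(E_r\psi)(x)=n^{-r}\sum_{d(y,x)\leq r}\psi(y)$ on $\ell^2(\mathbb{X})$, and $\Delta=\sum_{r\geq1}p_rE_r$. Let $(\omega(x))_{x\in\mathbb{X}}$ be i.i.d. real random variables with bounded density $\gamma$ on the product space $(\Omega,\mathcal{F},\mathbb{P})$, $V_\omega$ multiplication by $\omega(x)$, and $H_\omega=\Delta+V_\omega$ (self-adjoint on its natural domain). Fix $x_0\in\mathbb{X}$, $B_k=B(x_0,k)$ ($|B_k|=n^k$),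 $H_k^\omega=\sum_{s=1}^kp_sE_s+V_\omega$, which leaves $\ell^2(B_k)$ invariant; $e_1^{\omega,k}\leq\dots\leq e^{\omega,k}_{|B_k|}$ are the eigenvalues of $H_k^\omega$ restricted to $\ell^2(B_k)$. $\mu^{av}$ is the Borel probability measure on $\mathbb{R}$ with $\int f\,d\mu^{av}=\mathbb{E}\langle\delta_{x_0},f(H_\omega)\delta_{x_0}\rangle$ for continuous $f$ vanishing at infinity. *)

theory Defs
  imports "HOL-Probability.Probability" "Jordan_Normal_Form.Char_Poly"
begin

definition hdist :: "nat \<Rightarrow> nat \<Rightarrow> nat \<Rightarrow> nat" where
  "hdist n x y = (LEAST r. x div n ^ r = y div n ^ r)"

definition hball :: "nat \<Rightarrow> nat \<Rightarrow> nat \<Rightarrow> nat set" where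
  "hball n x r = {y. hdist n x y \<le> r}"

definition Eop :: "nat \<Rightarrow> nat \<Rightarrow> (nat \<Rightarrow> complex) \<Rightarrow> nat \<Rightarrow> complex" where
  "Eop n r \<psi> x = (1 / of_nat n ^ r) * (\<Sum>y\<in>{y. hdist n y x \<le> r}. \<psi> y)"

definition hLap :: "nat \<Rightarrow> (nat \<Rightarrow> real) \<Rightarrow> (nat \<Rightarrow> complex) \<Rightarrow> nat \<Rightarrow> complex" where
  "hLap n p \<psi> x = (\<Sum>r. of_real (p (Suc r)) * Eop n (Suc r) \<psi> x)"

definition hHam :: "nat \<Rightarrow> (nat \<Rightarrow> real) \<Rightarrow> (nat \<Rightarrow> real) \<Rightarrow> (nat \<Rightarrow> complex) \<Rightarrow> nat \<Rightarrow> complex" where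
  "hHam n p \<omega> \<psi> x = hLap n p \<psi> x + of_real (\<omega> x) * \<psi> x"

definition in_l2 :: "(nat \<Rightarrow> complex) \<Rightarrow> bool" where
  "in_l2 \<psi> \<longleftrightarrow> summable (\<lambda>x. (cmod (\<psi> x))\<^sup>2)"

definition hdom :: "(nat \<Rightarrow> real) \<Rightarrow> (nat \<Rightarrow> complex) \<Rightarrow> bool" where
  "hdom \<omega> \<psi> \<longleftrightarrow> in_l2 \<psi> \<and> in_l2 (\<lambda>x. of_real (\<omega> x) * \<psi> x)"

text \<open>Green function <delta_x0, (H_omega - z)^{-1} delta_x0> for Im z > 0: psi(x0)
  where psi is the unique element of the domain with (H_omega - z) psi = delta_x0.\<close>
definition green :: "nat \<Rightarrow> (nat \<Rightarrow> real) \<Rightarrow> nat \<Rightarrow> (nat \<Rightarrow> real) \<Rightarrow> complex \<Rightarrow> complex" where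
  "green n p x0 \<omega> z =
     (THE \<psi>. hdom \<omega> \<psi> \<and> (\<forall>x. hHam n p \<omega> \<psi> x - z * \<psi> x = (if x = x0 then 1 else 0))) x0"

text \<open>Spectral measure of delta_x0 w.r.t. H_omega: the Borel probability measure mu with
  <delta_x0, f(H_omega) delta_x0> = integral of f dmu; it is characterised by its
  Stieltjes transform, i.e. by the resolvents.\<close>
definition spec_meas :: "nat \<Rightarrow> (nat \<Rightarrow> real) \<Rightarrow> nat \<Rightarrow> (nat \<Rightarrow> real) \<Rightarrow> real measure" where
  "spec_meas n p x0 \<omega> = (THE \<mu>. sets \<mu> = sets borel \<and> prob_space \<mu> \<and>
      (\<forall>z. Im z > 0 \<longrightarrow> (\<integral>t. 1 / (complex_of_real t - z) \<partial>\<mu>) = green n p x0 \<omega> z))"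

definition fH_diag :: "nat \<Rightarrow> (nat \<Rightarrow> real) \<Rightarrow> nat \<Rightarrow> (nat \<Rightarrow> real) \<Rightarrow> (real \<Rightarrow> complex) \<Rightarrow> complex" where
  "fH_diag n p x0 \<omega> f = (\<integral>t. f t \<partial>spec_meas n p x0 \<omega>)"

text \<open>Matrix of H_k^omega = sum_{s=1}^k p_s E_s + V_omega restricted to l2(B_k),
  B_k = B(x0,k) enumerated as b + i, i < n^k, where b = (x0 div n^k) * n^k.\<close>
definition Hk_mat :: "nat \<Rightarrow> (nat \<Rightarrow> real) \<Rightarrow> nat \<Rightarrow> nat \<Rightarrow> (nat \<Rightarrow> real) \<Rightarrow> real mat" where
  "Hk_mat n p x0 k \<omega> =
     (let b = (x0 div n ^ k) * n ^ k in
      mat (n ^ k) (n ^ k) (\<lambda>(i, j).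
        (\<Sum>s\<in>{1..k}. p s * (if hdist n (b + i) (b + j) \<le> s then 1 / real n ^ s else 0))
        + (if i = j then \<omega> (b + i) else 0)))"

definition Hk_eigs :: "nat \<Rightarrow> (nat \<Rightarrow> real) \<Rightarrow> nat \<Rightarrow> nat \<Rightarrow> (nat \<Rightarrow> real) \<Rightarrow> real multiset" where
  "Hk_eigs n p x0 k \<omega> = proots (char_poly (Hk_mat n p x0 k \<omega>))"

definition int_mu_k :: "nat \<Rightarrow> (nat \<Rightarrow> real) \<Rightarrow> nat \<Rightarrow> nat \<Rightarrow> (nat \<Rightarrow> real) \<Rightarrow> (real \<Rightarrow> complex) \<Rightarrow> complex" where
  "int_mu_k n p x0 k \<omega> f =
     (1 / of_nat (card (hball n x0 k))) * sum_mset (image_mset f (Hk_eigs n p x0 k \<omega>))"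

end

theory Submission
  imports Defs
begin

text \<open>Write \<open>G k \<omega> z x\<close> for the diagonal resolvent entry of the truncated operator
  \<open>Hfin n p k \<omega>\<close> at the site \<open>x\<close>. Since the averaging operators are contractions, truncating at
  level \<open>m\<close> instead of \<open>k \<ge> m\<close> changes it by at most \<open>(\<Sum>s>m. p s) / (Im z)\<^sup>2\<close>, uniformly in
  \<open>\<omega>\<close> and \<open>x\<close>. Hence \<open>G k\<close> converges to the Green function of the full operator, and the Stieltjes
  transform of the eigenvalue distribution on \<open>B\<^sub>k\<close>, which is the average of \<open>G k \<omega> z x\<close> over \<open>B\<^sub>k\<close>,
  is close to the average of \<open>G m \<omega> z x\<close>. The latter variables are independent for sites in different
  blocks of level \<open>m\<close> and, because digitwise addition is an isometry, have the same mean; a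
  variance estimate gives almost sure convergence for each \<open>z\<close>. A countable dense set of \<open>z\<close> then
  suffices: by the Stone-Weierstrass theorem on the circle, the resolvents
  \<open>t \<mapsto> 1 / (t - z)\<close> together with the constants span a dense subspace of the continuous functions
  that have a limit at infinity. The spectral measure in the definition of \<open>fH_diag\<close>
  exists by Helly's theorem, tightness being provided by the second moments
  \<open>\<parallel>H\<^sub>k \<delta>\<^sub>x\<parallel>\<^sup>2 \<le> (1 + \<bar>\<omega> x\<bar>)\<^sup>2\<close>.\<close>

text \<open>\<open>green\<close> and \<open>spec_meas\<close> are descriptions by
  \<open>THE\<close>, for an operator that may be unbounded, so existence and uniqueness have to be
  supplied. Both come from finite blocks, where one inequality, that \<open>Im z\<close> times the
  norm of \<psi> is at most the norm of (H - z) \<psi>, yields uniqueness, truncation errors and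
  continuity in the potential alike. The entries at level k depend on the potential in all of B_k
  and are far from independent. Fixing m makes the dependence local before k tends to infinity.
  Since blocks grow geometrically, the variances are summable and second moments alone give almost
  sure convergence. Probability and the hypothesis on \<mu>av are applied to resolvents; the passage
  to general f is deterministic, through a notion of mean that covers integrals and eigenvalue
  averages at once. Constants belong to the dense class because polynomials on the circle need not
  vanish at the point that represents infinity; they are harmless, as all means have total mass
  one.\<close>

unbundle no vec_syntax

section \<open>Orthogonal diagonalisation of real symmetric matrices\<close>

text \<open>Over the complex numbers the characteristic polynomial has a root. The quadratic form of
  a real symmetric matrix is real, hence so is the root, and the real and imaginary parts of a
  complex eigenvector solve the same real linear system.\<close>

lemma symmetric_mat_unit_eigenvector:
  fixes A :: "real mat"
  assumes A: "A \<in> carrier_mat N N" and sym: "\<And>i j. i < N \<Longrightarrow> j < N \<Longrightarrow> A $$ (i, j) = A $$ (j, i)"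
    and N: "N > 0"
  obtains e v where "v \<in> carrier_vec N" "(\<Sum>i<N. (v $ i)\<^sup>2) = 1" "A *\<^sub>v v = e \<cdot>\<^sub>v v"
proof -
  let ?C = "map_mat complex_of_real A"
  have C: "?C \<in> carrier_mat N N" using A by simp
  have "degree (char_poly ?C) = N" using degree_monic_char_poly[OF C] by blast
  hence "\<not> constant (poly (char_poly ?C))" using N constant_degree[of "char_poly ?C"] by simp
  then obtain z where "poly (char_poly ?C) z = 0" using fundamental_theorem_of_algebra by blast
  then obtain u where u: "u \<in> carrier_vec N" "u \<noteq> 0\<^sub>v N" "?C *\<^sub>v u = z \<cdot>\<^sub>v u"
    using eigenvalue_root_char_poly[OF C] A unfolding eigenvalue_def eigenvector_def by auto
  have eq: "(\<Sum>j<N. complex_of_real (A $$ (i, j)) * u $ j) = z * u $ i" if i: "i < N" for i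
  proof -
    have "(?C *\<^sub>v u) $ i = (z \<cdot>\<^sub>v u) $ i" using u by simp
    thus ?thesis using i A u(1) by (simp add: scalar_prod_def lessThan_atLeast0)
  qed
  define s where "s = (\<Sum>i<N. \<Sum>j<N. cnj (u $ i) * (complex_of_real (A $$ (i, j)) * u $ j))"
  define q where "q = (\<Sum>i<N. (cmod (u $ i))\<^sup>2)"
  obtain i0 where i0: "i0 < N" "u $ i0 \<noteq> 0"
    using u(1,2) by (metis carrier_vecD eq_vecI index_zero_vec)
  have "0 < (cmod (u $ i0))\<^sup>2" using i0 by simp
  also have "\<dots> \<le> q" unfolding q_def by (rule member_le_sum) (use i0 in auto)
  finally have q: "q > 0" .
  have "s = (\<Sum>i<N. cnj (u $ i) * (z * u $ i))"
    unfolding s_def by (simp add: sum_distrib_left[symmetric] eq)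
  also have "\<dots> = z * of_real q"
    unfolding q_def of_real_sum sum_distrib_left
    by (rule sum.cong) (simp_all only: complex_norm_square mult_ac refl)
  finally have sz: "s = z * of_real q" .
  have "cnj s = (\<Sum>i<N. \<Sum>j<N. u $ i * (complex_of_real (A $$ (i, j)) * cnj (u $ j)))"
    unfolding s_def by simp
  also have "\<dots> = (\<Sum>j<N. \<Sum>i<N. u $ i * (complex_of_real (A $$ (i, j)) * cnj (u $ j)))"
    by (rule sum.swap)
  also have "\<dots> = s" unfolding s_def
    by (intro sum.cong refl) (simp add: sym mult_ac)
  finally have "cnj z * of_real q = z * of_real q" by (simp add: sz)
  hence "cnj z = z" using q by simp
  hence z: "z = of_real (Re z)" by (simp add: complex_eq_iff)
  have re: "(\<Sum>j<N. A $$ (i, j) * Re (u $ j)) = Re z * Re (u $ i)" if "i < N" for i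
    using arg_cong[OF eq[OF that], of Re] arg_cong[OF z, of Im] by simp
  have im: "(\<Sum>j<N. A $$ (i, j) * Im (u $ j)) = Re z * Im (u $ i)" if "i < N" for i
    using arg_cong[OF eq[OF that], of Im] arg_cong[OF z, of Im] by simp
  \<comment> \<open>Of the two parts, take one that does not vanish at \<open>i0\<close>.\<close>
  have "\<exists>w::nat \<Rightarrow> real. (\<forall>i<N. (\<Sum>j<N. A $$ (i, j) * w j) = Re z * w i) \<and> w i0 \<noteq> 0"
  proof (cases "Re (u $ i0) = 0")
    case True
    thus ?thesis using im i0 by (intro exI[of _ "\<lambda>i. Im (u $ i)"]) (auto simp: complex_eq_iff)
  next
    case False
    thus ?thesis using re by (intro exI[of _ "\<lambda>i. Re (u $ i)"]) auto
  qed
  then obtain w :: "nat \<Rightarrow> real" where w: "\<And>i. i < N \<Longrightarrow> (\<Sum>j<N. A $$ (i, j) * w j) = Re z * w i" "w i0 \<noteq> 0"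
    by blast
  define c where "c = (\<Sum>i<N. (w i)\<^sup>2)"
  have "0 < (w i0)\<^sup>2" using w by simp
  also have "\<dots> \<le> c" unfolding c_def by (rule member_le_sum) (use i0 in auto)
  finally have c: "c > 0" .
  define v where "v = vec N (\<lambda>i. w i / sqrt c)"
  show thesis
  proof
    show "v \<in> carrier_vec N" by (simp add: v_def)
    show "(\<Sum>i<N. (v $ i)\<^sup>2) = 1"
      using c by (simp add: v_def power_divide sum_divide_distrib[symmetric] c_def[symmetric])
    show "A *\<^sub>v v = Re z \<cdot>\<^sub>v v"
    proof (rule eq_vecI)
      fix i assume "i < dim_vec (Re z \<cdot>\<^sub>v v)"
      hence i: "i < N" by (simp add: v_def)
      have "(A *\<^sub>v v) $ i = (\<Sum>j<N. A $$ (i, j) * (w j / sqrt c))"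
        using i A by (simp add: v_def scalar_prod_def lessThan_atLeast0)
      also have "\<dots> = Re z * w i / sqrt c" by (simp add: sum_divide_distrib[symmetric] w(1)[OF i])
      finally show "(A *\<^sub>v v) $ i = (Re z \<cdot>\<^sub>v v) $ i" using i by (simp add: v_def)
    qed (use A in \<open>simp add: v_def\<close>)
  qed
qed

text \<open>The Householder reflection that exchanges \<open>v\<close> and the first unit vector.\<close>

lemma reflection_mat:
  fixes v :: "real vec"
  assumes v: "v \<in> carrier_vec N" "(\<Sum>i<N. (v $ i)\<^sup>2) = 1" and N: "N > 0"
  obtains W where "W \<in> carrier_mat N N" "transpose_mat W = W" "W * W = 1\<^sub>m N" "col W 0 = v"
proof (cases "v = unit_vec N 0")
  case True
  show thesis by (rule that[of "1\<^sub>m N"]) (use N True in auto)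
next
  case False
  define w where "w i = v $ i - (if i = 0 then 1 else 0)" for i
  define c where "c = (\<Sum>i<N. (w i)\<^sup>2)"
  obtain i0 where i0: "i0 < N" "w i0 \<noteq> 0"
  proof -
    obtain i where "i < N" "v $ i \<noteq> unit_vec N 0 $ i"
      using False v(1) by (metis carrier_vecD eq_vecI index_unit_vec(3))
    thus thesis using that[of i] N by (auto simp: w_def)
  qed
  have "0 < (w i0)\<^sup>2" using i0 by simp
  also have "\<dots> \<le> c" unfolding c_def by (rule member_le_sum) (use i0 in auto)
  finally have c: "c > 0" .
  have split: "(\<Sum>i<N. f i) = f 0 + (\<Sum>i\<in>{1..<N}. f i)" for f :: "nat \<Rightarrow> real"
    using N by (simp add: lessThan_atLeast0 sum.atLeast_Suc_lessThan)
  \<comment> \<open>\<open>c\<close> is the squared length of v - e_0, which is 2 - 2 v_0 for a unit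
    vector. Hence column 0 of \<open>W\<close> is e_0 + w = v.\<close>
  have cw: "c = - 2 * w 0"
  proof -
    have "c = (v $ 0 - 1)\<^sup>2 + (\<Sum>i\<in>{1..<N}. (v $ i)\<^sup>2)"
      unfolding c_def split by (simp add: w_def)
    moreover have "1 = (v $ 0)\<^sup>2 + (\<Sum>i\<in>{1..<N}. (v $ i)\<^sup>2)" using v(2) split by metis
    ultimately show ?thesis by (simp add: w_def power2_eq_square algebra_simps)
  qed
  define W where "W = mat N N (\<lambda>(i, j). (if i = j then 1 else 0) - 2 * w i * w j / c)"
  show thesis
  proof (rule that[of W])
    show W: "W \<in> carrier_mat N N" by (simp add: W_def)
    show "transpose_mat W = W" by (rule eq_matI) (auto simp: W_def)
    show "col W 0 = v"
      using N c v(1) cw by (intro eq_vecI) (auto simp: W_def field_simps, auto simp: w_def algebra_simps)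
    show "W * W = 1\<^sub>m N"
    proof (rule eq_matI)
      fix i j assume "i < dim_row (1\<^sub>m N :: real mat)" "j < dim_col (1\<^sub>m N :: real mat)"
      hence ij: "i < N" "j < N" by auto
      have "(W * W) $$ (i, j) = (\<Sum>k<N. ((if i = k then 1 else 0) - 2 * w i * w k / c) *
          ((if k = j then 1 else 0) - 2 * w k * w j / c))"
        using ij by (simp add: W_def scalar_prod_def lessThan_atLeast0)
      also have "\<dots> = (\<Sum>k<N. (if k = i then (if i = j then 1 else 0) - 2 * w i * w j / c else 0)
          - (if k = j then 2 * w i * w j / c else 0) + 4 * w i * w j / c\<^sup>2 * (w k)\<^sup>2)"
        using c by (intro sum.cong refl) (auto simp: field_simps power2_eq_square)
      also have "\<dots> = (if i = j then 1 else 0) - 4 * w i * w j / c + 4 * w i * w j / c\<^sup>2 * c"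
        unfolding sum.distrib sum_subtractf sum_distrib_left[symmetric] c_def[symmetric] using ij by simp
      also have "\<dots> = (if i = j then 1 else 0)" using c by (simp add: power2_eq_square field_simps)
      finally show "(W * W) $$ (i, j) = 1\<^sub>m N $$ (i, j)" using ij by simp
    qed (auto simp: W_def)
  qed
qed

text \<open>Deflation: conjugation with the reflection that sends e_0 to a unit eigenvector clears
  the first column below the corner, symmetry clears the first row as well, and induction treats the
  remaining block.\<close>

theorem symmetric_mat_orthogonal_diagonalization:
  fixes A :: "real mat"
  assumes "A \<in> carrier_mat N N" "transpose_mat A = A"
  shows "\<exists>U D. U \<in> carrier_mat N N \<and> D \<in> carrier_mat N N \<and> diagonal_mat D \<and>
    transpose_mat U * U = 1\<^sub>m N \<and> A = U * D * transpose_mat U"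
  using assms
proof (induction N arbitrary: A)
  case 0
  have "A = 1\<^sub>m 0 * A * transpose_mat (1\<^sub>m 0)" using 0 by auto
  thus ?case using 0 by (intro exI[of _ "1\<^sub>m 0"] exI[of _ A]) (auto simp: diagonal_mat_def)
next
  case (Suc N A)
  have sym: "A $$ (i, j) = A $$ (j, i)" if "i < Suc N" "j < Suc N" for i j
    using Suc.prems that by (metis carrier_matD index_transpose_mat(1))
  obtain e v where v: "v \<in> carrier_vec (Suc N)" "(\<Sum>i<Suc N. (v $ i)\<^sup>2) = 1" "A *\<^sub>v v = e \<cdot>\<^sub>v v"
    using symmetric_mat_unit_eigenvector[OF Suc.prems(1) sym] by blast
  obtain W where W: "W \<in> carrier_mat (Suc N) (Suc N)" "transpose_mat W = W" "W * W = 1\<^sub>m (Suc N)" "col W 0 = v"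
    using reflection_mat[OF v(1,2)] by blast
  note A = Suc.prems(1)
  define A' where "A' = W * A * W"
  have A': "A' \<in> carrier_mat (Suc N) (Suc N)" using A W by (simp add: A'_def)
  have tA': "transpose_mat A' = A'"
    unfolding A'_def using A W Suc.prems(2) by (simp add: transpose_mult[of _ "Suc N" "Suc N" _ "Suc N"])
  have "col A' 0 = W *\<^sub>v (A *\<^sub>v v)"
    unfolding A'_def using A W
    by (subst col_mult2[of _ "Suc N" "Suc N" _ "Suc N"]) (auto simp: v(1))
  also have "\<dots> = e \<cdot>\<^sub>v (W *\<^sub>v v)" using v W by (simp add: mult_mat_vec)
  also have "W *\<^sub>v v = unit_vec (Suc N) 0"
    using W by (metis col_mult2 col_one zero_less_Suc)
  finally have col0: "col A' 0 = e \<cdot>\<^sub>v unit_vec (Suc N) 0" .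
  have A'0: "A' $$ (i, 0) = (if i = 0 then e else 0)" if "i < Suc N" for i
    using arg_cong[OF col0, of "\<lambda>x. x $ i"] that A' by auto
  have A'0': "A' $$ (0, i) = (if i = 0 then e else 0)" if "i < Suc N" for i
    using A'0[OF that] A' that tA' by (metis carrier_matD index_transpose_mat(1) zero_less_Suc)
  define B where "B = mat N N (\<lambda>(i, j). A' $$ (Suc i, Suc j))"
  have B: "B \<in> carrier_mat N N" by (simp add: B_def)
  let ?F = "\<lambda>c X. four_block_mat (mat 1 1 (\<lambda>_. c)) (0\<^sub>m 1 N) (0\<^sub>m N 1) (X :: real mat)"
  have A'B: "A' = ?F e B"
  proof (rule eq_matI)
    fix i j assume "i < dim_row (?F e B)" "j < dim_col (?F e B)"
    hence "i < Suc N" "j < Suc N" using B by auto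
    thus "A' $$ (i, j) = ?F e B $$ (i, j)" using A'0 A'0' B_def
      by (cases i; cases j) auto
  qed (use A' B in auto)
  have "transpose_mat B = B"
  proof (rule eq_matI)
    fix i j assume "i < dim_row B" "j < dim_col B"
    hence "i < N" "j < N" using B by auto
    thus "transpose_mat B $$ (i, j) = B $$ (i, j)" using tA' A'
      by (simp add: B_def) (metis Suc_less_eq carrier_matD index_transpose_mat(1))
  qed (use B in auto)
  from Suc.IH[OF B this] obtain U D where UD: "U \<in> carrier_mat N N" "D \<in> carrier_mat N N" "diagonal_mat D"
    "transpose_mat U * U = 1\<^sub>m N" "B = U * D * transpose_mat U" by blast
  define U' where "U' = ?F 1 U"
  define D' where "D' = ?F e D"
  have c: "U' \<in> carrier_mat (Suc N) (Suc N)" "D' \<in> carrier_mat (Suc N) (Suc N)"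
    using UD by (auto simp: U'_def D'_def)
  have tU': "transpose_mat U' = ?F 1 (transpose_mat U)"
    unfolding U'_def by (subst transpose_four_block_mat[of _ 1 1 _ N _ N]) (use UD in auto)
  have FF: "?F a X * ?F b Y = ?F (a * b) (X * Y)" if "X \<in> carrier_mat N N" "Y \<in> carrier_mat N N" for a b X Y
  proof -
    have "?F a X * ?F b Y = four_block_mat
        (mat 1 1 (\<lambda>_. a) * mat 1 1 (\<lambda>_. b) + 0\<^sub>m 1 N * 0\<^sub>m N 1) (mat 1 1 (\<lambda>_. a) * 0\<^sub>m 1 N + 0\<^sub>m 1 N * Y)
        (0\<^sub>m N 1 * mat 1 1 (\<lambda>_. b) + X * 0\<^sub>m N 1) (0\<^sub>m N 1 * 0\<^sub>m 1 N + X * Y)"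
      by (rule mult_four_block_mat) (use that in auto)
    also have "\<dots> = ?F (a * b) (X * Y)"
      using that by (intro cong_four_block_mat) (auto intro!: eq_matI simp: scalar_prod_def)
    finally show ?thesis .
  qed
  have UtU: "transpose_mat U' * U' = 1\<^sub>m (Suc N)"
    unfolding tU' unfolding U'_def using UD by (subst FF) (auto intro!: eq_matI)
  have A'D': "A' = U' * D' * transpose_mat U'"
    unfolding A'B tU' unfolding U'_def D'_def using UD(1,2,5)
    by (simp add: FF[OF _ _, unfolded One_nat_def] del: assoc_mult_mat)
  have AW: "A = W * A' * W"
  proof -
    have "W * A' * W = (W * W) * A * (W * W)"
      unfolding A'_def using A W(1) by (simp add: assoc_mult_mat[of _ "Suc N" "Suc N" _ "Suc N" _ "Suc N"])
    thus ?thesis using A W(3) by simp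
  qed
  show ?case
  proof (intro exI conjI)
    show "W * U' \<in> carrier_mat (Suc N) (Suc N)" "D' \<in> carrier_mat (Suc N) (Suc N)" using W c by auto
    have t: "transpose_mat (W * U') = transpose_mat U' * W"
      using W c by (simp add: transpose_mult[of _ "Suc N" "Suc N" _ "Suc N"])
    show "diagonal_mat D'" using UD unfolding D'_def diagonal_mat_def by auto
    have "transpose_mat (W * U') * (W * U') = transpose_mat U' * (W * W) * U'"
      unfolding t using W(1) c by (simp add: assoc_mult_mat[of _ "Suc N" "Suc N" _ "Suc N" _ "Suc N"])
    thus "transpose_mat (W * U') * (W * U') = 1\<^sub>m (Suc N)" using W(3) c UtU by simp
    show "A = W * U' * D' * transpose_mat (W * U')"
      unfolding t by (subst AW, unfold A'D') (use W(1) c in \<open>simp add: assoc_mult_mat[of _ "Suc N" "Suc N" _ "Suc N" _ "Suc N"]\<close>)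
  qed
qed

section \<open>Spectral decomposition of symmetric kernels and the a priori resolvent bound\<close>

lemma proots_prod_list_linear_factors:
  "proots (\<Prod>a\<leftarrow>as. [:- a, 1:]) = mset (as :: 'a :: field list)"
proof (induction as)
  case (Cons a as)
  have "(\<Prod>a\<leftarrow>as. [:- a, 1:]) \<noteq> 0" by (auto simp: prod_list_zero_iff)
  thus ?case using Cons by (simp add: proots_mult proots_linear_factor del: mult_pCons_left)
qed simp

text \<open>Both orthogonality relations are recorded: normalised columns lead to the trace formula,
  normalised rows to probability weights at a site. The roots of the characteristic polynomial tie
  \<open>e\<close> to \<open>Hk_eigs\<close>.\<close>

lemma symmetric_kernel_spectral_decomposition:
  fixes a :: "nat \<Rightarrow> nat \<Rightarrow> real"
  assumes sym: "\<And>x y. x < N \<Longrightarrow> y < N \<Longrightarrow> a x y = a y x"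
  obtains U :: "nat \<Rightarrow> nat \<Rightarrow> real" and e :: "nat \<Rightarrow> real" where
    "\<And>i j. i < N \<Longrightarrow> j < N \<Longrightarrow> (\<Sum>x<N. U x i * U x j) = (if i = j then 1 else 0)"
    "\<And>x y. x < N \<Longrightarrow> y < N \<Longrightarrow> (\<Sum>i<N. U x i * U y i) = (if x = y then 1 else 0)"
    "\<And>x y. x < N \<Longrightarrow> y < N \<Longrightarrow> a x y = (\<Sum>i<N. U x i * e i * U y i)"
    "proots (char_poly (mat N N (\<lambda>(i, j). a i j))) = image_mset e (mset_set {..<N})"
proof -
  let ?A = "mat N N (\<lambda>(i, j). a i j)"
  have A: "?A \<in> carrier_mat N N" by simp
  have "transpose_mat ?A = ?A" by (rule eq_matI) (auto simp: sym)
  from symmetric_mat_orthogonal_diagonalization[OF A this] obtain U D where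
    U: "U \<in> carrier_mat N N" and D: "D \<in> carrier_mat N N" and dD: "diagonal_mat D"
    and UU: "transpose_mat U * U = 1\<^sub>m N" and AU: "?A = U * D * transpose_mat U" by blast
  have tU: "transpose_mat U \<in> carrier_mat N N" using U by simp
  have UU': "U * transpose_mat U = 1\<^sub>m N" by (rule mat_mult_left_right_inverse[OF tU U UU])
  have "similar_mat_wit ?A D U (transpose_mat U)"
    by (rule similar_mat_witI[OF UU' UU AU A D U tU])
  hence "char_poly ?A = char_poly D" by (intro char_poly_similar) (auto simp: similar_mat_def)
  also have "\<dots> = (\<Prod>a\<leftarrow>diag_mat D. [:- a, 1:])"
    by (rule char_poly_upper_triangular[OF D]) (use dD D in \<open>auto simp: diagonal_mat_def\<close>)
  finally have "proots (char_poly ?A) = mset (diag_mat D)" by (simp only: proots_prod_list_linear_factors)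
  also have "\<dots> = image_mset (\<lambda>i. D $$ (i, i)) (mset_set {..<N})"
    using D by (simp add: diag_mat_def lessThan_atLeast0)
  finally have cp: "proots (char_poly ?A) = image_mset (\<lambda>i. D $$ (i, i)) (mset_set {..<N})" .
  show thesis
  proof (rule that[of "\<lambda>x i. U $$ (x, i)" "\<lambda>i. D $$ (i, i)"])
    fix i j assume ij: "i < N" "j < N"
    have "(transpose_mat U * U) $$ (i, j) = (\<Sum>x<N. U $$ (x, i) * U $$ (x, j))"
      using ij U by (simp add: scalar_prod_def lessThan_atLeast0)
    thus "(\<Sum>x<N. U $$ (x, i) * U $$ (x, j)) = (if i = j then 1 else 0)" using UU ij by simp
    have "(U * transpose_mat U) $$ (i, j) = (\<Sum>x<N. U $$ (i, x) * U $$ (j, x))"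
      using ij U by (simp add: scalar_prod_def lessThan_atLeast0)
    thus "(\<Sum>x<N. U $$ (i, x) * U $$ (j, x)) = (if i = j then 1 else 0)" using UU' ij by simp
    have UD: "(U * D) $$ (i, k) = U $$ (i, k) * D $$ (k, k)" if k: "k < N" for k
    proof -
      have "(U * D) $$ (i, k) = (\<Sum>l<N. U $$ (i, l) * D $$ (l, k))"
        using ij k U D by (simp add: scalar_prod_def lessThan_atLeast0)
      also have "\<dots> = (\<Sum>l<N. if l = k then U $$ (i, k) * D $$ (k, k) else 0)"
        using dD D k by (intro sum.cong) (auto simp: diagonal_mat_def)
      finally show ?thesis using k by simp
    qed
    have X: "(X * transpose_mat U) $$ (i, j) = (\<Sum>k<N. X $$ (i, k) * U $$ (j, k))"
      if "X \<in> carrier_mat N N" for X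
      using that ij U by (simp add: scalar_prod_def lessThan_atLeast0)
    have "a i j = ?A $$ (i, j)" using ij by simp
    also have "\<dots> = (\<Sum>k<N. (U * D) $$ (i, k) * U $$ (j, k))"
      unfolding AU using U D by (intro X) simp
    finally show "a i j = (\<Sum>k<N. U $$ (i, k) * D $$ (k, k) * U $$ (j, k))" by (simp add: UD)
  qed (fact cp)
qed

text \<open>Pair the equation with \<psi>: the quadratic form is real by symmetry, so the imaginary
  part retains only \<open>Im z\<close> times the squared norm, and Cauchy-Schwarz bounds the other
  side. Invertibility is not presupposed.\<close>

lemma symmetric_kernel_resolvent_bound:
  fixes a :: "'a \<Rightarrow> 'a \<Rightarrow> real" and \<psi> f :: "'a \<Rightarrow> complex"
  assumes fin: "finite S" and sym: "\<And>x y. x \<in> S \<Longrightarrow> y \<in> S \<Longrightarrow> a x y = a y x" and z: "Im z > 0"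
    and eq: "\<And>x. x \<in> S \<Longrightarrow> (\<Sum>y\<in>S. of_real (a x y) * \<psi> y) - z * \<psi> x = f x"
  shows "Im z * L2_set (\<lambda>x. cmod (\<psi> x)) S \<le> L2_set (\<lambda>x. cmod (f x)) S"
proof -
  let ?L = "L2_set (\<lambda>x. cmod (\<psi> x)) S"
  define s where "s = (\<Sum>x\<in>S. \<Sum>y\<in>S. cnj (\<psi> x) * (of_real (a x y) * \<psi> y))"
  have "cnj s = (\<Sum>x\<in>S. \<Sum>y\<in>S. \<psi> x * (of_real (a x y) * cnj (\<psi> y)))" unfolding s_def by simp
  also have "\<dots> = (\<Sum>y\<in>S. \<Sum>x\<in>S. \<psi> x * (of_real (a x y) * cnj (\<psi> y)))" by (rule sum.swap)
  also have "\<dots> = s" unfolding s_def by (intro sum.cong refl) (simp add: sym mult_ac)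
  finally have Ims: "Im s = 0" by (simp add: complex_eq_iff)
  have L: "?L\<^sup>2 = (\<Sum>x\<in>S. (cmod (\<psi> x))\<^sup>2)" unfolding L2_set_def by (simp add: sum_nonneg)
  have "(\<Sum>x\<in>S. cnj (\<psi> x) * f x) = s - z * (\<Sum>x\<in>S. cnj (\<psi> x) * \<psi> x)"
    unfolding s_def sum_distrib_left[symmetric]
    by (simp add: sum_distrib_left sum_subtractf[symmetric] eq[symmetric] algebra_simps)
  also have "(\<Sum>x\<in>S. cnj (\<psi> x) * \<psi> x) = of_real (?L\<^sup>2)"
    unfolding L of_real_sum by (intro sum.cong refl) (simp only: complex_norm_square mult.commute)
  finally have "Im (\<Sum>x\<in>S. cnj (\<psi> x) * f x) = - Im z * ?L\<^sup>2" using Ims by (simp del: of_real_power)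
  hence "Im z * ?L\<^sup>2 \<le> cmod (\<Sum>x\<in>S. cnj (\<psi> x) * f x)"
    using abs_Im_le_cmod[of "\<Sum>x\<in>S. cnj (\<psi> x) * f x"] by linarith
  also have "\<dots> \<le> (\<Sum>x\<in>S. \<bar>cmod (\<psi> x)\<bar> * \<bar>cmod (f x)\<bar>)"
    by (rule order_trans[OF norm_sum]) (simp add: norm_mult)
  also have "\<dots> \<le> ?L * L2_set (\<lambda>x. cmod (f x)) S" by (rule L2_set_mult_ineq)
  finally have "?L * (Im z * ?L) \<le> ?L * L2_set (\<lambda>x. cmod (f x)) S" by (simp add: power2_eq_square mult_ac)
  thus ?thesis using L2_set_nonneg[of "\<lambda>x. cmod (\<psi> x)" S] L2_set_nonneg[of "\<lambda>x. cmod (f x)" S]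
    by (cases "?L = 0") auto
qed

section \<open>The hierarchical structure and the finite-volume operators\<close>

text \<open>The ultrametric ball as a class of equal quotients, which makes it plain that blocks of
  one level partition the sites and that levels are nested.\<close>

definition hblock :: "nat \<Rightarrow> nat \<Rightarrow> nat \<Rightarrow> nat set" where
  "hblock n r x = {y. y div n ^ r = x div n ^ r}"

lemma hblock_self [simp]: "x \<in> hblock n r x"
  by (simp add: hblock_def)

lemma hblock_eqI: "y \<in> hblock n r x \<Longrightarrow> hblock n r y = hblock n r x"
  by (auto simp: hblock_def)

lemma div_power_eq_mono:
  fixes x y :: nat
  assumes "x div n ^ r = y div n ^ r" "r \<le> s"
  shows "x div n ^ s = y div n ^ s"
proof -
  have "n ^ s = n ^ r * n ^ (s - r)" using assms(2) by (simp flip: power_add)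
  thus ?thesis using assms(1) by (simp add: div_mult2_eq)
qed

lemma hblock_mono: "r \<le> s \<Longrightarrow> hblock n r x \<subseteq> hblock n s x"
  unfolding hblock_def by (blast intro: div_power_eq_mono)

lemma hblock_subset: "y \<in> hblock n s x \<Longrightarrow> r \<le> s \<Longrightarrow> hblock n r y \<subseteq> hblock n s x"
  using hblock_mono hblock_eqI by metis

lemma hblock_eq_interval:
  assumes "n > 0"
  shows "hblock n r x = {x div n ^ r * n ^ r..<x div n ^ r * n ^ r + n ^ r}"
proof -
  have N: "n ^ r > 0" using assms by simp
  have "y div n ^ r = q \<longleftrightarrow> q * n ^ r \<le> y \<and> y < q * n ^ r + n ^ r" for y q
  proof
    assume "y div n ^ r = q"
    thus "q * n ^ r \<le> y \<and> y < q * n ^ r + n ^ r"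
      using N div_times_less_eq_dividend[of y "n ^ r"] dividend_less_div_times[OF N, of y] by simp
  qed (auto intro!: div_nat_eqI simp: algebra_simps)
  thus ?thesis by (auto simp: hblock_def)
qed

lemma finite_hblock [simp]: "n > 0 \<Longrightarrow> finite (hblock n r x)"
  by (simp add: hblock_eq_interval)

lemma card_hblock [simp]: "n > 0 \<Longrightarrow> card (hblock n r x) = n ^ r"
  by (simp add: hblock_eq_interval)

text \<open>Every site satisfies the hypothesis once k is large, so balls around different centres
  eventually coincide.\<close>

lemma hblock_eq_initial:
  assumes "n > 0" "x < n ^ k"
  shows "hblock n k x = {..<n ^ k}"
  using assms by (simp add: hblock_eq_interval lessThan_atLeast0)

text \<open>Both quotients vanish at the exponent x + y, so the \<open>LEAST\<close> in
  \<open>hdist\<close> is attained; equal quotients stay equal at larger exponents.\<close>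

lemma hdist_le_iff:
  assumes "n \<ge> 2"
  shows "hdist n x y \<le> r \<longleftrightarrow> x div n ^ r = y div n ^ r"
proof
  have lt: "m < n ^ m" for m
    using assms less_exp[of m] power_mono[of 2 n m] by linarith
  have "x div n ^ (x + y) = 0" "y div n ^ (x + y) = 0"
    using lt[of "x + y"] by auto
  hence "x div n ^ hdist n x y = y div n ^ hdist n x y"
    unfolding hdist_def by (intro LeastI[of "\<lambda>r. x div n ^ r = y div n ^ r" "x + y"]) simp
  thus "x div n ^ r = y div n ^ r" if "hdist n x y \<le> r" using div_power_eq_mono that by blast
  show "hdist n x y \<le> r" if "x div n ^ r = y div n ^ r"
    unfolding hdist_def using that by (rule Least_le)
qed

lemma hball_eq_hblock: "n \<ge> 2 \<Longrightarrow> hball n x r = hblock n r x"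
  by (auto simp: hball_def hblock_def hdist_le_iff)

lemma Eop_eq_hblock: "n \<ge> 2 \<Longrightarrow> Eop n r \<psi> x = (1 / of_nat n ^ r) * (\<Sum>y\<in>hblock n r x. \<psi> y)"
  by (simp add: Eop_def hblock_def hdist_le_iff)

text \<open>Acts on functions on all sites rather than on one block, so that different truncation
  levels and the full operator apply to the same function.\<close>

definition Hfin :: "nat \<Rightarrow> (nat \<Rightarrow> real) \<Rightarrow> nat \<Rightarrow> (nat \<Rightarrow> real) \<Rightarrow> (nat \<Rightarrow> complex) \<Rightarrow> nat \<Rightarrow> complex" where
  "Hfin n p k \<omega> \<psi> x = (\<Sum>s=1..k. of_real (p s) * Eop n s \<psi> x) + of_real (\<omega> x) * \<psi> x"

definition Hkernel :: "nat \<Rightarrow> (nat \<Rightarrow> real) \<Rightarrow> nat \<Rightarrow> (nat \<Rightarrow> real) \<Rightarrow> nat \<Rightarrow> nat \<Rightarrow> real" where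
  "Hkernel n p k \<omega> x y =
    (\<Sum>s=1..k. p s * (if x div n ^ s = y div n ^ s then 1 / real n ^ s else 0)) + (if x = y then \<omega> x else 0)"

lemma Hkernel_sym: "Hkernel n p k \<omega> x y = Hkernel n p k \<omega> y x"
  unfolding Hkernel_def by (intro arg_cong2[of _ _ _ _ "(+)"] sum.cong) auto

lemma Hk_mat_eq_Hkernel:
  assumes "n \<ge> 2"
  shows "Hk_mat n p x k \<omega> = mat (n ^ k) (n ^ k)
    (\<lambda>(i, j). Hkernel n p k \<omega> (x div n ^ k * n ^ k + i) (x div n ^ k * n ^ k + j))"
  using assms by (auto simp: Hk_mat_def Let_def Hkernel_def hdist_le_iff intro!: eq_matI)

lemma Eop_eq_sum_hblock:
  assumes n: "n \<ge> 2" and y: "y \<in> hblock n k x" and s: "s \<le> k"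
  shows "Eop n s \<psi> y = (\<Sum>y'\<in>hblock n k x. of_real (if y div n ^ s = y' div n ^ s then 1 / real n ^ s else 0) * \<psi> y')"
proof -
  have "(\<Sum>y'\<in>hblock n k x. of_real (if y div n ^ s = y' div n ^ s then 1 / real n ^ s else 0) * \<psi> y')
      = (\<Sum>y'\<in>hblock n k x. if y' \<in> hblock n s y then 1 / of_nat n ^ s * \<psi> y' else 0)"
    by (intro sum.cong) (auto simp: hblock_def)
  also have "\<dots> = (\<Sum>y'\<in>hblock n k x \<inter> hblock n s y. 1 / of_nat n ^ s * \<psi> y')"
    by (rule sum.inter_restrict[symmetric]) (use n in simp)
  also have "hblock n k x \<inter> hblock n s y = hblock n s y" using hblock_subset[OF y s] by blast
  finally show ?thesis using n by (simp add: Eop_eq_hblock sum_distrib_left)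
qed

text \<open>Averages of level at most \<open>k\<close> do not leave a block of level
  \<open>K\<close>. Allowing \<open>K\<close> above \<open>k\<close> is what later makes two
  truncations comparable on one block.\<close>

lemma Hfin_eq_Hkernel:
  assumes n: "n \<ge> 2" and y: "y \<in> hblock n K x" and k: "k \<le> K"
  shows "Hfin n p k \<omega> \<psi> y = (\<Sum>y'\<in>hblock n K x. of_real (Hkernel n p k \<omega> y y') * \<psi> y')"
proof -
  have "(\<Sum>s=1..k. of_real (p s) * Eop n s \<psi> y) = (\<Sum>s=1..k. \<Sum>y'\<in>hblock n K x.
      of_real (p s * (if y div n ^ s = y' div n ^ s then 1 / real n ^ s else 0)) * \<psi> y')"
    using k by (intro sum.cong refl) (simp add: Eop_eq_sum_hblock[OF n y] sum_distrib_left mult_ac)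
  also have "\<dots> = (\<Sum>y'\<in>hblock n K x. \<Sum>s=1..k.
      of_real (p s * (if y div n ^ s = y' div n ^ s then 1 / real n ^ s else 0)) * \<psi> y')"
    by (rule sum.swap)
  moreover have "of_real (\<omega> y) * \<psi> y = (\<Sum>y'\<in>hblock n K x. of_real (if y = y' then \<omega> y else 0) * \<psi> y')"
  proof -
    have "(\<Sum>y'\<in>hblock n K x. of_real (if y = y' then \<omega> y else 0) * \<psi> y')
      = (\<Sum>y'\<in>hblock n K x. if y = y' then of_real (\<omega> y) * \<psi> y else 0)" by (intro sum.cong) auto
    thus ?thesis using n y by simp
  qed
  ultimately show ?thesis unfolding Hfin_def Hkernel_def
    by (simp only: of_real_add of_real_sum distrib_right sum_distrib_right sum.distrib)
qed

lemma Hfin_resolvent_bound: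
  assumes "n \<ge> 2" "k \<le> K" "Im z > 0"
    and "\<And>y. y \<in> hblock n K x \<Longrightarrow> Hfin n p k \<omega> \<psi> y - z * \<psi> y = f y"
  shows "Im z * L2_set (\<lambda>y. cmod (\<psi> y)) (hblock n K x) \<le> L2_set (\<lambda>y. cmod (f y)) (hblock n K x)"
proof (rule symmetric_kernel_resolvent_bound)
  show "finite (hblock n K x)" using assms(1) by simp
  show "Hkernel n p k \<omega> y y' = Hkernel n p k \<omega> y' y" for y y' by (rule Hkernel_sym)
  show "(\<Sum>y'\<in>hblock n K x. of_real (Hkernel n p k \<omega> y y') * \<psi> y') - z * \<psi> y = f y"
    if "y \<in> hblock n K x" for y
    using assms(4)[OF that] Hfin_eq_Hkernel[OF assms(1) that assms(2)] by simp
qed fact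

section \<open>Contractivity of the averaging operators\<close>

lemma sum_hblock_swap:
  assumes n: "n \<ge> 2" and s: "s \<le> k"
  shows "(\<Sum>y\<in>hblock n k x. \<Sum>y'\<in>hblock n s y. g y') = real n ^ s * (\<Sum>y\<in>hblock n k x. g y :: real)"
proof -
  let ?S = "hblock n k x"
  have fin: "finite (hblock n r y)" for r y using n by simp
  have *: "(\<Sum>y'\<in>hblock n s y. h y') = (\<Sum>y'\<in>?S. if y' \<in> hblock n s y then h y' else 0)"
    if "y \<in> ?S" for y and h :: "nat \<Rightarrow> real"
    using hblock_subset[OF that s] fin by (subst sum.inter_restrict[symmetric]) (auto intro!: sum.cong)
  have "(\<Sum>y\<in>?S. \<Sum>y'\<in>hblock n s y. g y') = (\<Sum>y\<in>?S. \<Sum>y'\<in>?S. if y' \<in> hblock n s y then g y' else 0)"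
    by (intro sum.cong refl *)
  also have "\<dots> = (\<Sum>y'\<in>?S. \<Sum>y\<in>?S. if y \<in> hblock n s y' then g y' else 0)"
    by (subst sum.swap) (auto intro!: sum.cong simp: hblock_def)
  also have "\<dots> = (\<Sum>y'\<in>?S. \<Sum>y\<in>hblock n s y'. g y')" by (intro sum.cong refl *[symmetric])
  also have "\<dots> = (\<Sum>y'\<in>?S. real n ^ s * g y')" using n by simp
  finally show ?thesis by (simp add: sum_distrib_left)
qed

lemma cmod_Eop_sq_le:
  assumes "n \<ge> 2"
  shows "(cmod (Eop n s \<psi> y))\<^sup>2 \<le> (1 / real n ^ s) * (\<Sum>y'\<in>hblock n s y. (cmod (\<psi> y'))\<^sup>2)"
proof -
  have n0: "real n ^ s > 0" using assms by simp
  have "(cmod (\<Sum>y'\<in>hblock n s y. \<psi> y'))\<^sup>2 \<le> (\<Sum>y'\<in>hblock n s y. cmod (\<psi> y'))\<^sup>2"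
    by (intro power_mono norm_sum) simp
  also have "\<dots> \<le> (\<Sum>y'\<in>hblock n s y. (cmod (\<psi> y'))\<^sup>2) * card (hblock n s y)"
    by (rule sum_squared_le_sum_of_squares)
  also have "real (card (hblock n s y)) = real n ^ s" using assms by simp
  finally have "(cmod (\<Sum>y'\<in>hblock n s y. \<psi> y'))\<^sup>2 / (real n ^ s)\<^sup>2
      \<le> (\<Sum>y'\<in>hblock n s y. (cmod (\<psi> y'))\<^sup>2) * real n ^ s / (real n ^ s)\<^sup>2"
    by (rule divide_right_mono) simp
  moreover have "(cmod (Eop n s \<psi> y))\<^sup>2 = (cmod (\<Sum>y'\<in>hblock n s y. \<psi> y'))\<^sup>2 / (real n ^ s)\<^sup>2"
    using assms by (simp add: Eop_eq_hblock norm_divide norm_power power_divide)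
  moreover have "(\<Sum>y'\<in>hblock n s y. (cmod (\<psi> y'))\<^sup>2) * real n ^ s / (real n ^ s)\<^sup>2
      = (1 / real n ^ s) * (\<Sum>y'\<in>hblock n s y. (cmod (\<psi> y'))\<^sup>2)"
    using n0 by (simp add: power2_eq_square)
  ultimately show ?thesis by simp
qed

text \<open>Cauchy-Schwarz in each block of level s bounds the squared average by the mean of the
  squares; summing over the large block counts every site n^s times, which cancels the factor 1 /
  n^s.\<close>

lemma L2_set_Eop_le:
  assumes "n \<ge> 2" "s \<le> k"
  shows "L2_set (\<lambda>y. cmod (Eop n s \<psi> y)) (hblock n k x) \<le> L2_set (\<lambda>y. cmod (\<psi> y)) (hblock n k x)"
proof -
  have "(\<Sum>y\<in>hblock n k x. (cmod (Eop n s \<psi> y))\<^sup>2)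
      \<le> (\<Sum>y\<in>hblock n k x. (1 / real n ^ s) * (\<Sum>y'\<in>hblock n s y. (cmod (\<psi> y'))\<^sup>2))"
    by (intro sum_mono cmod_Eop_sq_le assms)
  also have "\<dots> = (\<Sum>y\<in>hblock n k x. (cmod (\<psi> y))\<^sup>2)"
    using assms(1) by (simp add: sum_distrib_left[symmetric] sum_hblock_swap[OF assms] sum_divide_distrib[symmetric])
  finally show ?thesis by (simp add: L2_set_def)
qed

lemma L2_set_sum_le:
  assumes "finite I"
  shows "L2_set (\<lambda>x. \<Sum>i\<in>I. f i x) S \<le> (\<Sum>i\<in>I. L2_set (f i) S)"
  using assms
proof (induction I)
  case empty
  show ?case by (simp add: L2_set_def)
next
  case (insert i I)
  have "(\<lambda>x. \<Sum>i\<in>insert i I. f i x) = (\<lambda>x. f i x + (\<Sum>i\<in>I. f i x))" using insert.hyps by auto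
  thus ?case using L2_set_triangle_ineq[of "f i" "\<lambda>x. \<Sum>i\<in>I. f i x" S] insert.hyps insert.IH by auto
qed

lemma L2_set_sum_Eop_le:
  fixes p :: "nat \<Rightarrow> real"
  assumes "n \<ge> 2" "finite I" "\<And>s. s \<in> I \<Longrightarrow> s \<le> k \<and> 0 \<le> p s"
  shows "L2_set (\<lambda>y. cmod (\<Sum>s\<in>I. of_real (p s) * Eop n s \<psi> y)) (hblock n k x)
    \<le> (\<Sum>s\<in>I. p s) * L2_set (\<lambda>y. cmod (\<psi> y)) (hblock n k x)"
proof -
  let ?L = "\<lambda>\<phi>. L2_set \<phi> (hblock n k x)"
  have "?L (\<lambda>y. cmod (\<Sum>s\<in>I. of_real (p s) * Eop n s \<psi> y)) \<le> ?L (\<lambda>y. \<Sum>s\<in>I. p s * cmod (Eop n s \<psi> y))"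
  proof (rule L2_set_mono)
    fix y
    show "cmod (\<Sum>s\<in>I. of_real (p s) * Eop n s \<psi> y) \<le> (\<Sum>s\<in>I. p s * cmod (Eop n s \<psi> y))"
      by (rule sum_norm_le) (use assms(3) in \<open>auto simp: norm_mult\<close>)
  qed simp
  moreover have "?L (\<lambda>y. \<Sum>s\<in>I. p s * cmod (Eop n s \<psi> y)) \<le> (\<Sum>s\<in>I. ?L (\<lambda>y. p s * cmod (Eop n s \<psi> y)))"
    by (rule L2_set_sum_le[OF assms(2)])
  moreover have "(\<Sum>s\<in>I. ?L (\<lambda>y. p s * cmod (Eop n s \<psi> y))) \<le> (\<Sum>s\<in>I. p s * ?L (\<lambda>y. cmod (\<psi> y)))"
  proof (rule sum_mono)
    fix s assume s: "s \<in> I"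
    have "?L (\<lambda>y. p s * cmod (Eop n s \<psi> y)) = p s * ?L (\<lambda>y. cmod (Eop n s \<psi> y))"
      by (rule L2_set_right_distrib[symmetric]) (use assms(3)[OF s] in blast)
    thus "?L (\<lambda>y. p s * cmod (Eop n s \<psi> y)) \<le> p s * ?L (\<lambda>y. cmod (\<psi> y))"
      using assms(3)[OF s] L2_set_Eop_le[OF assms(1), of s k \<psi> x] by (metis mult_left_mono)
  qed
  ultimately show ?thesis unfolding sum_distrib_right by linarith
qed

text \<open>The weights are squared entries of orthonormal eigenvectors: row \<open>x\<close>,
  placed at the points \<open>e i\<close>, is the spectral measure at \<open>x\<close>, whose mass,
  second moment and Stieltjes transform are listed. The unit column sums turn sums over sites into
  sums over eigenvalues.\<close>

lemma symmetric_kernel_resolvent_spectral: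
  fixes a :: "nat \<Rightarrow> nat \<Rightarrow> real"
  assumes sym: "\<And>x y. x < N \<Longrightarrow> y < N \<Longrightarrow> a x y = a y x"
  obtains W :: "nat \<Rightarrow> nat \<Rightarrow> real" and e :: "nat \<Rightarrow> real" where
    "\<And>x i. 0 \<le> W x i"
    "\<And>x. x < N \<Longrightarrow> (\<Sum>i<N. W x i) = 1"
    "\<And>i. i < N \<Longrightarrow> (\<Sum>x<N. W x i) = 1"
    "\<And>x. x < N \<Longrightarrow> (\<Sum>i<N. W x i * (e i)\<^sup>2) = (\<Sum>y<N. (a x y)\<^sup>2)"
    "\<And>x z. x < N \<Longrightarrow> Im z > 0 \<Longrightarrow> \<exists>\<psi>. (\<forall>y<N. (\<Sum>y'<N. of_real (a y y') * \<psi> y') - z * \<psi> y = (if y = x then 1 else 0))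
       \<and> \<psi> x = (\<Sum>i<N. of_real (W x i) / (of_real (e i) - z))"
    "proots (char_poly (mat N N (\<lambda>(i, j). a i j))) = image_mset e (mset_set {..<N})"
proof -
  obtain U e where U1: "\<And>i j. i < N \<Longrightarrow> j < N \<Longrightarrow> (\<Sum>x<N. U x i * U x j) = (if i = j then 1 else 0)"
    and U2: "\<And>x y. x < N \<Longrightarrow> y < N \<Longrightarrow> (\<Sum>i<N. U x i * U y i) = (if x = y then 1 else 0)"
    and a: "\<And>x y. x < N \<Longrightarrow> y < N \<Longrightarrow> a x y = (\<Sum>i<N. U x i * e i * U y i)"
    and cp: "proots (char_poly (mat N N (\<lambda>(i, j). a i j))) = image_mset e (mset_set {..<N})"
    by (rule symmetric_kernel_spectral_decomposition[of N a, OF sym]) (assumption, assumption, rule that)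
  have eig: "(\<Sum>y<N. a x y * U y i) = e i * U x i" if "x < N" "i < N" for x i
  proof -
    have "(\<Sum>y<N. a x y * U y i) = (\<Sum>y<N. \<Sum>j<N. U x j * e j * (U y j * U y i))"
      using that by (intro sum.cong refl) (simp add: a sum_distrib_right sum_distrib_left mult_ac)
    also have "\<dots> = (\<Sum>j<N. \<Sum>y<N. U x j * e j * (U y j * U y i))" by (rule sum.swap)
    also have "\<dots> = (\<Sum>j<N. U x j * e j * (if j = i then 1 else 0))"
      using that by (simp add: sum_distrib_left[symmetric] U1)
    also have "\<dots> = (\<Sum>j<N. if j = i then U x i * e i else 0)" by (intro sum.cong) auto
    finally show ?thesis using that by simp
  qed
  show thesis
  proof (rule that[of "\<lambda>x i. (U x i)\<^sup>2" e])
    show "(\<Sum>i<N. (U x i)\<^sup>2) = 1" if "x < N" for x using U2[OF that that] by (simp add: power2_eq_square)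
    show "(\<Sum>x<N. (U x i)\<^sup>2) = 1" if "i < N" for i using U1[OF that that] by (simp add: power2_eq_square)
    show "(\<Sum>i<N. (U x i)\<^sup>2 * (e i)\<^sup>2) = (\<Sum>y<N. (a x y)\<^sup>2)" if x: "x < N" for x
    proof -
      \<comment> \<open>Parseval's identity for row \<open>x\<close> of \<open>a\<close>, whose
        coefficients in the eigenbasis are \<open>e i * U x i\<close>.\<close>
      have "(\<Sum>i<N. (U x i)\<^sup>2 * (e i)\<^sup>2) = (\<Sum>i<N. (\<Sum>y<N. a x y * U y i) * (\<Sum>y'<N. a x y' * U y' i))"
        using x by (intro sum.cong refl) (simp only: eig lessThan_iff, simp add: power2_eq_square)
      also have "\<dots> = (\<Sum>i<N. \<Sum>y<N. \<Sum>y'<N. a x y * a x y' * (U y i * U y' i))"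
        by (simp add: sum_product mult_ac)
      also have "\<dots> = (\<Sum>y<N. \<Sum>i<N. \<Sum>y'<N. a x y * a x y' * (U y i * U y' i))" by (rule sum.swap)
      also have "\<dots> = (\<Sum>y<N. \<Sum>y'<N. \<Sum>i<N. a x y * a x y' * (U y i * U y' i))"
        by (intro sum.cong refl sum.swap)
      also have "\<dots> = (\<Sum>y<N. \<Sum>y'<N. if y' = y then (a x y)\<^sup>2 else 0)"
        by (intro sum.cong refl) (auto simp: sum_distrib_left[symmetric] U2 power2_eq_square)
      finally show ?thesis by simp
    qed
    fix x :: nat and z :: complex assume x: "x < N" and z: "Im z > 0"
    have ez: "of_real (e i) - z \<noteq> 0" for i using z by (auto simp: complex_eq_iff)
    \<comment> \<open>The eigenvector expansion of the resolvent column at \<open>x\<close>.\<close>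
    define \<psi> where "\<psi> y = (\<Sum>i<N. of_real (U y i) * (of_real (U x i) / (of_real (e i) - z)))" for y
    have "(\<Sum>y'<N. of_real (a y y') * \<psi> y') - z * \<psi> y = (if y = x then 1 else 0)" if y: "y < N" for y
    proof -
      have "(\<Sum>y'<N. of_real (a y y') * \<psi> y')
          = (\<Sum>y'<N. \<Sum>i<N. of_real (a y y' * U y' i) * (of_real (U x i) / (of_real (e i) - z)))"
        by (simp add: \<psi>_def sum_distrib_left mult_ac)
      also have "\<dots> = (\<Sum>i<N. \<Sum>y'<N. of_real (a y y' * U y' i) * (of_real (U x i) / (of_real (e i) - z)))"
        by (rule sum.swap)
      also have "\<dots> = (\<Sum>i<N. of_real (e i * U y i) * (of_real (U x i) / (of_real (e i) - z)))"
        using y by (simp only: sum_distrib_right[symmetric] of_real_sum[symmetric]) (simp add: eig)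
      finally have "(\<Sum>y'<N. of_real (a y y') * \<psi> y') - z * \<psi> y
          = (\<Sum>i<N. of_real (e i * U y i) * (of_real (U x i) / (of_real (e i) - z)))
            - z * (\<Sum>i<N. of_real (U y i) * (of_real (U x i) / (of_real (e i) - z)))"
        by (simp only: \<psi>_def)
      also have "\<dots> = (\<Sum>i<N. of_real (U y i * U x i) * ((of_real (e i) - z) / (of_real (e i) - z)))"
        unfolding sum_distrib_left sum_subtractf[symmetric]
        by (intro sum.cong refl) (simp only: divide_inverse of_real_mult, simp only: algebra_simps)
      also have "\<dots> = of_real (\<Sum>i<N. U y i * U x i)" using ez by simp
      finally show ?thesis using U2[OF y x] by simp
    qed
    thus "\<exists>\<psi>. (\<forall>y<N. (\<Sum>y'<N. of_real (a y y') * \<psi> y') - z * \<psi> y = (if y = x then 1 else 0))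
       \<and> \<psi> x = (\<Sum>i<N. of_real ((U x i)\<^sup>2) / (of_real (e i) - z))"
      by (intro exI[of _ \<psi>]) (simp add: \<psi>_def power2_eq_square)
  qed (simp_all add: cp)
qed

text \<open>The resolvent column at \<open>x\<close>, extended by zero so that columns of all levels
  are functions on the same set. It is a predicate because existence needs the spectral
  decomposition and uniqueness the a priori bound.\<close>

definition fv_resolvent ::
    "nat \<Rightarrow> (nat \<Rightarrow> real) \<Rightarrow> nat \<Rightarrow> (nat \<Rightarrow> real) \<Rightarrow> complex \<Rightarrow> nat \<Rightarrow> (nat \<Rightarrow> complex) \<Rightarrow> bool" where
  "fv_resolvent n p k \<omega> z x \<psi> \<longleftrightarrow> (\<forall>y. y \<notin> hblock n k x \<longrightarrow> \<psi> y = 0) \<and>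
    (\<forall>y\<in>hblock n k x. Hfin n p k \<omega> \<psi> y - z * \<psi> y = (if y = x then 1 else 0))"

lemma fv_spectral:
  assumes n: "n \<ge> 2"
  obtains W :: "nat \<Rightarrow> nat \<Rightarrow> real" and e :: "nat \<Rightarrow> real" where
    "\<And>y i. 0 \<le> W y i"
    "\<And>y. y \<in> hblock n k x \<Longrightarrow> (\<Sum>i<n ^ k. W y i) = 1"
    "\<And>i. i < n ^ k \<Longrightarrow> (\<Sum>y\<in>hblock n k x. W y i) = 1"
    "\<And>y. y \<in> hblock n k x \<Longrightarrow> (\<Sum>i<n ^ k. W y i * (e i)\<^sup>2) = (\<Sum>y'\<in>hblock n k x. (Hkernel n p k \<omega> y y')\<^sup>2)"
    "\<And>y z. y \<in> hblock n k x \<Longrightarrow> Im z > 0 \<Longrightarrow> \<exists>\<psi>. fv_resolvent n p k \<omega> z y \<psi>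
       \<and> \<psi> y = (\<Sum>i<n ^ k. of_real (W y i) / (of_real (e i) - z))"
    "Hk_eigs n p x k \<omega> = image_mset e (mset_set {..<n ^ k})"
proof -
  define b where "b = x div n ^ k * n ^ k"
  let ?N = "n ^ k" and ?B = "hblock n k x"
  have B: "?B = {b..<b + ?N}" using n by (simp add: hblock_eq_interval b_def)
  have re: "(\<Sum>y\<in>?B. g y) = (\<Sum>i<?N. g (b + i))" for g :: "nat \<Rightarrow> 'z :: comm_monoid_add"
    unfolding B by (rule sum.reindex_bij_witness[of _ "\<lambda>i. b + i" "\<lambda>y. y - b"]) auto
  have Bi: "y \<in> ?B \<Longrightarrow> y - b < ?N \<and> b + (y - b) = y" for y unfolding B by auto
  obtain W e where W: "\<And>x i. 0 \<le> W x i"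
    "\<And>x. x < ?N \<Longrightarrow> (\<Sum>i<?N. W x i) = 1"
    "\<And>i. i < ?N \<Longrightarrow> (\<Sum>x<?N. W x i) = 1"
    "\<And>x. x < ?N \<Longrightarrow> (\<Sum>i<?N. W x i * (e i)\<^sup>2) = (\<Sum>y<?N. (Hkernel n p k \<omega> (b + x) (b + y))\<^sup>2)"
    "\<And>x z. x < ?N \<Longrightarrow> Im z > 0 \<Longrightarrow> \<exists>\<psi>. (\<forall>y<?N. (\<Sum>y'<?N. of_real (Hkernel n p k \<omega> (b + y) (b + y')) * \<psi> y') - z * \<psi> y
        = (if y = x then 1 else 0)) \<and> \<psi> x = (\<Sum>i<?N. of_real (W x i) / (of_real (e i) - z))"
    "proots (char_poly (mat ?N ?N (\<lambda>(i, j). Hkernel n p k \<omega> (b + i) (b + j)))) = image_mset e (mset_set {..<?N})"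
    by (rule symmetric_kernel_resolvent_spectral[of ?N "\<lambda>i j. Hkernel n p k \<omega> (b + i) (b + j)", OF Hkernel_sym])
      (rule that)
  show thesis
  proof (rule that[of "\<lambda>y. W (y - b)" e])
    show "(\<Sum>i<?N. W (y - b) i) = 1" if "y \<in> ?B" for y using W(2) Bi[OF that] by blast
    show "(\<Sum>y\<in>?B. W (y - b) i) = 1" if "i < ?N" for i using W(3)[OF that] by (simp add: re)
    show "(\<Sum>i<?N. W (y - b) i * (e i)\<^sup>2) = (\<Sum>y'\<in>?B. (Hkernel n p k \<omega> y y')\<^sup>2)" if "y \<in> ?B" for y
      using W(4)[of "y - b"] Bi[OF that] by (simp add: re)
    show "Hk_eigs n p x k \<omega> = image_mset e (mset_set {..<?N})"
      unfolding Hk_eigs_def Hk_mat_eq_Hkernel[OF n] b_def[symmetric] by (rule W(6))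
    fix y :: nat and z :: complex assume y: "y \<in> ?B" and z: "Im z > 0"
    obtain \<psi> where \<psi>: "\<And>v. v < ?N \<Longrightarrow> (\<Sum>y'<?N. of_real (Hkernel n p k \<omega> (b + v) (b + y')) * \<psi> y') - z * \<psi> v
        = (if v = y - b then 1 else 0)" "\<psi> (y - b) = (\<Sum>i<?N. of_real (W (y - b) i) / (of_real (e i) - z))"
      using W(5)[of "y - b" z] Bi[OF y] z by blast
    define \<phi> where "\<phi> v = (if v \<in> ?B then \<psi> (v - b) else 0)" for v
    have "fv_resolvent n p k \<omega> z y \<phi>"
      unfolding fv_resolvent_def hblock_eqI[OF y]
    proof (intro conjI allI ballI impI)
      fix v assume v: "v \<in> ?B"
      have "Hfin n p k \<omega> \<phi> v = (\<Sum>y'<?N. of_real (Hkernel n p k \<omega> v (b + y')) * \<psi> y')"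
        unfolding Hfin_eq_Hkernel[OF n v order_refl] re by (intro sum.cong refl) (simp add: \<phi>_def B)
      also have "\<dots> - z * \<phi> v = (if v = y then 1 else 0)"
        using \<psi>(1)[of "v - b"] Bi[OF v] Bi[OF y] v by (auto simp: \<phi>_def)
      finally show "Hfin n p k \<omega> \<phi> v - z * \<phi> v = (if v = y then 1 else 0)" .
    qed (simp add: \<phi>_def)
    thus "\<exists>\<psi>. fv_resolvent n p k \<omega> z y \<psi> \<and> \<psi> y = (\<Sum>i<?N. of_real (W (y - b) i) / (of_real (e i) - z))"
      using \<psi>(2) y by (intro exI[of _ \<phi>]) (auto simp: \<phi>_def)
  qed (rule W(1))
qed

section \<open>Finite-volume resolvents and their limit\<close>

lemma norm_le_L2_set:
  assumes "finite S" "y \<in> S"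
  shows "cmod (f y) \<le> L2_set (\<lambda>y. cmod (f y)) S"
  using member_le_L2_set[OF assms, of "\<lambda>y. cmod (f y)"] by simp

text \<open>The extension by zero solves the equation at outside sites too, since their blocks of
  level at most k miss the block of \<open>x\<close>.\<close>

lemma fv_resolvent_eq:
  assumes n: "n \<ge> 2" and R: "fv_resolvent n p k \<omega> z x \<psi>"
  shows "Hfin n p k \<omega> \<psi> y - z * \<psi> y = (if y = x then 1 else 0)"
proof (cases "y \<in> hblock n k x")
  case False
  have "Eop n s \<psi> y = 0" if "s \<le> k" for s
  proof -
    have "\<psi> y' = 0" if "y' \<in> hblock n s y" for y'
    proof -
      have "y' \<in> hblock n k y" using hblock_mono[OF \<open>s \<le> k\<close>, of n y] that by blast
      hence "y' \<notin> hblock n k x" using False by (auto simp: hblock_def)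
      thus ?thesis using R by (simp add: fv_resolvent_def)
    qed
    thus ?thesis using n by (simp add: Eop_eq_hblock)
  qed
  moreover have "\<psi> y = 0" using R False by (simp add: fv_resolvent_def)
  ultimately show ?thesis using False by (auto simp: Hfin_def)
qed (use R in \<open>simp add: fv_resolvent_def\<close>)

lemma L2_set_delta:
  assumes "finite S" "x \<in> S"
  shows "L2_set (\<lambda>y. cmod (if y = x then 1 else 0)) S = 1"
proof -
  have "(\<Sum>y\<in>S. (cmod (if y = x then 1 else 0))\<^sup>2) = (\<Sum>y\<in>S. if y = x then 1 else 0)"
    by (intro sum.cong) auto
  thus ?thesis using assms by (simp add: L2_set_def)
qed

lemma Eop_diff: "n \<ge> 2 \<Longrightarrow> Eop n s (\<lambda>y. \<psi> y - \<phi> y) x = Eop n s \<psi> x - Eop n s \<phi> x"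
  by (simp add: Eop_eq_hblock sum_subtractf diff_divide_distrib)

lemma Hfin_diff: "n \<ge> 2 \<Longrightarrow> Hfin n p k \<omega> (\<lambda>y. \<psi> y - \<phi> y) x = Hfin n p k \<omega> \<psi> x - Hfin n p k \<omega> \<phi> x"
  by (simp add: Hfin_def Eop_diff algebra_simps sum_subtractf)

text \<open>The decay n^(-s/2) will be consumed by a sum over the n^k sites of a block. Expressing
  the l2 bound by finite sums lets it serve finite-volume columns and l2 functions in the same
  way.\<close>

lemma cmod_Eop_le:
  assumes n: "n \<ge> 2" and C: "\<And>T. finite T \<Longrightarrow> (\<Sum>y\<in>T. (cmod (\<psi> y))\<^sup>2) \<le> C\<^sup>2" "C \<ge> 0"
  shows "cmod (Eop n s \<psi> y) \<le> C / sqrt (real n ^ s)"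
proof -
  have "(cmod (Eop n s \<psi> y))\<^sup>2 \<le> (1 / real n ^ s) * C\<^sup>2"
    using n by (intro order_trans[OF cmod_Eop_sq_le[OF n]] mult_left_mono C(1)) auto
  also have "\<dots> = (C / sqrt (real n ^ s))\<^sup>2" by (simp add: power_divide)
  finally show ?thesis by (rule power2_le_imp_le) (use C in simp)
qed

lemma cmod_Eop_le':
  assumes n: "n \<ge> 2" and C: "\<And>T. finite T \<Longrightarrow> (\<Sum>y\<in>T. (cmod (\<psi> y))\<^sup>2) \<le> C\<^sup>2" "C \<ge> 0"
  shows "cmod (Eop n s \<psi> y) \<le> C"
proof -
  have "C / sqrt (real n ^ s) \<le> C / 1"
    using n C(2) by (intro divide_left_mono) auto
  thus ?thesis using cmod_Eop_le[OF n C, of s y] by simp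
qed

locale hierarchical_model =
  fixes n :: nat and p :: "nat \<Rightarrow> real"
  assumes n2: "n \<ge> 2" and p_nonneg: "\<And>r. r \<ge> 1 \<Longrightarrow> p r \<ge> 0" and p_sum: "(\<lambda>r. p (Suc r)) sums 1"
begin

text \<open>The mass of \<open>p\<close> beyond level m, hence a norm bound for all averages that
  truncation at m discards.\<close>

definition tail :: "nat \<Rightarrow> real" where
  "tail m = 1 - (\<Sum>r<m. p (Suc r))"

definition R :: "nat \<Rightarrow> (nat \<Rightarrow> real) \<Rightarrow> complex \<Rightarrow> nat \<Rightarrow> nat \<Rightarrow> complex" where
  "R k \<omega> z x = (SOME \<psi>. fv_resolvent n p k \<omega> z x \<psi>)"

definition G :: "nat \<Rightarrow> (nat \<Rightarrow> real) \<Rightarrow> complex \<Rightarrow> nat \<Rightarrow> complex" where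
  "G k \<omega> z x = R k \<omega> z x x"

lemma n_pos: "n > 0"
  using n2 by simp

lemma sum_shift: "(\<Sum>s=1..k. g s) = (\<Sum>r<k. g (Suc r))"
  by (simp add: sum.shift_bounds_cl_Suc_ivl lessThan_atLeast0 atLeastLessThanSuc_atLeastAtMost
      flip: sum.shift_bounds_Suc_ivl)

lemma tail_tendsto: "tail \<longlonglongrightarrow> 0"
  using tendsto_diff[OF tendsto_const p_sum[unfolded sums_def], of 1] by (simp add: tail_def[abs_def])

lemma tail_nonneg: "tail m \<ge> 0"
proof -
  have "(\<Sum>r<m. p (Suc r)) \<le> (\<Sum>r. p (Suc r))"
    using p_sum p_nonneg by (intro sum_le_suminf) (auto simp: sums_iff)
  thus ?thesis using p_sum by (simp add: tail_def sums_iff)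
qed

lemma sum_p_le_tail:
  assumes "m \<le> k"
  shows "(\<Sum>s\<in>{m<..k}. p s) \<le> tail m"
proof -
  have "(\<Sum>s=1..k. p s) = (\<Sum>s=1..m. p s) + (\<Sum>s\<in>{m<..k}. p s)"
    using assms by (subst sum.union_disjoint[symmetric]) (auto intro!: sum.cong)
  thus ?thesis using tail_nonneg[of k] by (simp only: tail_def sum_shift)
qed

lemma sum_p_le: "(\<Sum>s=1..k. p s) \<le> 1"
  using tail_nonneg[of k] by (simp only: tail_def sum_shift)

lemma R_spec:
  assumes "Im z > 0"
  shows "fv_resolvent n p k \<omega> z x (R k \<omega> z x)"
proof -
  obtain W e where W: "\<And>y z. y \<in> hblock n k x \<Longrightarrow> Im z > 0 \<Longrightarrow> \<exists>\<psi>. fv_resolvent n p k \<omega> z y \<psi>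
       \<and> \<psi> y = (\<Sum>i<n ^ k. of_real (W y i :: real) / (of_real (e i) - z))"
    by (rule fv_spectral[OF n2, where p = p and \<omega> = \<omega>]) (rule that)
  have "\<exists>\<psi>. fv_resolvent n p k \<omega> z x \<psi>" using W[OF _ assms, of x] by auto
  thus ?thesis unfolding R_def by (rule someI_ex)
qed

lemma fv_resolvent_unique:
  assumes z: "Im z > 0" and \<psi>: "fv_resolvent n p k \<omega> z x \<psi>" and \<phi>: "fv_resolvent n p k \<omega> z x \<phi>"
  shows "\<psi> = \<phi>"
proof
  fix y
  show "\<psi> y = \<phi> y"
  proof (cases "y \<in> hblock n k x")
    case True
    have "Im z * L2_set (\<lambda>y. cmod (\<psi> y - \<phi> y)) (hblock n k x) \<le> L2_set (\<lambda>y. cmod 0) (hblock n k x)"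
    proof (rule Hfin_resolvent_bound[OF n2 order_refl z])
      fix y
      show "Hfin n p k \<omega> (\<lambda>y. \<psi> y - \<phi> y) y - z * (\<psi> y - \<phi> y) = 0"
        using fv_resolvent_eq[OF n2 \<psi>, of y] fv_resolvent_eq[OF n2 \<phi>, of y]
        by (simp add: Hfin_diff n2 algebra_simps)
    qed
    hence "L2_set (\<lambda>y. cmod (\<psi> y - \<phi> y)) (hblock n k x) \<le> 0"
      using z by (simp add: L2_set_def mult_le_0_iff)
    with norm_le_L2_set[OF finite_hblock[OF n_pos] True, of "\<lambda>y. \<psi> y - \<phi> y"]
    have "cmod (\<psi> y - \<phi> y) \<le> 0" by (rule order_trans)
    thus ?thesis by simp
  qed (use \<psi> \<phi> in \<open>simp add: fv_resolvent_def\<close>)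
qed

lemma R_eqI: "Im z > 0 \<Longrightarrow> fv_resolvent n p k \<omega> z x \<psi> \<Longrightarrow> R k \<omega> z x = \<psi>"
  using fv_resolvent_unique R_spec by blast

lemma G_spectral:
  obtains W :: "nat \<Rightarrow> nat \<Rightarrow> real" and e :: "nat \<Rightarrow> real" where
    "\<And>y i. 0 \<le> W y i"
    "\<And>y. y \<in> hblock n k x \<Longrightarrow> (\<Sum>i<n ^ k. W y i) = 1"
    "\<And>i. i < n ^ k \<Longrightarrow> (\<Sum>y\<in>hblock n k x. W y i) = 1"
    "\<And>y. y \<in> hblock n k x \<Longrightarrow> (\<Sum>i<n ^ k. W y i * (e i)\<^sup>2) = (\<Sum>y'\<in>hblock n k x. (Hkernel n p k \<omega> y y')\<^sup>2)"
    "\<And>y z. y \<in> hblock n k x \<Longrightarrow> Im z > 0 \<Longrightarrow> G k \<omega> z y = (\<Sum>i<n ^ k. of_real (W y i) / (of_real (e i) - z))"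
    "Hk_eigs n p x k \<omega> = image_mset e (mset_set {..<n ^ k})"
proof -
  obtain W e where W: "\<And>y i. 0 \<le> W y i"
    "\<And>y. y \<in> hblock n k x \<Longrightarrow> (\<Sum>i<n ^ k. W y i) = 1"
    "\<And>i. i < n ^ k \<Longrightarrow> (\<Sum>y\<in>hblock n k x. W y i) = 1"
    "\<And>y. y \<in> hblock n k x \<Longrightarrow> (\<Sum>i<n ^ k. W y i * (e i)\<^sup>2) = (\<Sum>y'\<in>hblock n k x. (Hkernel n p k \<omega> y y')\<^sup>2)"
    "\<And>y z. y \<in> hblock n k x \<Longrightarrow> Im z > 0 \<Longrightarrow> \<exists>\<psi>. fv_resolvent n p k \<omega> z y \<psi>
       \<and> \<psi> y = (\<Sum>i<n ^ k. of_real (W y i) / (of_real (e i) - z))"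
    "Hk_eigs n p x k \<omega> = image_mset e (mset_set {..<n ^ k})"
    by (rule fv_spectral[OF n2, where p = p and \<omega> = \<omega>]) (rule that)
  show thesis
  proof (rule that[of W e])
    show "G k \<omega> z y = (\<Sum>i<n ^ k. of_real (W y i) / (of_real (e i) - z))"
      if "y \<in> hblock n k x" "Im z > 0" for y z
    proof -
      obtain \<psi> where "fv_resolvent n p k \<omega> z y \<psi>" "\<psi> y = (\<Sum>i<n ^ k. of_real (W y i) / (of_real (e i) - z))"
        using W(5)[OF \<open>y \<in> hblock n k x\<close> \<open>Im z > 0\<close>] by blast
      thus ?thesis using R_eqI that by (simp add: G_def)
    qed
  qed (fact W)+
qed

lemma L2_set_R_le:
  assumes z: "Im z > 0" and "k \<le> K"
  shows "L2_set (\<lambda>y. cmod (R k \<omega> z x y)) (hblock n K x) \<le> 1 / Im z"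
proof -
  have "Im z * L2_set (\<lambda>y. cmod (R k \<omega> z x y)) (hblock n K x)
      \<le> L2_set (\<lambda>y. cmod (if y = x then 1 else 0)) (hblock n K x)"
    by (rule Hfin_resolvent_bound[OF n2 assms(2) z]) (rule fv_resolvent_eq[OF n2 R_spec[OF z]])
  thus ?thesis using z n_pos by (simp only: L2_set_delta finite_hblock hblock_self) (simp add: field_simps)
qed

lemma sum_R_le:
  assumes z: "Im z > 0" and "finite T"
  shows "(\<Sum>y\<in>T. (cmod (R k \<omega> z x y))\<^sup>2) \<le> (1 / Im z)\<^sup>2"
proof -
  have "(\<Sum>y\<in>T. (cmod (R k \<omega> z x y))\<^sup>2) = (\<Sum>y\<in>T \<inter> hblock n k x. (cmod (R k \<omega> z x y))\<^sup>2)"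
    using assms R_spec[OF z, of k \<omega> x] by (intro sum.mono_neutral_right) (auto simp: fv_resolvent_def)
  also have "\<dots> \<le> (\<Sum>y\<in>hblock n k x. (cmod (R k \<omega> z x y))\<^sup>2)"
    using n_pos by (intro sum_mono2) auto
  also have "\<dots> = (L2_set (\<lambda>y. cmod (R k \<omega> z x y)) (hblock n k x))\<^sup>2"
    by (simp add: L2_set_def sum_nonneg)
  also have "\<dots> \<le> (1 / Im z)\<^sup>2" by (intro power_mono L2_set_R_le z) (auto simp: L2_set_nonneg)
  finally show ?thesis .
qed

lemma cmod_R_le:
  assumes "Im z > 0"
  shows "cmod (R k \<omega> z x y) \<le> 1 / Im z"
  by (rule power2_le_imp_le) (use sum_R_le[OF assms, of "{y}" k \<omega> x] assms in auto)

lemma cmod_G_le: "Im z > 0 \<Longrightarrow> cmod (G k \<omega> z x) \<le> 1 / Im z"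
  unfolding G_def by (rule cmod_R_le)

text \<open>Second resolvent identity: on the larger block the difference solves the level-k
  equation with the discarded averages of the level-m column on the right. One factor 1 / Im z
  bounds that column, the other comes from inverting.\<close>

lemma cmod_R_diff_le:
  assumes z: "Im z > 0" and mk: "m \<le> k"
  shows "cmod (R k \<omega> z x y - R m \<omega> z x y) \<le> tail m / (Im z)\<^sup>2"
proof (cases "y \<in> hblock n k x")
  case True
  let ?B = "hblock n k x" and ?f = "\<lambda>y. \<Sum>s\<in>{m<..k}. of_real (p s) * Eop n s (R m \<omega> z x) y"
  have split: "Hfin n p k \<omega> \<psi> y = Hfin n p m \<omega> \<psi> y + (\<Sum>s\<in>{m<..k}. of_real (p s) * Eop n s \<psi> y)" for \<psi> y
  proof -
    have *: "{1..k} = {1..m} \<union> {m<..k}" using mk by auto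
    show ?thesis unfolding Hfin_def * by (subst sum.union_disjoint) auto
  qed
  have "Im z * L2_set (\<lambda>y. cmod (R k \<omega> z x y - R m \<omega> z x y)) ?B \<le> L2_set (\<lambda>y. cmod (- ?f y)) ?B"
  proof (rule Hfin_resolvent_bound[OF n2 order_refl z])
    fix y
    show "Hfin n p k \<omega> (\<lambda>y. R k \<omega> z x y - R m \<omega> z x y) y - z * (R k \<omega> z x y - R m \<omega> z x y) = - ?f y"
      using fv_resolvent_eq[OF n2 R_spec[OF z], of k \<omega> x y] fv_resolvent_eq[OF n2 R_spec[OF z], of m \<omega> x y]
      by (simp add: Hfin_diff n2 split[of "R m \<omega> z x"] algebra_simps)
  qed
  also have "\<dots> \<le> (\<Sum>s\<in>{m<..k}. p s) * L2_set (\<lambda>y. cmod (R m \<omega> z x y)) ?B"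
    unfolding norm_minus_cancel by (rule L2_set_sum_Eop_le[OF n2]) (auto intro: p_nonneg)
  also have "\<dots> \<le> tail m * (1 / Im z)"
    by (intro mult_mono sum_p_le_tail mk L2_set_R_le z tail_nonneg L2_set_nonneg)
  finally have "L2_set (\<lambda>y. cmod (R k \<omega> z x y - R m \<omega> z x y)) ?B \<le> tail m / (Im z)\<^sup>2"
    using z by (simp add: field_simps power2_eq_square)
  thus ?thesis using norm_le_L2_set[of ?B y "\<lambda>y. R k \<omega> z x y - R m \<omega> z x y"] True n_pos by simp
next
  case False
  hence "y \<notin> hblock n m x" using hblock_mono[OF mk, of n x] by blast
  thus ?thesis using False R_spec[OF z, of k \<omega> x] R_spec[OF z, of m \<omega> x] tail_nonneg
    by (simp add: fv_resolvent_def)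
qed

end

section \<open>Passage to the infinite-volume operator\<close>

lemma in_l2_bound:
  assumes "in_l2 \<psi>"
  obtains C where "C \<ge> 0" "\<And>T. finite T \<Longrightarrow> (\<Sum>y\<in>T. (cmod (\<psi> y))\<^sup>2) \<le> C\<^sup>2"
proof (rule that[of "sqrt (\<Sum>y. (cmod (\<psi> y))\<^sup>2)"])
  have s: "summable (\<lambda>x. (cmod (\<psi> x))\<^sup>2)" using assms by (simp add: in_l2_def)
  show "sqrt (\<Sum>y. (cmod (\<psi> y))\<^sup>2) \<ge> 0" using s by (simp add: suminf_nonneg)
  show "(\<Sum>y\<in>T. (cmod (\<psi> y))\<^sup>2) \<le> (sqrt (\<Sum>y. (cmod (\<psi> y))\<^sup>2))\<^sup>2" if "finite T" for T
    using s that by (simp add: suminf_nonneg sum_le_suminf)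
qed

lemma in_l2I:
  assumes "\<And>N. (\<Sum>y<N. (cmod (\<psi> y))\<^sup>2) \<le> C"
  shows "in_l2 \<psi>"
  unfolding in_l2_def by (rule bounded_imp_summable[of _ C]) (use assms[of "Suc _"] in \<open>auto simp: lessThan_Suc_atMost\<close>)

lemma in_l2_diff:
  assumes "in_l2 \<psi>" "in_l2 \<phi>"
  shows "in_l2 (\<lambda>y. \<psi> y - \<phi> y)"
  unfolding in_l2_def
proof (rule summable_comparison_test')
  show "summable (\<lambda>y. 2 * (cmod (\<psi> y))\<^sup>2 + 2 * (cmod (\<phi> y))\<^sup>2)"
    using assms unfolding in_l2_def by (intro summable_add summable_mult)
  fix y
  have "(cmod (\<psi> y - \<phi> y))\<^sup>2 \<le> (cmod (\<psi> y) + cmod (\<phi> y))\<^sup>2"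
    by (intro power_mono norm_triangle_ineq4) simp
  also have "\<dots> \<le> 2 * (cmod (\<psi> y))\<^sup>2 + 2 * (cmod (\<phi> y))\<^sup>2"
    using sum_squares_bound[of "cmod (\<psi> y)" "cmod (\<phi> y)"] by (simp add: power2_sum)
  finally show "norm ((cmod (\<psi> y - \<phi> y))\<^sup>2) \<le> 2 * (cmod (\<psi> y))\<^sup>2 + 2 * (cmod (\<phi> y))\<^sup>2" by simp
qed

lemma eventually_less_power:
  assumes "n \<ge> (2::nat)"
  shows "eventually (\<lambda>k. y < n ^ k) sequentially"
proof (rule eventually_sequentiallyI[of y])
  fix k assume "y \<le> k"
  also have "k < 2 ^ k" by (rule less_exp)
  also have "(2::nat) ^ k \<le> n ^ k" using assms by (intro power_mono) auto
  finally show "y < n ^ k" .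
qed

context hierarchical_model
begin

lemma summable_hLap:
  assumes "\<And>T. finite T \<Longrightarrow> (\<Sum>y\<in>T. (cmod (\<psi> y))\<^sup>2) \<le> C\<^sup>2" "C \<ge> 0"
  shows "summable (\<lambda>r. of_real (p (Suc r)) * Eop n (Suc r) \<psi> y)"
proof (rule summable_comparison_test')
  show "summable (\<lambda>r. p (Suc r) * C)" using p_sum by (intro summable_mult2) (rule sums_summable)
  show "norm (of_real (p (Suc r)) * Eop n (Suc r) \<psi> y) \<le> p (Suc r) * C" for r
    using cmod_Eop_le'[OF n2 assms] p_nonneg by (auto simp: norm_mult intro!: mult_mono)
qed

lemma hHam_split:
  assumes "\<And>T. finite T \<Longrightarrow> (\<Sum>y\<in>T. (cmod (\<psi> y))\<^sup>2) \<le> C\<^sup>2" "C \<ge> 0"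
  shows "hHam n p \<omega> \<psi> y = Hfin n p k \<omega> \<psi> y + (\<Sum>r. of_real (p (Suc (r + k))) * Eop n (Suc (r + k)) \<psi> y)"
  using suminf_split_initial_segment[OF summable_hLap[OF assms], of y k]
  unfolding hHam_def hLap_def Hfin_def sum_shift by simp

text \<open>The factor 1 / sqrt (n^k) makes the l2 norm of this pointwise bound over a block of n^k
  sites equal to \<open>tail k * C\<close>.\<close>

lemma cmod_hLap_tail_le:
  assumes C: "\<And>T. finite T \<Longrightarrow> (\<Sum>y\<in>T. (cmod (\<psi> y))\<^sup>2) \<le> C\<^sup>2" "C \<ge> 0"
  shows "cmod (\<Sum>r. of_real (p (Suc (r + k))) * Eop n (Suc (r + k)) \<psi> y) \<le> tail k * (C / sqrt (real n ^ k))"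
proof -
  have tl: "(\<lambda>r. p (Suc (r + k))) sums tail k"
    using sums_split_initial_segment[OF p_sum, of k] by (simp add: tail_def)
  have b: "cmod (of_real (p (Suc (r + k))) * Eop n (Suc (r + k)) \<psi> y) \<le> p (Suc (r + k)) * (C / sqrt (real n ^ k))" for r
  proof -
    have "C / sqrt (real n ^ Suc (r + k)) \<le> C / sqrt (real n ^ k)"
      using n2 C(2) by (intro divide_left_mono real_sqrt_le_mono power_increasing) auto
    hence "cmod (Eop n (Suc (r + k)) \<psi> y) \<le> C / sqrt (real n ^ k)"
      using cmod_Eop_le[OF n2 C, of "Suc (r + k)" y] by linarith
    from mult_left_mono[OF this, of "p (Suc (r + k))"] p_nonneg[of "Suc (r + k)"]
    show ?thesis by (simp add: norm_mult)
  qed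
  have s: "summable (\<lambda>r. p (Suc (r + k)) * (C / sqrt (real n ^ k)))"
    using tl by (intro summable_mult2) (rule sums_summable)
  have "cmod (\<Sum>r. of_real (p (Suc (r + k))) * Eop n (Suc (r + k)) \<psi> y) \<le> (\<Sum>r. p (Suc (r + k)) * (C / sqrt (real n ^ k)))"
    by (rule norm_suminf_le[OF b s])
  also have "\<dots> = tail k * (C / sqrt (real n ^ k))"
    by (rule sums_unique[OF sums_mult2[OF tl], symmetric])
  finally show ?thesis .
qed

text \<open>Uniqueness for the \<open>THE\<close> in \<open>green\<close>, without an appeal to
  self-adjointness: on each block the difference solves the truncated equation up to the tail of the
  Laplacian, so the a priori bound leaves at most \<open>tail k * C\<close>, which tends to
  0.\<close>

lemma resolvent_eq_unique:
  assumes z: "Im z > 0" and l2: "in_l2 \<psi>" "in_l2 \<phi>"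
    and eq: "\<And>y. hHam n p \<omega> \<psi> y - z * \<psi> y = hHam n p \<omega> \<phi> y - z * \<phi> y"
  shows "\<psi> = \<phi>"
proof
  fix x
  let ?d = "\<lambda>y. \<psi> y - \<phi> y"
  obtain C1 where C1: "C1 \<ge> 0" "\<And>T. finite T \<Longrightarrow> (\<Sum>y\<in>T. (cmod (\<psi> y))\<^sup>2) \<le> C1\<^sup>2" using in_l2_bound[OF l2(1)] by metis
  obtain C2 where C2: "C2 \<ge> 0" "\<And>T. finite T \<Longrightarrow> (\<Sum>y\<in>T. (cmod (\<phi> y))\<^sup>2) \<le> C2\<^sup>2" using in_l2_bound[OF l2(2)] by metis
  obtain C where C: "C \<ge> 0" "\<And>T. finite T \<Longrightarrow> (\<Sum>y\<in>T. (cmod (?d y))\<^sup>2) \<le> C\<^sup>2"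
    using in_l2_bound[OF in_l2_diff[OF l2]] by metis
  have eq0: "hHam n p \<omega> ?d y - z * ?d y = 0" for y
  proof -
    have "hLap n p ?d y = hLap n p \<psi> y - hLap n p \<phi> y"
      unfolding hLap_def using suminf_diff[OF summable_hLap[OF C1(2,1)] summable_hLap[OF C2(2,1)], of y y]
      by (simp add: Eop_diff n2 right_diff_distrib)
    hence "hHam n p \<omega> ?d y = hHam n p \<omega> \<psi> y - hHam n p \<omega> \<phi> y"
      by (simp add: hHam_def right_diff_distrib)
    hence "hHam n p \<omega> ?d y - z * ?d y = (hHam n p \<omega> \<psi> y - z * \<psi> y) - (hHam n p \<omega> \<phi> y - z * \<phi> y)"
      by (simp add: right_diff_distrib)
    thus ?thesis using eq[of y] by simp
  qed
  have bound: "Im z * cmod (?d x) \<le> tail k * C" for k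
  proof -
    let ?f = "\<lambda>y. \<Sum>r. of_real (p (Suc (r + k))) * Eop n (Suc (r + k)) ?d y" and ?B = "hblock n k x"
    have "Im z * L2_set (\<lambda>y. cmod (?d y)) ?B \<le> L2_set (\<lambda>y. cmod (- ?f y)) ?B"
    proof (rule Hfin_resolvent_bound[OF n2 order_refl z])
      show "Hfin n p k \<omega> ?d y - z * ?d y = - ?f y" for y
        using eq0[of y] hHam_split[OF C(2,1), of \<omega> y k] by (simp add: algebra_simps)
    qed
    also have "\<dots> \<le> L2_set (\<lambda>y. tail k * (C / sqrt (real n ^ k))) ?B"
      unfolding norm_minus_cancel by (intro L2_set_mono cmod_hLap_tail_le C) auto
    also have "\<dots> = tail k * C"
      using n_pos C(1) tail_nonneg[of k] by (simp add: L2_set_def real_sqrt_mult power_divide power_mult_distrib)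
    finally show ?thesis
      using norm_le_L2_set[OF finite_hblock[OF n_pos] hblock_self, of ?d x k] z
      by (meson mult_left_mono order_less_imp_le order_trans)
  qed
  have "(\<lambda>k. tail k * C) \<longlonglongrightarrow> 0 * C" by (intro tendsto_mult tail_tendsto tendsto_const)
  hence "Im z * cmod (?d x) \<le> 0 * C" by (rule LIMSEQ_le_const) (use bound in auto)
  thus "\<psi> x = \<phi> x" using z by (simp add: mult_le_0_iff)
qed

text \<open>Existence for the \<open>THE\<close> in \<open>green\<close>. The truncation estimate
  makes the columns Cauchy at each site, and the uniform l2 bounds survive the pointwise limit
  because they are tested on finite sets.\<close>

lemma R_limit:
  assumes z: "Im z > 0"
  obtains \<psi> where "\<And>y. (\<lambda>k. R k \<omega> z x y) \<longlonglongrightarrow> \<psi> y" "hdom \<omega> \<psi>"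
    "\<And>y. hHam n p \<omega> \<psi> y - z * \<psi> y = (if y = x then 1 else 0)"
proof -
  let ?R = "\<lambda>k. R k \<omega> z x"
  have "Cauchy (\<lambda>k. ?R k y)" for y
  proof (rule CauchyI')
    fix e :: real assume e: "e > 0"
    have "(\<lambda>m. tail m / (Im z)\<^sup>2) \<longlonglongrightarrow> 0 / (Im z)\<^sup>2" using z by (intro tendsto_intros tail_tendsto) auto
    then obtain M where M: "\<And>m. m \<ge> M \<Longrightarrow> tail m / (Im z)\<^sup>2 < e"
      using order_tendstoD(2)[of "\<lambda>m. tail m / (Im z)\<^sup>2" 0 sequentially e] e
      by (auto simp: eventually_sequentially)
    show "\<exists>M. \<forall>m\<ge>M. \<forall>k>m. dist (?R m y) (?R k y) < e"
    proof (intro exI allI impI)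
      fix m k assume "m \<ge> M" "k > m"
      thus "dist (?R m y) (?R k y) < e"
        using M[of m] cmod_R_diff_le[OF z, of m k \<omega> x y] by (simp add: dist_commute dist_norm norm_minus_commute)
    qed
  qed
  hence "\<exists>l. (\<lambda>k. ?R k y) \<longlonglongrightarrow> l" for y using Cauchy_convergent_iff convergent_def by blast
  then obtain \<psi> where lim: "\<And>y. (\<lambda>k. ?R k y) \<longlonglongrightarrow> \<psi> y" by metis
  have "in_l2 \<psi>"
  proof (rule in_l2I)
    fix N
    have "(\<lambda>k. \<Sum>y<N. (cmod (?R k y))\<^sup>2) \<longlonglongrightarrow> (\<Sum>y<N. (cmod (\<psi> y))\<^sup>2)" by (intro tendsto_intros lim)
    thus "(\<Sum>y<N. (cmod (\<psi> y))\<^sup>2) \<le> (1 / Im z)\<^sup>2"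
      by (rule LIMSEQ_le_const2) (use sum_R_le[OF z] in auto)
  qed
  moreover have "in_l2 (\<lambda>y. of_real (\<omega> y) * \<psi> y)"
  proof (rule in_l2I)
    fix N
    \<comment> \<open>The equation writes potential times column as delta plus z times the column
      minus its averages; the three summands bound the l2 norms of these terms.\<close>
    define C where "C = 1 + cmod z / Im z + 1 / Im z"
    have "(\<lambda>k. \<Sum>y<N. (cmod (of_real (\<omega> y) * ?R k y))\<^sup>2) \<longlonglongrightarrow> (\<Sum>y<N. (cmod (of_real (\<omega> y) * \<psi> y))\<^sup>2)"
      by (intro tendsto_intros lim)
    moreover have "eventually (\<lambda>k. (\<Sum>y<N. (cmod (of_real (\<omega> y) * ?R k y))\<^sup>2) \<le> C\<^sup>2) sequentially"
      using eventually_less_power[OF n2, of x] eventually_less_power[OF n2, of N]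
    proof eventually_elim
      case (elim k)
      let ?B = "hblock n k x"
      let ?E = "\<lambda>y. \<Sum>s=1..k. of_real (p s) * Eop n s (?R k) y" and ?d = "\<lambda>y. if y = x then 1 else 0 :: complex"
      have "of_real (\<omega> y) * ?R k y = ?d y + z * ?R k y - ?E y" for y
        using fv_resolvent_eq[OF n2 R_spec[OF z], of k \<omega> x y] by (simp add: Hfin_def algebra_simps)
      hence "cmod (of_real (\<omega> y) * ?R k y) \<le> cmod (?d y) + cmod z * cmod (?R k y) + cmod (?E y)" for y
        using norm_triangle_ineq[of "?d y" "z * ?R k y"] norm_triangle_ineq4[of "?d y + z * ?R k y" "?E y"]
        by (simp only: norm_mult)
      hence "L2_set (\<lambda>y. cmod (of_real (\<omega> y) * ?R k y)) ?B
          \<le> L2_set (\<lambda>y. (cmod (?d y) + cmod z * cmod (?R k y)) + cmod (?E y)) ?B"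
        by (intro L2_set_mono) auto
      also have "\<dots> \<le> L2_set (\<lambda>y. cmod (?d y) + cmod z * cmod (?R k y)) ?B + L2_set (\<lambda>y. cmod (?E y)) ?B"
        by (rule L2_set_triangle_ineq)
      also have "\<dots> \<le> (1 + cmod z * (1 / Im z)) + 1 * (1 / Im z)"
      proof (rule add_mono)
        have "L2_set (\<lambda>y. cmod (?d y) + cmod z * cmod (?R k y)) ?B
            \<le> L2_set (\<lambda>y. cmod (?d y)) ?B + L2_set (\<lambda>y. cmod z * cmod (?R k y)) ?B"
          by (rule L2_set_triangle_ineq)
        also have "L2_set (\<lambda>y. cmod z * cmod (?R k y)) ?B = cmod z * L2_set (\<lambda>y. cmod (?R k y)) ?B"
          by (rule L2_set_right_distrib[symmetric]) simp
        also have "L2_set (\<lambda>y. cmod (?d y)) ?B = 1" by (rule L2_set_delta) (use n_pos in auto)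
        finally show "L2_set (\<lambda>y. cmod (?d y) + cmod z * cmod (?R k y)) ?B \<le> 1 + cmod z * (1 / Im z)"
          using mult_left_mono[OF L2_set_R_le[OF z order_refl, of k \<omega> x], of "cmod z"] by simp
        have "L2_set (\<lambda>y. cmod (?E y)) ?B \<le> (\<Sum>s=1..k. p s) * L2_set (\<lambda>y. cmod (?R k y)) ?B"
          by (rule L2_set_sum_Eop_le[OF n2]) (auto intro: p_nonneg)
        also have "\<dots> \<le> 1 * (1 / Im z)"
          by (intro mult_mono sum_p_le L2_set_R_le z L2_set_nonneg) auto
        finally show "L2_set (\<lambda>y. cmod (?E y)) ?B \<le> 1 * (1 / Im z)" .
      qed
      finally have "L2_set (\<lambda>y. cmod (of_real (\<omega> y) * ?R k y)) ?B \<le> C" by (simp add: C_def)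
      hence "(L2_set (\<lambda>y. cmod (of_real (\<omega> y) * ?R k y)) ?B)\<^sup>2 \<le> C\<^sup>2"
        by (rule power_mono) (rule L2_set_nonneg)
      hence "(\<Sum>y\<in>?B. (cmod (of_real (\<omega> y) * ?R k y))\<^sup>2) \<le> C\<^sup>2" by (simp add: L2_set_def sum_nonneg)
      moreover have "(\<Sum>y<N. (cmod (of_real (\<omega> y) * ?R k y))\<^sup>2) \<le> (\<Sum>y\<in>?B. (cmod (of_real (\<omega> y) * ?R k y))\<^sup>2)"
        using elim n_pos by (intro sum_mono2) (auto simp: hblock_eq_initial)
      ultimately show ?case by linarith
    qed
    ultimately show "(\<Sum>y<N. (cmod (of_real (\<omega> y) * \<psi> y))\<^sup>2) \<le> C\<^sup>2"
      by (rule tendsto_upperbound) simp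
  qed
  moreover have "hHam n p \<omega> \<psi> y - z * \<psi> y = (if y = x then 1 else 0)" for y
  proof -
    \<comment> \<open>Truncation level and column vary together. Padding with zeros gives a series
      dominated by p (Suc r) / Im z, to which Tannery's theorem applies.\<close>
    define a where "a r k = (if r < k then of_real (p (Suc r)) * Eop n (Suc r) (?R k) y else 0)" for r k
    have 1: "(\<lambda>k. a r k) \<longlonglongrightarrow> of_real (p (Suc r)) * Eop n (Suc r) \<psi> y" for r
    proof (rule Lim_transform_eventually)
      show "(\<lambda>k. of_real (p (Suc r)) * Eop n (Suc r) (?R k) y) \<longlonglongrightarrow> of_real (p (Suc r)) * Eop n (Suc r) \<psi> y"
        unfolding Eop_eq_hblock[OF n2] by (intro tendsto_intros lim)
      show "\<forall>\<^sub>F k in sequentially. of_real (p (Suc r)) * Eop n (Suc r) (?R k) y = a r k"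
        using eventually_gt_at_top[of r] by eventually_elim (simp add: a_def)
    qed
    have 2: "eventually (\<lambda>(r, k). norm (a r k) \<le> p (Suc r) * (1 / Im z)) (at_top \<times>\<^sub>F sequentially)"
    proof (rule always_eventually, safe)
      fix r k
      have "cmod (Eop n (Suc r) (?R k) y) \<le> 1 / Im z"
        by (rule cmod_Eop_le'[OF n2 sum_R_le[OF z]]) (use z in auto)
      from mult_left_mono[OF this, of "p (Suc r)"] p_nonneg[of "Suc r"] z
      show "norm (a r k) \<le> p (Suc r) * (1 / Im z)" by (auto simp: a_def norm_mult)
    qed
    have 3: "summable (\<lambda>r. p (Suc r) * (1 / Im z))"
      using p_sum by (intro summable_mult2) (rule sums_summable)
    have "(\<lambda>k. \<Sum>r. a r k) \<longlonglongrightarrow> hLap n p \<psi> y"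
      unfolding hLap_def using tannerys_theorem[OF 1 2 3] by simp
    moreover have "(\<Sum>r. a r k) = (\<Sum>s=1..k. of_real (p s) * Eop n s (?R k) y)" for k
      unfolding sum_shift by (subst suminf_finite[of "{..<k}"]) (auto simp: a_def)
    ultimately have "(\<lambda>k. (\<Sum>s=1..k. of_real (p s) * Eop n s (?R k) y) + of_real (\<omega> y) * ?R k y - z * ?R k y)
        \<longlonglongrightarrow> hLap n p \<psi> y + of_real (\<omega> y) * \<psi> y - z * \<psi> y"
      by (intro tendsto_intros lim) simp
    moreover have "(\<lambda>k. (\<Sum>s=1..k. of_real (p s) * Eop n s (?R k) y) + of_real (\<omega> y) * ?R k y - z * ?R k y)
        = (\<lambda>k. if y = x then 1 else 0)"
      using fv_resolvent_eq[OF n2 R_spec[OF z], of _ \<omega> x y] by (simp add: Hfin_def fun_eq_iff)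
    ultimately have "(\<lambda>k::nat. if y = x then 1 else 0 :: complex) \<longlonglongrightarrow> hHam n p \<omega> \<psi> y - z * \<psi> y"
      by (simp only: hHam_def)
    thus ?thesis by (rule LIMSEQ_unique[OF _ tendsto_const])
  qed
  ultimately show thesis using lim by (intro that[of \<psi>]) (simp_all add: hdom_def)
qed

lemma G_tendsto_green:
  assumes z: "Im z > 0"
  shows "(\<lambda>k. G k \<omega> z x) \<longlonglongrightarrow> green n p x \<omega> z"
proof -
  obtain \<psi> where \<psi>: "\<And>y. (\<lambda>k. R k \<omega> z x y) \<longlonglongrightarrow> \<psi> y" "hdom \<omega> \<psi>"
    "\<And>y. hHam n p \<omega> \<psi> y - z * \<psi> y = (if y = x then 1 else 0)" by (rule R_limit[OF z, of \<omega> x]) (rule that)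
  have "(THE \<psi>. hdom \<omega> \<psi> \<and> (\<forall>y. hHam n p \<omega> \<psi> y - z * \<psi> y = (if y = x then 1 else 0))) = \<psi>"
  proof (rule the_equality)
    fix \<phi> assume "hdom \<omega> \<phi> \<and> (\<forall>y. hHam n p \<omega> \<phi> y - z * \<phi> y = (if y = x then 1 else 0))"
    thus "\<phi> = \<psi>" using \<psi>(2,3) by (intro resolvent_eq_unique[OF z, where \<omega> = \<omega>]) (auto simp: hdom_def)
  qed (use \<psi> in blast)
  thus ?thesis using \<psi>(1)[of x] by (simp add: green_def G_def)
qed

lemma cmod_G_diff_le: "Im z > 0 \<Longrightarrow> m \<le> k \<Longrightarrow> cmod (G k \<omega> z x - G m \<omega> z x) \<le> tail m / (Im z)\<^sup>2"
  unfolding G_def by (rule cmod_R_diff_le)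

lemma cmod_green_diff_le:
  assumes z: "Im z > 0"
  shows "cmod (green n p x \<omega> z - G m \<omega> z x) \<le> tail m / (Im z)\<^sup>2"
proof (rule LIMSEQ_le_const2)
  show "(\<lambda>k. cmod (G k \<omega> z x - G m \<omega> z x)) \<longlonglongrightarrow> cmod (green n p x \<omega> z - G m \<omega> z x)"
    by (intro tendsto_intros G_tendsto_green z)
qed (use cmod_G_diff_le[OF z, of m _ \<omega> x] in auto)

end

section \<open>Density of the resolvents in the functions vanishing at infinity\<close>

text \<open>The uniform closure of the linear span of constants and resolvents. Multiplication is
  deliberately not a rule: convergence of means is proved by induction over the rules, and means are
  only linear. Closure under products is derived.\<close>

inductive resolvent_algebra :: "(real \<Rightarrow> complex) \<Rightarrow> bool" where
  const: "resolvent_algebra (\<lambda>t. c)"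
| resolvent: "Im z \<noteq> 0 \<Longrightarrow> resolvent_algebra (\<lambda>t. 1 / (of_real t - z))"
| add: "resolvent_algebra f \<Longrightarrow> resolvent_algebra g \<Longrightarrow> resolvent_algebra (\<lambda>t. f t + g t)"
| scale: "resolvent_algebra f \<Longrightarrow> resolvent_algebra (\<lambda>t. c * f t)"
| limit: "(\<And>e. e > 0 \<Longrightarrow> \<exists>g. resolvent_algebra g \<and> (\<forall>t. cmod (f t - g t) \<le> e)) \<Longrightarrow> resolvent_algebra f"

lemma cmod_resolvent_le:
  assumes "Im z \<noteq> 0"
  shows "cmod (1 / (of_real t - z)) \<le> 1 / \<bar>Im z\<bar>"
proof -
  have "\<bar>Im z\<bar> \<le> cmod (of_real t - z)" using abs_Im_le_cmod[of "of_real t - z"] by simp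
  thus ?thesis using assms by (simp add: norm_divide frac_le)
qed

lemma resolvent_denom_nonzero: "Im z \<noteq> 0 \<Longrightarrow> of_real t - z \<noteq> 0"
  by (auto simp: complex_eq_iff)

lemma resolvent_algebra_bounded:
  assumes "resolvent_algebra f"
  shows "\<exists>B. \<forall>t. cmod (f t) \<le> B"
  using assms
proof induction
  case (const c)
  show ?case by auto
next
  case (resolvent z)
  thus ?case using cmod_resolvent_le by blast
next
  case (add f g)
  then obtain B C where "\<And>t. cmod (f t) \<le> B" "\<And>t. cmod (g t) \<le> C" by auto
  hence "cmod (f t + g t) \<le> B + C" for t by (meson add_mono norm_triangle_ineq order_trans)
  thus ?case by blast
next
  case (scale f c)
  then obtain B where "\<And>t. cmod (f t) \<le> B" by auto
  hence "cmod (c * f t) \<le> cmod c * B" for t by (simp add: norm_mult mult_left_mono)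
  thus ?case by blast
next
  case (limit f)
  from limit.IH[of 1] obtain g where "\<exists>B. \<forall>t. cmod (g t) \<le> B" and 1: "\<And>t. cmod (f t - g t) \<le> 1" by auto
  then obtain B where "\<And>t. cmod (g t) \<le> B" by auto
  with 1 have "cmod (f t) \<le> 1 + B" for t by (smt (verit) norm_triangle_sub)
  thus ?case by blast
qed

section \<open>Closure under products\<close>

lemma resolvent_identity:
  assumes "Im z \<noteq> 0" "Im w \<noteq> 0"
  shows "1 / (of_real t - z) - 1 / (of_real t - w) = (z - w) * (1 / (of_real t - z) * (1 / (of_real t - w)))"
  using resolvent_denom_nonzero[OF assms(1), of t] resolvent_denom_nonzero[OF assms(2), of t]
  by (simp add: field_simps)

text \<open>The resolvent identity writes a product with two distinct poles as a multiple of a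
  difference of resolvents. A double pole is a uniform limit of products with distinct
  poles.\<close>

lemma resolvent_algebra_resolvent_mult_resolvent:
  assumes z: "Im z \<noteq> 0" and w: "Im w \<noteq> 0"
  shows "resolvent_algebra (\<lambda>t. 1 / (of_real t - z) * (1 / (of_real t - w)))"
proof -
  have neq: "resolvent_algebra (\<lambda>t. 1 / (of_real t - z) * (1 / (of_real t - w)))"
    if w: "Im w \<noteq> 0" and "z \<noteq> w" for w
  proof -
    have "(\<lambda>t. 1 / (of_real t - z) * (1 / (of_real t - w)))
        = (\<lambda>t. (1 / (z - w)) * (1 / (of_real t - z) + (-1) * (1 / (of_real t - w))))"
      using resolvent_identity[OF z w] that by (auto simp: fun_eq_iff)
    thus ?thesis
      by (simp only:) (intro resolvent_algebra.scale resolvent_algebra.add resolvent_algebra.resolvent z w)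
  qed
  show ?thesis
  proof (cases "z = w")
    case True
    show ?thesis unfolding True[symmetric]
    proof (rule resolvent_algebra.limit)
      fix e :: real assume e: "e > 0"
      \<comment> \<open>Cancels the three factors 1 / |Im z| of the estimate below.\<close>
      define d where "d = e * \<bar>Im z\<bar> ^ 3"
      have d: "d > 0" using e z by (simp add: d_def)
      \<comment> \<open>The second pole moves away from the real axis, so its resolvent keeps the
        bound 1 / |Im z|.\<close>
      define v where "v = z + \<i> * of_real (sgn (Im z) * d)"
      have Imv: "\<bar>Im v\<bar> = \<bar>Im z\<bar> + d" using d z by (auto simp: v_def sgn_if)
      hence v: "Im v \<noteq> 0" using d by auto
      have zv: "cmod (z - v) = d" using d z by (simp add: v_def norm_mult abs_mult abs_sgn_eq)
      have "cmod (1 / (of_real t - z) * (1 / (of_real t - z)) - 1 / (of_real t - z) * (1 / (of_real t - v))) \<le> e" for t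
      proof -
        have "cmod (1 / (of_real t - z) * (1 / (of_real t - z)) - 1 / (of_real t - z) * (1 / (of_real t - v)))
            = cmod (1 / (of_real t - z)) * (d * (cmod (1 / (of_real t - z)) * cmod (1 / (of_real t - v))))"
          unfolding right_diff_distrib[symmetric] resolvent_identity[OF z v] norm_mult zv ..
        also have "\<dots> \<le> (1 / \<bar>Im z\<bar>) * (d * ((1 / \<bar>Im z\<bar>) * (1 / \<bar>Im z\<bar>)))"
        proof -
          have "1 / \<bar>Im v\<bar> \<le> 1 / \<bar>Im z\<bar>" using z d Imv by (intro divide_left_mono) auto
          hence "cmod (1 / (of_real t - v)) \<le> 1 / \<bar>Im z\<bar>" using cmod_resolvent_le[OF v, of t] by linarith
          thus ?thesis using cmod_resolvent_le[OF z, of t] d by (intro mult_mono) auto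
        qed
        also have "\<dots> = e" using z by (simp add: d_def power3_eq_cube)
        finally show ?thesis .
      qed
      moreover have "z \<noteq> v" using zv d by auto
      ultimately show "\<exists>g. resolvent_algebra g \<and> (\<forall>t. cmod (1 / (of_real t - z) * (1 / (of_real t - z)) - g t) \<le> e)"
        using neq[OF v] by blast
    qed
  qed (use neq w in blast)
qed

lemma resolvent_algebra_resolvent_mult:
  assumes "resolvent_algebra g" and z: "Im z \<noteq> 0"
  shows "resolvent_algebra (\<lambda>t. 1 / (of_real t - z) * g t)"
  using assms(1)
proof induction
  case (const c)
  show ?case using resolvent_algebra.scale[OF resolvent_algebra.resolvent[OF z], of c] by (simp add: mult.commute)
next
  case (resolvent w)
  show ?case by (rule resolvent_algebra_resolvent_mult_resolvent[OF z resolvent])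
next
  case (add f g)
  show ?case unfolding distrib_left by (rule resolvent_algebra.add[OF add.IH])
next
  case (scale f c)
  show ?case using resolvent_algebra.scale[OF scale.IH, of c] by (simp add: mult_ac)
next
  case (limit f)
  show ?case
  proof (rule resolvent_algebra.limit)
    fix e :: real assume "e > 0"
    hence "e * \<bar>Im z\<bar> > 0" using z by simp
    from limit.IH[OF this] obtain g where g: "resolvent_algebra (\<lambda>t. 1 / (of_real t - z) * g t)"
      "\<And>t. cmod (f t - g t) \<le> e * \<bar>Im z\<bar>" by blast
    have "cmod (1 / (of_real t - z) * f t - 1 / (of_real t - z) * g t) \<le> e" for t
    proof -
      have "cmod (1 / (of_real t - z) * f t - 1 / (of_real t - z) * g t) \<le> (1 / \<bar>Im z\<bar>) * (e * \<bar>Im z\<bar>)"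
        unfolding right_diff_distrib[symmetric] norm_mult by (intro mult_mono cmod_resolvent_le z g) auto
      thus ?thesis using z by simp
    qed
    thus "\<exists>h. resolvent_algebra h \<and> (\<forall>t. cmod (1 / (of_real t - z) * f t - h t) \<le> e)" using g(1) by blast
  qed
qed

lemma resolvent_algebra_mult:
  assumes "resolvent_algebra f" and g: "resolvent_algebra g"
  shows "resolvent_algebra (\<lambda>t. f t * g t)"
  using assms(1)
proof induction
  case (const c)
  show ?case by (rule resolvent_algebra.scale[OF g])
next
  case (resolvent w)
  show ?case by (rule resolvent_algebra_resolvent_mult[OF g resolvent])
next
  case (add f h)
  show ?case unfolding distrib_right by (rule resolvent_algebra.add[OF add.IH])
next
  case (scale f c)
  show ?case using resolvent_algebra.scale[OF scale.IH, of c] by (simp add: mult_ac)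
next
  case (limit f)
  obtain B0 where B0: "\<And>t. cmod (g t) \<le> B0" using resolvent_algebra_bounded[OF g] by blast
  define B where "B = max B0 1"
  have B: "\<And>t. cmod (g t) \<le> B" "B > 0" using B0 by (auto simp: B_def intro: order_trans max.cobounded1)
  show ?case
  proof (rule resolvent_algebra.limit)
    fix e :: real assume "e > 0"
    hence "e / B > 0" using B by simp
    from limit.IH[OF this] obtain h where h: "resolvent_algebra (\<lambda>t. h t * g t)"
      "\<And>t. cmod (f t - h t) \<le> e / B" by blast
    have "cmod (f t * g t - h t * g t) \<le> e" for t
    proof -
      have "cmod (f t * g t - h t * g t) \<le> e / B * B"
        unfolding left_diff_distrib[symmetric] norm_mult
        using h B \<open>e / B > 0\<close> by (intro mult_mono) auto
      thus ?thesis using B by simp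
    qed
    thus "\<exists>k. resolvent_algebra k \<and> (\<forall>t. cmod (f t * g t - k t) \<le> e)" using h(1) by blast
  qed
qed

text \<open>The Cayley transform maps the real line onto the unit circle without the point 1, so that
  functions vanishing at infinity become continuous functions on a compact set.\<close>

definition cayley :: "real \<Rightarrow> complex" where
  "cayley t = (of_real t - \<i>) / (of_real t + \<i>)"

lemma real_plus_i_nonzero: "of_real t + \<i> \<noteq> 0" "of_real t - \<i> \<noteq> 0"
  by (auto simp: complex_eq_iff)

text \<open>By partial fractions the transform and its conjugate are affine in the resolvents at
  -\<i> and at \<i>; this is where poles in both half planes are called for.\<close>

lemma resolvent_algebra_cayley:
  "resolvent_algebra cayley" "resolvent_algebra (\<lambda>t. cnj (cayley t))"
proof -
  have "cayley t = 1 + (- 2 * \<i>) * (1 / (of_real t - (- \<i>)))" for t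
    using real_plus_i_nonzero[of t] by (simp add: cayley_def field_simps)
  hence eq: "cayley = (\<lambda>t. 1 + (- 2 * \<i>) * (1 / (of_real t - (- \<i>))))" ..
  show "resolvent_algebra cayley"
    unfolding eq by (intro resolvent_algebra.add resolvent_algebra.const resolvent_algebra.scale resolvent_algebra.resolvent, simp)
  have "cnj (cayley t) = 1 + (2 * \<i>) * (1 / (of_real t - \<i>))" for t
    using real_plus_i_nonzero[of t] by (simp add: cayley_def field_simps)
  hence eq: "(\<lambda>t. cnj (cayley t)) = (\<lambda>t. 1 + (2 * \<i>) * (1 / (of_real t - \<i>)))" ..
  show "resolvent_algebra (\<lambda>t. cnj (cayley t))"
    unfolding eq by (intro resolvent_algebra.add resolvent_algebra.const resolvent_algebra.scale resolvent_algebra.resolvent, simp)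
qed

text \<open>Real polynomial functions are generated by constants and real-linear functionals, and
  each such functional on the plane is a combination of w and cnj w.\<close>

lemma resolvent_algebra_real_polynomial_cayley:
  assumes "real_polynomial_function q"
  shows "resolvent_algebra (\<lambda>t. of_real (q (cayley t)))"
  using assms
proof induction
  case (linear h)
  have "complex_of_real (h w) = (of_real (h 1) - \<i> * of_real (h \<i>)) / 2 * w + (of_real (h 1) + \<i> * of_real (h \<i>)) / 2 * cnj w" for w
  proof -
    have "w = Re w *\<^sub>R 1 + Im w *\<^sub>R \<i>" by (simp add: complex_eq_iff)
    hence "h w = h (Re w *\<^sub>R 1 + Im w *\<^sub>R \<i>)" by simp
    also have "\<dots> = Re w * h 1 + Im w * h \<i>" using linear
      by (simp only: bounded_linear.linear linear_add linear_scale real_scaleR_def)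
    finally show ?thesis by (simp add: complex_eq_iff field_simps)
  qed
  hence eq: "(\<lambda>t. complex_of_real (h (cayley t))) = (\<lambda>t. (of_real (h 1) - \<i> * of_real (h \<i>)) / 2 * cayley t
      + (of_real (h 1) + \<i> * of_real (h \<i>)) / 2 * cnj (cayley t))" by (intro ext)
  show ?case unfolding eq by (intro resolvent_algebra.add resolvent_algebra.scale resolvent_algebra_cayley)
next
  case (const c)
  show ?case by (rule resolvent_algebra.const)
next
  case (add f g)
  thus ?case using resolvent_algebra.add by simp
next
  case (mult f g)
  thus ?case using resolvent_algebra_mult by simp
qed

theorem resolvent_algebra_vanishing_at_infinity:
  assumes f: "continuous_on UNIV f" and lim: "(f \<longlongrightarrow> 0) at_infinity"
  shows "resolvent_algebra f"
proof -
  let ?S = "sphere (0::complex) 1"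
  let ?inv = "\<lambda>w. Re (\<i> * (1 + w) / (1 - w))"
  \<comment> \<open>\<open>?inv\<close> inverts the Cayley transform on the circle; the omitted
    point 1 stands for infinity and receives the limit of \<open>f\<close>.\<close>
  define F where "F w = (if w = 1 then 0 else f (?inv w))" for w
  have cay: "cayley t \<in> ?S" for t
  proof -
    have "cmod (of_real t - \<i>) = cmod (of_real t + \<i>)" by (simp add: cmod_def)
    thus ?thesis using real_plus_i_nonzero[of t] by (simp add: cayley_def norm_divide)
  qed
  have Fc: "F (cayley t) = f t" for t
  proof -
    have 1: "1 - cayley t = 2 * \<i> / (of_real t + \<i>)" "1 + cayley t = 2 * of_real t / (of_real t + \<i>)"
      using real_plus_i_nonzero[of t] by (simp_all add: cayley_def field_simps)
    have "cayley t \<noteq> 1" using 1(1) real_plus_i_nonzero(1)[of t] by auto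
    moreover have "\<i> * (1 + cayley t) / (1 - cayley t) = of_real t"
      unfolding 1 using real_plus_i_nonzero(1)[of t] by (simp add: field_simps)
    ultimately show ?thesis by (simp add: F_def)
  qed
  have real: "\<i> * (1 + w) / (1 - w) = of_real (?inv w)" if "w \<in> ?S" "w \<noteq> 1" for w
  proof -
    have ww: "w * cnj w = 1" using that by (simp add: complex_norm_square[symmetric])
    have "1 - w \<noteq> 0" "1 - cnj w \<noteq> 0" using that by (auto simp: complex_eq_iff)
    moreover have "(1 + cnj w) * (1 - w) = - ((1 + w) * (1 - cnj w))" using ww by (simp add: algebra_simps)
    ultimately have "cnj (\<i> * (1 + w) / (1 - w)) = \<i> * (1 + w) / (1 - w)"
      by (simp add: divide_eq_eq eq_divide_eq algebra_simps)
    thus ?thesis by (metis Reals_cnj_iff of_real_Re)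
  qed
  have cF: "continuous_on ?S F"
    unfolding continuous_on_eq_continuous_within
  proof
    fix w assume w: "w \<in> ?S"
    show "continuous (at w within ?S) F"
    proof (cases "w = 1")
      case False
      have "isCont (\<lambda>w. f (?inv w)) w"
      proof (rule isCont_o2[where g = f])
        show "isCont ?inv w" unfolding isCont_def by (intro tendsto_intros) (use False in auto)
        show "isCont f (?inv w)" using f by (simp add: continuous_on_eq_continuous_at)
      qed
      moreover have "isCont F w \<longleftrightarrow> isCont (\<lambda>w. f (?inv w)) w"
      proof (rule isCont_cong)
        show "\<forall>\<^sub>F v in nhds w. F v = f (?inv v)"
          using t1_space_nhds[OF False] by eventually_elim (simp add: F_def)
      qed
      ultimately have "isCont F w" by blast
      thus ?thesis by (rule continuous_at_imp_continuous_at_within)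
    next
      case True
      have "(F \<longlongrightarrow> 0) (at 1 within ?S)"
      proof (rule tendstoI)
        fix e :: real assume "e > 0"
        then obtain L where L: "\<And>t. L \<le> norm t \<Longrightarrow> dist (f t) 0 < e"
          using tendstoD[OF lim] by (auto simp: eventually_at_infinity)
        \<comment> \<open>As \<open>d\<close> is at most 1, points closer than \<open>d\<close> to 1
          satisfy cmod (1 + w) \<ge> 1, so their preimages have modulus at least 1 / d \<ge>
          L.\<close>
        define d where "d = 1 / (\<bar>L\<bar> + 1)"
        have d: "d > 0" "d \<le> 1" by (auto simp: d_def)
        show "\<forall>\<^sub>F w in at 1 within ?S. dist (F w) 0 < e"
          unfolding eventually_at
        proof (intro exI conjI ballI impI)
          fix w assume w: "w \<in> ?S" and wd: "w \<noteq> 1 \<and> dist w 1 < d"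
          have "cmod (1 + w) \<ge> 1"
          proof -
            have "cmod (1 + w) \<ge> cmod 2 - cmod (1 - w)" using norm_triangle_ineq2[of 2 "1 - w"] by simp
            thus ?thesis using wd d by (simp add: dist_norm norm_minus_commute)
          qed
          have pos: "cmod (1 - w) > 0" using wd by simp
          have "L \<le> 1 / d" by (simp add: d_def)
          also have "\<dots> \<le> 1 / cmod (1 - w)" using wd pos d by (intro divide_left_mono) (auto simp: dist_norm norm_minus_commute)
          also have "\<dots> \<le> cmod (1 + w) / cmod (1 - w)" using \<open>cmod (1 + w) \<ge> 1\<close> pos by (intro divide_right_mono) auto
          also have "\<dots> = norm (?inv w)" using arg_cong[OF real[OF w], of cmod] wd by (simp add: norm_divide norm_mult)
          finally show "dist (F w) 0 < e" using L wd by (simp add: F_def)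
        qed (use d in auto)
      qed
      thus ?thesis using True by (simp add: continuous_within F_def)
    qed
  qed
  show ?thesis
  proof (rule resolvent_algebra.limit)
    fix e :: real assume e: "e > 0"
    obtain g where g: "polynomial_function g" "\<And>w. w \<in> ?S \<Longrightarrow> norm (F w - g w) < e"
      using Stone_Weierstrass_polynomial_function[OF compact_sphere cF e] by auto
    have "real_polynomial_function (\<lambda>w. Re (g w))" "real_polynomial_function (\<lambda>w. Im (g w))"
      using g(1) bounded_linear_Re bounded_linear_Im unfolding polynomial_function_def o_def by blast+
    from this[THEN resolvent_algebra_real_polynomial_cayley]
    have "resolvent_algebra (\<lambda>t. of_real (Re (g (cayley t))) + \<i> * of_real (Im (g (cayley t))))"
      by (intro resolvent_algebra.add resolvent_algebra.scale)
    hence "resolvent_algebra (\<lambda>t. g (cayley t))" by (simp only: complex_eq[symmetric])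
    moreover have "cmod (f t - g (cayley t)) \<le> e" for t using g(2)[OF cay, of t] Fc[of t] by simp
    ultimately show "\<exists>g. resolvent_algebra g \<and> (\<forall>t. cmod (f t - g t) \<le> e)" by blast
  qed
qed

section \<open>Means, Stieltjes transforms and spectral measures\<close>

lemma resolvent_algebra_measurable:
  assumes "resolvent_algebra f"
  shows "f \<in> borel_measurable borel"
  using assms
proof induction
  case (limit f)
  have "\<exists>g. g \<in> borel_measurable borel \<and> (\<forall>t. cmod (f t - g t) \<le> 1 / real (Suc k))" for k
    using limit.IH[of "1 / real (Suc k)"] by auto
  then obtain g where g: "\<And>k. g k \<in> borel_measurable borel" "\<And>k t. cmod (f t - g k t) \<le> 1 / real (Suc k)"
    by metis
  show ?case
  proof (rule borel_measurable_LIMSEQ_metric[of g])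
    fix t
    have "(\<lambda>k. g k t - f t) \<longlonglongrightarrow> 0"
    proof (rule Lim_null_comparison)
      show "\<forall>\<^sub>F k in sequentially. norm (g k t - f t) \<le> 1 / real (Suc k)"
        using g(2)[of t] by (auto simp: norm_minus_commute)
      show "(\<lambda>k. 1 / real (Suc k)) \<longlonglongrightarrow> 0" using LIMSEQ_inverse_real_of_nat by (simp add: inverse_eq_divide)
    qed
    thus "(\<lambda>k. g k t) \<longlonglongrightarrow> f t" by (simp add: LIM_zero_iff)
  qed (use g in auto)
qed (auto intro: borel_measurable_continuous_onI continuous_intros)

text \<open>Common to integrals over probability measures and normalised sums over eigenvalues.
  Linearity is demanded on \<open>resolvent_algebra\<close>, whose members are bounded and
  measurable; the conjugation clause carries statements from the upper to the lower half
  plane.\<close>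

definition is_mean :: "((real \<Rightarrow> complex) \<Rightarrow> complex) \<Rightarrow> bool" where
  "is_mean I \<longleftrightarrow> (\<forall>c. I (\<lambda>t. c) = c)
    \<and> (\<forall>f g. resolvent_algebra f \<longrightarrow> resolvent_algebra g \<longrightarrow> I (\<lambda>t. f t + g t) = I f + I g)
    \<and> (\<forall>c f. resolvent_algebra f \<longrightarrow> I (\<lambda>t. c * f t) = c * I f)
    \<and> (\<forall>f. resolvent_algebra f \<longrightarrow> I (\<lambda>t. cnj (f t)) = cnj (I f))
    \<and> (\<forall>f B. resolvent_algebra f \<longrightarrow> (\<forall>t. cmod (f t) \<le> B) \<longrightarrow> cmod (I f) \<le> B)"

lemma is_mean_diff_le:
  assumes I: "is_mean I" and f: "resolvent_algebra f" and g: "resolvent_algebra g"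
    and le: "\<And>t. cmod (f t - g t) \<le> e"
  shows "cmod (I f - I g) \<le> e"
proof -
  have g': "resolvent_algebra (\<lambda>t. (-1) * g t)" by (rule resolvent_algebra.scale[OF g])
  have "I (\<lambda>t. f t + (-1) * g t) = I f + I (\<lambda>t. (-1) * g t)" using I f g' unfolding is_mean_def by blast
  also have "I (\<lambda>t. (-1) * g t) = (-1) * I g" using I g unfolding is_mean_def by blast
  finally have eq: "I (\<lambda>t. f t + (-1) * g t) = I f - I g" by simp
  have "cmod (I (\<lambda>t. f t + (-1) * g t)) \<le> e"
  proof -
    have "\<forall>t. cmod (f t + (-1) * g t) \<le> e" using le by simp
    thus ?thesis using I resolvent_algebra.add[OF f g'] unfolding is_mean_def by blast
  qed
  thus ?thesis unfolding eq .
qed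

text \<open>A three-epsilon argument in which the comparison sequence and its limit may both depend
  on \<open>e\<close>.\<close>

lemma tendsto_of_uniform_approx:
  fixes x :: "nat \<Rightarrow> complex"
  assumes "\<And>e. e > 0 \<Longrightarrow> \<exists>y L'. y \<longlonglongrightarrow> L' \<and> (\<forall>\<^sub>F k in sequentially. cmod (x k - y k) \<le> e) \<and> cmod (L' - L) \<le> e"
  shows "x \<longlonglongrightarrow> L"
proof (rule tendstoI)
  fix e :: real assume "e > 0"
  then obtain y L' where y: "y \<longlonglongrightarrow> L'" "\<forall>\<^sub>F k in sequentially. cmod (x k - y k) \<le> e / 4" "cmod (L' - L) \<le> e / 4"
    using assms[of "e / 4"] by auto
  have "\<forall>\<^sub>F k in sequentially. dist (y k) L' < e / 4" using tendstoD[OF y(1), of "e / 4"] \<open>e > 0\<close> by simp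
  thus "\<forall>\<^sub>F k in sequentially. dist (x k) L < e"
    using y(2)
  proof eventually_elim
    case (elim k)
    have "dist (x k) L \<le> dist (x k) (y k) + dist (y k) L' + dist L' L"
      using dist_triangle[of "x k" L "y k"] dist_triangle[of "y k" L L'] by linarith
    thus ?case using elim y(3) \<open>e > 0\<close> by (simp add: dist_norm)
  qed
qed

text \<open>Every rule generating \<open>f\<close> is compatible with means, the limit rule through
  their uniform norm bound. Poles in the lower half plane reduce to the upper one by
  conjugation.\<close>

lemma is_mean_tendsto:
  assumes I: "\<And>k. is_mean (I k)" and L: "is_mean L"
    and lim: "\<And>z. Im z > 0 \<Longrightarrow> (\<lambda>k. I k (\<lambda>t. 1 / (of_real t - z))) \<longlonglongrightarrow> L (\<lambda>t. 1 / (of_real t - z))"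
    and "resolvent_algebra f"
  shows "(\<lambda>k. I k f) \<longlonglongrightarrow> L f"
  using assms(4)
proof induction
  case (const c)
  have "I k (\<lambda>t. c) = c" "L (\<lambda>t. c) = c" for k using I[of k] L unfolding is_mean_def by blast+
  thus ?case by simp
next
  case (resolvent z)
  show ?case
  proof (cases "Im z > 0")
    case True
    thus ?thesis by (rule lim)
  next
    case False
    hence z: "Im (cnj z) > 0" using resolvent by simp
    have *: "J (\<lambda>t. 1 / (of_real t - z)) = cnj (J (\<lambda>t. 1 / (of_real t - cnj z)))" if J: "is_mean J" for J
    proof -
      have r: "resolvent_algebra (\<lambda>t. 1 / (of_real t - cnj z))" by (rule resolvent_algebra.resolvent) (use z in simp)
      have "J (\<lambda>t. cnj (1 / (of_real t - cnj z))) = cnj (J (\<lambda>t. 1 / (of_real t - cnj z)))"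
        using J r unfolding is_mean_def by blast
      thus ?thesis by simp
    qed
    show ?thesis unfolding *[OF I] *[OF L] by (intro tendsto_cnj lim z)
  qed
next
  case (add f g)
  have "I k (\<lambda>t. f t + g t) = I k f + I k g" "L (\<lambda>t. f t + g t) = L f + L g" for k
    using I[of k] L add.hyps unfolding is_mean_def by blast+
  thus ?case using tendsto_add[OF add.IH] by simp
next
  case (scale f c)
  have "I k (\<lambda>t. c * f t) = c * I k f" "L (\<lambda>t. c * f t) = c * L f" for k
    using I[of k] L scale.hyps unfolding is_mean_def by blast+
  thus ?case using tendsto_mult[OF tendsto_const scale.IH] by simp
next
  case (limit f)
  have f: "resolvent_algebra f" using limit.IH by (intro resolvent_algebra.limit) blast
  show ?case
  proof (rule tendsto_of_uniform_approx)
    fix e :: real assume "e > 0"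
    from limit.IH[OF this] obtain g where g: "resolvent_algebra g" "(\<lambda>k. I k g) \<longlonglongrightarrow> L g"
      "\<And>t. cmod (f t - g t) \<le> e" by blast
    have "cmod (L g - L f) \<le> e"
      using is_mean_diff_le[OF L f g(1,3)] by (simp add: norm_minus_commute)
    thus "\<exists>y L'. y \<longlonglongrightarrow> L' \<and> (\<forall>\<^sub>F k in sequentially. cmod (I k f - y k) \<le> e) \<and> cmod (L' - L f) \<le> e"
      using g is_mean_diff_le[OF I f g(1,3)] by (intro exI[of _ "\<lambda>k. I k g"] exI[of _ "L g"]) auto
  qed
qed

text \<open>Almost sure statements can be collected for countably many poles only. Moving the pole
  slightly changes the resolvent uniformly little, so a dense set of poles suffices.\<close>

lemma is_mean_tendsto_dense:
  assumes I: "\<And>k. is_mean (I k)" and L: "is_mean L"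
    and D: "\<And>z e. e > 0 \<Longrightarrow> \<exists>w\<in>D. dist w z < e"
    and lim: "\<And>z. z \<in> D \<Longrightarrow> Im z > 0 \<Longrightarrow> (\<lambda>k. I k (\<lambda>t. 1 / (of_real t - z))) \<longlonglongrightarrow> L (\<lambda>t. 1 / (of_real t - z))"
    and f: "resolvent_algebra f"
  shows "(\<lambda>k. I k f) \<longlonglongrightarrow> L f"
proof (rule is_mean_tendsto[OF I L _ f])
  fix z :: complex assume z: "Im z > 0"
  show "(\<lambda>k. I k (\<lambda>t. 1 / (of_real t - z))) \<longlonglongrightarrow> L (\<lambda>t. 1 / (of_real t - z))"
  proof (rule tendsto_of_uniform_approx)
    fix e :: real assume e: "e > 0"
    \<comment> \<open>The first bound keeps \<open>Im w\<close> above half of \<open>Im z\<close>;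
      the second makes |z - w| * (1 / Im z) * (2 / Im z) at most \<open>e\<close>.\<close>
    define d where "d = min (Im z / 2) (e * (Im z)\<^sup>2 / 2)"
    have "d > 0" using e z by (simp add: d_def)
    from D[OF this, of z] obtain w where w: "w \<in> D" "dist w z < d" by blast
    have "\<bar>Im w - Im z\<bar> < Im z / 2"
      using abs_Im_le_cmod[of "w - z"] w(2) by (simp add: d_def dist_norm)
    hence Imw: "Im w > Im z / 2" by (simp add: abs_if split: if_splits)
    hence w0: "Im w > 0" using z by linarith
    have le: "cmod (1 / (of_real t - z) - 1 / (of_real t - w)) \<le> e" for t
    proof -
      have "cmod (1 / (of_real t - z) - 1 / (of_real t - w)) = cmod (z - w) * (cmod (1 / (of_real t - z)) * cmod (1 / (of_real t - w)))"
      proof -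
        have "Im z \<noteq> 0" "Im w \<noteq> 0" using z w0 by auto
        from resolvent_identity[OF this, of t] show ?thesis by (simp only: norm_mult)
      qed
      also have "\<dots> \<le> (e * (Im z)\<^sup>2 / 2) * ((1 / Im z) * (1 / (Im z / 2)))"
      proof (intro mult_mono)
        show "cmod (z - w) \<le> e * (Im z)\<^sup>2 / 2" using w(2) by (simp add: d_def dist_norm norm_minus_commute)
        show "cmod (1 / (of_real t - z)) \<le> 1 / Im z" using cmod_resolvent_le[of z t] z by simp
        have "1 / Im w \<le> 1 / (Im z / 2)" using Imw z w0 by (intro divide_left_mono) auto
        thus "cmod (1 / (of_real t - w)) \<le> 1 / (Im z / 2)" using cmod_resolvent_le[of w t] w0 by simp
      qed (use e z in auto)
      also have "\<dots> = e" using z by (simp add: power2_eq_square)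
      finally show ?thesis .
    qed
    have r: "resolvent_algebra (\<lambda>t. 1 / (of_real t - z))" "resolvent_algebra (\<lambda>t. 1 / (of_real t - w))"
      using z w0 by (auto intro: resolvent_algebra.resolvent)
    show "\<exists>y L'. y \<longlonglongrightarrow> L' \<and> (\<forall>\<^sub>F k in sequentially. cmod (I k (\<lambda>t. 1 / (of_real t - z)) - y k) \<le> e)
        \<and> cmod (L' - L (\<lambda>t. 1 / (of_real t - z))) \<le> e"
      using lim[OF w(1) w0] is_mean_diff_le[OF I r le] is_mean_diff_le[OF L r le]
      by (intro exI[of _ "\<lambda>k. I k (\<lambda>t. 1 / (of_real t - w))"] exI[of _ "L (\<lambda>t. 1 / (of_real t - w))"])
        (auto simp: norm_minus_commute)
  qed
qed

lemma is_mean_integral: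
  assumes "prob_space \<mu>" "sets \<mu> = sets borel"
  shows "is_mean (\<lambda>f. \<integral>t. f t \<partial>\<mu>)"
proof -
  interpret prob_space \<mu> by fact
  have int: "integrable \<mu> f" if f: "resolvent_algebra f" for f
  proof -
    obtain B where "\<And>t. cmod (f t) \<le> B" using resolvent_algebra_bounded[OF f] by blast
    thus ?thesis using resolvent_algebra_measurable[OF f] measurable_cong_sets[OF assms(2) refl]
      by (intro integrable_const_bound[of _ B]) auto
  qed
  have "cmod (\<integral>t. f t \<partial>\<mu>) \<le> B" if f: "resolvent_algebra f" and B: "\<forall>t. cmod (f t) \<le> B" for f B
  proof -
    have "cmod (\<integral>t. f t \<partial>\<mu>) \<le> (\<integral>t. cmod (f t) \<partial>\<mu>)" by (rule integral_norm_bound)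
    also have "\<dots> \<le> (\<integral>t. B \<partial>\<mu>)" using int[OF f] B by (intro integral_mono) auto
    finally show ?thesis by (simp add: prob_space)
  qed
  thus ?thesis unfolding is_mean_def using int by (auto simp: prob_space)
qed

text \<open>Steeper and steeper tents cut off at height 1 converge to the indicator of an open
  interval, and open intervals are an intersection-stable generator.\<close>

lemma prob_measure_eqI_vanishing_at_infinity:
  fixes \<mu> \<nu> :: "real measure"
  assumes \<mu>: "prob_space \<mu>" "sets \<mu> = sets borel" and \<nu>: "prob_space \<nu>" "sets \<nu> = sets borel"
    and eq: "\<And>f :: real \<Rightarrow> complex. continuous_on UNIV f \<Longrightarrow> (f \<longlongrightarrow> 0) at_infinity \<Longrightarrow> (\<integral>t. f t \<partial>\<mu>) = (\<integral>t. f t \<partial>\<nu>)"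
  shows "\<mu> = \<nu>"
proof -
  have interval: "emeasure \<mu> {a<..<b} = emeasure \<nu> {a<..<b}" for a b :: real
  proof -
    define h where "h j t = min 1 (real j * max 0 (min (t - a) (b - t)))" for j t
    have cont: "continuous_on UNIV (h j)" for j unfolding h_def by (intro continuous_intros)
    have zero: "h j t = 0" if "t \<notin> {a<..<b}" for j t 
    proof -
      have "min (t - a) (b - t) \<le> 0" using that by auto
      thus ?thesis by (simp add: h_def)
    qed
    have lim: "(\<lambda>j. h j t) \<longlonglongrightarrow> indicator {a<..<b} t" for t
    proof (cases "t \<in> {a<..<b}")
      case True
      define m where "m = min (t - a) (b - t)"
      have m: "m > 0" using True by (simp add: m_def)
      obtain J where J: "1 < real J * m" using reals_Archimedean3[OF m] by blast
      have "h j t = 1" if "j \<ge> J" for j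
      proof -
        have "real J * m \<le> real j * m" using that m by simp
        hence "1 \<le> real j * m" using J by linarith
        thus ?thesis using m by (simp add: h_def m_def[symmetric])
      qed
      hence "\<forall>\<^sub>F j in sequentially. h j t = indicator {a<..<b} t"
        using True by (auto simp: eventually_sequentially)
      thus ?thesis by (rule tendsto_eventually)
    qed (use zero in simp)
    have conv: "(\<lambda>j. \<integral>t. h j t \<partial>M) \<longlonglongrightarrow> measure M {a<..<b}" if M: "prob_space M" "sets M = sets borel" for M
    proof -
      interpret prob_space M by fact
      have "(\<lambda>j. \<integral>t. h j t \<partial>M) \<longlonglongrightarrow> (\<integral>t. indicator {a<..<b} t \<partial>M)"
      proof (rule integral_dominated_convergence[where w = "\<lambda>_. 1"])
        show "h j \<in> borel_measurable M" for j
          using borel_measurable_continuous_onI[OF cont[of j]] measurable_cong_sets[OF M(2) refl] by blast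
        show "AE t in M. norm (h j t) \<le> 1" for j by (auto simp: h_def)
      qed (use lim M(2) in auto)
      thus ?thesis using M(2) sets_eq_imp_space_eq[OF M(2)] by simp
    qed
    have "(\<integral>t. h j t \<partial>\<mu>) = (\<integral>t. h j t \<partial>\<nu>)" for j
    proof -
      have "((\<lambda>t. complex_of_real (h j t)) \<longlongrightarrow> 0) at_infinity"
      proof (rule tendsto_eventually)
        show "\<forall>\<^sub>F t in at_infinity. complex_of_real (h j t) = 0"
          unfolding eventually_at_infinity
          by (rule exI[of _ "\<bar>a\<bar> + \<bar>b\<bar>"]) (auto intro!: zero)
      qed
      hence "(\<integral>t. complex_of_real (h j t) \<partial>\<mu>) = (\<integral>t. complex_of_real (h j t) \<partial>\<nu>)"
        using cont[of j] by (intro eq continuous_on_of_real) auto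
      thus ?thesis by (simp only: integral_complex_of_real of_real_eq_iff)
    qed
    hence "measure \<mu> {a<..<b} = measure \<nu> {a<..<b}"
      using conv[OF \<mu>] conv[OF \<nu>] LIMSEQ_unique by (simp only:) blast
    thus ?thesis using \<mu>(1) \<nu>(1) by (simp add: finite_measure.emeasure_eq_measure prob_space.finite_measure)
  qed
  show ?thesis
  proof (rule measure_eqI_generator_eq[where E = "range (\<lambda>(a, b). {a<..<b::real})" and \<Omega> = UNIV
        and A = "\<lambda>i. {- real i<..<real i}"])
    show "Int_stable (range (\<lambda>(a, b). {a<..<b::real}))"
      by (auto simp: Int_stable_def)
    have "sets (borel :: real measure) = sigma_sets UNIV (range (\<lambda>(a, b). {a<..<b}))"
      using arg_cong[OF borel_eq_box[where 'a = real], of sets] by (simp add: box_real)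
    thus "sets \<mu> = sigma_sets UNIV (range (\<lambda>(a, b). {a<..<b}))" "sets \<nu> = sigma_sets UNIV (range (\<lambda>(a, b). {a<..<b}))"
      using \<mu>(2) \<nu>(2) by auto
    show "(\<Union>i. {- real i<..<real i}) = UNIV"
    proof (intro equalityI subsetI UNIV_I)
      fix t :: real
      obtain i where "\<bar>t\<bar> < real i" using reals_Archimedean2 by blast
      thus "t \<in> (\<Union>i. {- real i<..<real i})" by (intro UN_I[of i]) auto
    qed
    show "emeasure \<mu> {- real i<..<real i} \<noteq> \<infinity>" for i
      using \<mu>(1) by (simp add: finite_measure.emeasure_finite prob_space.finite_measure)
  qed (use interval in auto)
qed

lemma prob_measure_eqI_stieltjes:
  fixes \<mu> \<nu> :: "real measure"
  assumes \<mu>: "prob_space \<mu>" "sets \<mu> = sets borel" and \<nu>: "prob_space \<nu>" "sets \<nu> = sets borel"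
    and eq: "\<And>z. Im z > 0 \<Longrightarrow> (\<integral>t. 1 / (complex_of_real t - z) \<partial>\<mu>) = (\<integral>t. 1 / (complex_of_real t - z) \<partial>\<nu>)"
  shows "\<mu> = \<nu>"
proof (rule prob_measure_eqI_vanishing_at_infinity[OF \<mu> \<nu>])
  fix f :: "real \<Rightarrow> complex" assume f: "continuous_on UNIV f" "(f \<longlongrightarrow> 0) at_infinity"
  \<comment> \<open>A constant sequence of means turns the convergence lemma into an
    equality.\<close>
  have "(\<lambda>k::nat. \<integral>t. f t \<partial>\<mu>) \<longlonglongrightarrow> (\<integral>t. f t \<partial>\<nu>)"
    by (rule is_mean_tendsto[OF is_mean_integral[OF \<mu>] is_mean_integral[OF \<nu>] _
          resolvent_algebra_vanishing_at_infinity[OF f]]) (simp add: eq)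
  thus "(\<integral>t. f t \<partial>\<mu>) = (\<integral>t. f t \<partial>\<nu>)" by (simp add: LIMSEQ_const_iff)
qed

text \<open>The weights sit on indices and are pushed forward along \<open>e\<close>, so repeated
  eigenvalues need no separate treatment.\<close>

definition atomic_measure :: "nat \<Rightarrow> (nat \<Rightarrow> real) \<Rightarrow> (nat \<Rightarrow> real) \<Rightarrow> real measure" where
  "atomic_measure N w e = distr (point_measure {..<N} w) borel e"

lemma integral_atomic_measure:
  fixes f :: "real \<Rightarrow> 'b :: {banach, second_countable_topology}"
  assumes "\<And>i. 0 \<le> w i" "f \<in> borel_measurable borel"
  shows "(\<integral>t. f t \<partial>atomic_measure N w e) = (\<Sum>i<N. w i *\<^sub>R f (e i))"
proof -
  have "(\<integral>t. f t \<partial>atomic_measure N w e) = (\<integral>i. f (e i) \<partial>point_measure {..<N} w)"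
    unfolding atomic_measure_def by (rule integral_distr) (use assms in \<open>auto simp: point_measure_def\<close>)
  thus ?thesis using assms by (simp add: lebesgue_integral_point_measure_finite)
qed

lemma real_distribution_atomic_measure:
  assumes "\<And>i. 0 \<le> w i" "(\<Sum>i<N. w i) = 1"
  shows "real_distribution (atomic_measure N w e)"
proof -
  have "prob_space (point_measure {..<N} w)"
    by (rule prob_spaceI)
      (use assms in \<open>simp add: space_point_measure emeasure_point_measure_finite sum_ennreal\<close>)
  hence "prob_space (atomic_measure N w e)"
    unfolding atomic_measure_def by (rule prob_space.prob_space_distr) (auto simp: point_measure_def)
  thus ?thesis by (simp add: real_distribution_def real_distribution_axioms_def atomic_measure_def)
qed

lemma measure_atomic_measure:
  assumes "\<And>i. 0 \<le> w i" "(\<Sum>i<N. w i) = 1" "A \<in> sets borel"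
  shows "measure (atomic_measure N w e) A = (\<Sum>i<N. w i * indicator A (e i))"
proof -
  interpret real_distribution "atomic_measure N w e" by (rule real_distribution_atomic_measure[OF assms(1,2)])
  have "measure (atomic_measure N w e) A = (\<integral>t. indicator A t \<partial>atomic_measure N w e)"
    using assms(3) by simp
  also have "\<dots> = (\<Sum>i<N. w i *\<^sub>R indicator A (e i))" by (rule integral_atomic_measure) (use assms in auto)
  finally show ?thesis by simp
qed

text \<open>Chebyshev's inequality with the uniform second moment bound; the added 1 in the cut-off
  \<open>L\<close> makes the final inequality strict.\<close>

lemma tight_atomic_measure:
  assumes w: "\<And>k i. 0 \<le> w k i" "\<And>k. (\<Sum>i<N k. w k i) = 1" and C: "\<And>k. (\<Sum>i<N k. w k i * (e k i)\<^sup>2) \<le> C"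
  shows "tight (\<lambda>k. atomic_measure (N k) (w k) (e k))"
  unfolding tight_def
proof (intro conjI allI impI)
  show "real_distribution (atomic_measure (N k) (w k) (e k))" for k
    by (rule real_distribution_atomic_measure) (use w in auto)
  fix \<epsilon> :: real assume \<epsilon>: "\<epsilon> > 0"
  define L where "L = sqrt ((\<bar>C\<bar> + 1) / \<epsilon>)"
  have L: "L > 0" "L\<^sup>2 = (\<bar>C\<bar> + 1) / \<epsilon>" using \<epsilon> by (simp_all add: L_def)
  show "\<exists>a b. a < b \<and> (\<forall>k. 1 - \<epsilon> < measure (atomic_measure (N k) (w k) (e k)) {a<..b})"
  proof (intro exI conjI allI)
    show "- L < L" using L by simp
    fix k
    have "1 - measure (atomic_measure (N k) (w k) (e k)) {-L<..L}
        = (\<Sum>i<N k. w k i) - (\<Sum>i<N k. w k i * indicator {-L<..L} (e k i))"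
      using w by (simp add: measure_atomic_measure)
    also have "\<dots> = (\<Sum>i<N k. w k i * (1 - indicator {-L<..L} (e k i)))"
      by (simp add: sum_subtractf right_diff_distrib)
    also have "\<dots> \<le> (\<Sum>i<N k. w k i * ((e k i)\<^sup>2 / L\<^sup>2))"
    proof (intro sum_mono mult_left_mono w)
      fix i
      have "L\<^sup>2 \<le> (e k i)\<^sup>2" if "e k i \<notin> {-L<..L}"
        using that L(1) abs_le_square_iff[of L "e k i"] by auto
      thus "1 - indicator {-L<..L} (e k i) \<le> (e k i)\<^sup>2 / L\<^sup>2" using L(1) by (simp add: indicator_def)
    qed
    also have "\<dots> = (\<Sum>i<N k. w k i * (e k i)\<^sup>2) / L\<^sup>2" by (simp add: sum_divide_distrib)
    also have "\<dots> \<le> C / L\<^sup>2" using C by (intro divide_right_mono) auto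
    also have "\<dots> < \<epsilon>"
    proof -
      have "C * \<epsilon> < (\<bar>C\<bar> + 1) * \<epsilon>" using \<epsilon> by (intro mult_strict_right_mono) auto
      thus ?thesis by (simp add: L(2) pos_divide_less_eq mult.commute)
    qed
    finally show "1 - \<epsilon> < measure (atomic_measure (N k) (w k) (e k)) {-L<..L}" by linarith
  qed
qed

section \<open>Existence of the spectral measure\<close>

context hierarchical_model
begin

lemma sum_Hkernel_sq_le: "(\<Sum>y\<in>hblock n k x. (Hkernel n p k \<omega> x y)\<^sup>2) \<le> (1 + \<bar>\<omega> x\<bar>)\<^sup>2"
proof -
  let ?B = "hblock n k x" and ?d = "\<lambda>y. if y = x then 1 else 0 :: complex"
  let ?E = "\<lambda>y. \<Sum>s=1..k. of_real (p s) * Eop n s ?d y"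
  have fin: "finite ?B" using n_pos by simp
  have d: "L2_set (\<lambda>y. cmod (?d y)) ?B = 1" by (rule L2_set_delta[OF fin hblock_self])
  have "Hfin n p k \<omega> ?d y = of_real (Hkernel n p k \<omega> x y)" if "y \<in> ?B" for y
  proof -
    have "Hfin n p k \<omega> ?d y = (\<Sum>y'\<in>?B. if y' = x then of_real (Hkernel n p k \<omega> y x) else 0)"
      unfolding Hfin_eq_Hkernel[OF n2 that order_refl] by (intro sum.cong) auto
    thus ?thesis using fin Hkernel_sym[of n p k \<omega> x y] by simp
  qed
  hence "L2_set (\<lambda>y. Hkernel n p k \<omega> x y) ?B = L2_set (\<lambda>y. cmod (Hfin n p k \<omega> ?d y)) ?B"
    by (simp add: L2_set_def)
  also have "\<dots> \<le> L2_set (\<lambda>y. cmod (?E y) + \<bar>\<omega> x\<bar> * cmod (?d y)) ?B"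
    by (rule L2_set_mono) (auto simp: Hfin_def norm_mult intro!: order_trans[OF norm_triangle_ineq])
  also have "\<dots> \<le> L2_set (\<lambda>y. cmod (?E y)) ?B + L2_set (\<lambda>y. \<bar>\<omega> x\<bar> * cmod (?d y)) ?B"
    by (rule L2_set_triangle_ineq)
  also have "L2_set (\<lambda>y. \<bar>\<omega> x\<bar> * cmod (?d y)) ?B = \<bar>\<omega> x\<bar> * L2_set (\<lambda>y. cmod (?d y)) ?B"
    by (rule L2_set_right_distrib[symmetric]) simp
  also have "L2_set (\<lambda>y. cmod (?E y)) ?B \<le> (\<Sum>s=1..k. p s) * L2_set (\<lambda>y. cmod (?d y)) ?B"
    by (rule L2_set_sum_Eop_le[OF n2]) (auto intro: p_nonneg)
  finally have "L2_set (\<lambda>y. Hkernel n p k \<omega> x y) ?B \<le> 1 + \<bar>\<omega> x\<bar>"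
    using sum_p_le[of k] unfolding d by linarith
  hence "(L2_set (\<lambda>y. Hkernel n p k \<omega> x y) ?B)\<^sup>2 \<le> (1 + \<bar>\<omega> x\<bar>)\<^sup>2" by (rule power_mono) (rule L2_set_nonneg)
  thus ?thesis by (simp add: L2_set_def sum_nonneg)
qed

text \<open>A subsequence from tightness is enough for a witness of the \<open>THE\<close> in
  \<open>spec_meas\<close>, because the transforms \<open>G k \<omega> z x\<close> converge to
  \<open>green\<close> along the whole sequence. Uniqueness is injectivity of the Stieltjes
  transform.\<close>

theorem spec_meas_stieltjes:
  shows "prob_space (spec_meas n p x \<omega>)" "sets (spec_meas n p x \<omega>) = sets borel"
    "Im z > 0 \<Longrightarrow> (\<integral>t. 1 / (complex_of_real t - z) \<partial>spec_meas n p x \<omega>) = green n p x \<omega> z"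
proof -
  \<comment> \<open>Packaging the facts at the single site \<open>x\<close> lets weights and
    eigenvalues be chosen for all levels at once.\<close>
  define Q where "Q k W e \<longleftrightarrow> (\<forall>i. 0 \<le> W i) \<and> (\<Sum>i<n ^ k. W i) = (1::real)
    \<and> (\<Sum>i<n ^ k. W i * (e i)\<^sup>2) \<le> (1 + \<bar>\<omega> x\<bar>)\<^sup>2
    \<and> (\<forall>z. Im z > 0 \<longrightarrow> G k \<omega> z x = (\<Sum>i<n ^ k. of_real (W i) / (of_real (e i) - z)))" for k W e
  have "\<exists>W e. Q k W e" for k
  proof -
    obtain W e where W: "\<And>y i. 0 \<le> W y i"
      "\<And>y. y \<in> hblock n k x \<Longrightarrow> (\<Sum>i<n ^ k. W y i) = 1"
      "\<And>i. i < n ^ k \<Longrightarrow> (\<Sum>y\<in>hblock n k x. W y i) = 1"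
      "\<And>y. y \<in> hblock n k x \<Longrightarrow> (\<Sum>i<n ^ k. W y i * (e i)\<^sup>2) = (\<Sum>y'\<in>hblock n k x. (Hkernel n p k \<omega> y y')\<^sup>2)"
      "\<And>y z. y \<in> hblock n k x \<Longrightarrow> Im z > 0 \<Longrightarrow> G k \<omega> z y = (\<Sum>i<n ^ k. of_real (W y i) / (of_real (e i) - z))"
      "Hk_eigs n p x k \<omega> = image_mset e (mset_set {..<n ^ k})"
      by (rule G_spectral) (rule that)
    have "Q k (W x) e"
      using W(1)[of x] W(2,4,5)[OF hblock_self] sum_Hkernel_sq_le[where k = k and x = x and \<omega> = \<omega>]
      by (simp add: Q_def)
    thus ?thesis by blast
  qed
  then obtain W e where Q: "\<And>k. Q k (W k) (e k)" by metis
  have W: "\<And>k i. 0 \<le> W k i" "\<And>k. (\<Sum>i<n ^ k. W k i) = (1::real)"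
      "\<And>k. (\<Sum>i<n ^ k. W k i * (e k i)\<^sup>2) \<le> (1 + \<bar>\<omega> x\<bar>)\<^sup>2"
      "\<And>k z. Im z > 0 \<Longrightarrow> G k \<omega> z x = (\<Sum>i<n ^ k. of_real (W k i) / (of_real (e k i) - z))"
    using Q unfolding Q_def by blast+
  let ?\<mu> = "\<lambda>k. atomic_measure (n ^ k) (W k) (e k)"
  have "tight ?\<mu>" by (rule tight_atomic_measure) (use W in auto)
  from tight_imp_convergent_subsubsequence[OF this strict_mono_id]
  obtain r \<mu> where r: "strict_mono r" and \<mu>: "real_distribution \<mu>" and conv: "weak_conv_m (?\<mu> \<circ> id \<circ> r) \<mu>" by blast
  interpret \<mu>: real_distribution \<mu> by fact
  have st: "(\<integral>t. 1 / (complex_of_real t - z) \<partial>\<mu>) = green n p x \<omega> z" if z: "Im z > 0" for z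
  proof -
    have "(\<lambda>k. \<integral>t. 1 / (complex_of_real t - z) \<partial>(?\<mu> \<circ> id \<circ> r) k) \<longlonglongrightarrow> (\<integral>t. 1 / (complex_of_real t - z) \<partial>\<mu>)"
    proof (rule weak_conv_imp_integral_bdd_continuous_conv[OF _ \<mu> conv])
      show "real_distribution ((?\<mu> \<circ> id \<circ> r) k)" for k
        using W by (auto intro!: real_distribution_atomic_measure)
      show "isCont (\<lambda>t. 1 / (complex_of_real t - z)) t" for t
        using z by (intro continuous_intros) (auto simp: complex_eq_iff)
      show "cmod (1 / (complex_of_real t - z)) \<le> 1 / \<bar>Im z\<bar>" for t using z by (intro cmod_resolvent_le) simp
    qed
    moreover have "(\<integral>t. 1 / (complex_of_real t - z) \<partial>(?\<mu> \<circ> id \<circ> r) k) = G (r k) \<omega> z x" for k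
    proof -
      have "(\<lambda>t. 1 / (complex_of_real t - z)) \<in> borel_measurable borel"
        using z by (intro resolvent_algebra_measurable resolvent_algebra.resolvent) simp
      thus ?thesis using W z by (simp add: integral_atomic_measure scaleR_conv_of_real)
    qed
    moreover have "(\<lambda>k. G (r k) \<omega> z x) \<longlonglongrightarrow> green n p x \<omega> z"
      using LIMSEQ_subseq_LIMSEQ[OF G_tendsto_green[OF z] r] by (simp add: o_def)
    ultimately show ?thesis using LIMSEQ_unique by auto
  qed
  have "spec_meas n p x \<omega> = \<mu>"
    unfolding spec_meas_def
  proof (rule the_equality)
    show "sets \<mu> = sets borel \<and> prob_space \<mu> \<and>
        (\<forall>z. Im z > 0 \<longrightarrow> (\<integral>t. 1 / (complex_of_real t - z) \<partial>\<mu>) = green n p x \<omega> z)"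
      using st \<mu>.prob_space_axioms by simp
    fix \<nu> :: "real measure" assume "sets \<nu> = sets borel \<and> prob_space \<nu> \<and>
        (\<forall>z. Im z > 0 \<longrightarrow> (\<integral>t. 1 / (complex_of_real t - z) \<partial>\<nu>) = green n p x \<omega> z)"
    thus "\<nu> = \<mu>" using st \<mu>.prob_space_axioms by (intro prob_measure_eqI_stieltjes) auto
  qed
  thus "prob_space (spec_meas n p x \<omega>)" "sets (spec_meas n p x \<omega>) = sets borel"
    "Im z > 0 \<Longrightarrow> (\<integral>t. 1 / (complex_of_real t - z) \<partial>spec_meas n p x \<omega>) = green n p x \<omega> z"
    using st \<mu>.prob_space_axioms by simp_all
qed

end

section \<open>Translation covariance\<close>

text \<open>Addition without carry on the lowest \<open>m\<close> digits in base \<open>n\<close>, which preserves all distances up to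
  level \<open>m\<close>. The higher digits are irrelevant for the truncation at level \<open>m\<close> and are added with carry.\<close>

primrec digit_add :: "nat \<Rightarrow> nat \<Rightarrow> nat \<Rightarrow> nat \<Rightarrow> nat" where
  "digit_add n 0 x y = x + y"
| "digit_add n (Suc m) x y = n * digit_add n m (x div n) (y div n) + (x mod n + y mod n) mod n"

lemma digit_add_0_right: "digit_add n m x 0 = x"
  by (induction m arbitrary: x) auto

text \<open>Without carries out of the lowest s digits, the higher digits of the result depend only
  on the higher digits of the summands.\<close>

lemma digit_add_div:
  assumes "n > 0" "s \<le> m"
  shows "digit_add n m x y div n ^ s = digit_add n (m - s) (x div n ^ s) (y div n ^ s)"
  using assms(2)
proof (induction s arbitrary: m x y)
  case (Suc s)
  then obtain m' where m: "m = Suc m'" "s \<le> m'" by (cases m) auto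
  have "digit_add n m x y div n = digit_add n m' (x div n) (y div n)"
    using assms(1) by (simp add: m)
  thus ?case using Suc.IH[OF m(2), of "x div n" "y div n"] by (simp add: m div_mult2_eq)
qed simp

lemma mod_add_left_cancel:
  fixes a b c n :: nat
  assumes "(a + b) mod n = (a + c) mod n" "a < n" "b < n" "c < n"
  shows "b = c"
proof -
  have *: "(a + t) mod n = (if a + t < n then a + t else a + t - n)" if "t < n" for t
  proof (cases "a + t < n")
    case False
    moreover from this have "a + t - n < n" using that assms(2) by linarith
    ultimately show ?thesis by (simp add: le_mod_geq)
  qed simp
  show ?thesis
    using assms(1) unfolding *[OF assms(3)] *[OF assms(4)] using assms(2-4) by (auto split: if_splits)
qed

lemma digit_add_eq_iff:
  assumes "n > 0"
  shows "digit_add n m x y = digit_add n m x y' \<longleftrightarrow> y = y'"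
proof (induction m arbitrary: x y y')
  case (Suc m)
  show ?case
  proof
    assume eq: "digit_add n (Suc m) x y = digit_add n (Suc m) x y'"
    have "digit_add n m (x div n) (y div n) = digit_add n m (x div n) (y' div n)"
      using arg_cong[OF eq, of "\<lambda>t. t div n"] assms by simp
    hence d: "y div n = y' div n" using Suc.IH by simp
    have m: "(x mod n + y mod n) mod n = (x mod n + y' mod n) mod n"
      using arg_cong[OF eq, of "\<lambda>t. t mod n"] assms by simp
    have "y mod n = y' mod n" by (rule mod_add_left_cancel[OF m]) (use assms in simp_all)
    with d show "y = y'" by (metis div_mult_mod_eq)
  qed simp
qed simp

lemma digit_add_div_eq_iff:
  assumes "n > 0" "s \<le> m"
  shows "digit_add n m x y div n ^ s = digit_add n m x y' div n ^ s \<longleftrightarrow> y div n ^ s = y' div n ^ s"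
  using assms by (simp add: digit_add_div digit_add_eq_iff)

lemma inj_digit_add: "n > 0 \<Longrightarrow> inj (digit_add n m x)"
  by (simp add: inj_def digit_add_eq_iff)

text \<open>Respecting quotients gives an inclusion; equality follows by counting, as the map is
  injective but in general not onto the naturals.\<close>

lemma digit_add_image_hblock:
  assumes "n > 0" "s \<le> m"
  shows "digit_add n m x ` hblock n s y = hblock n s (digit_add n m x y)"
proof (rule card_subset_eq)
  show "finite (hblock n s (digit_add n m x y))" using assms by simp
  show "digit_add n m x ` hblock n s y \<subseteq> hblock n s (digit_add n m x y)"
    using assms by (auto simp: hblock_def digit_add_div_eq_iff)
  have "inj_on (digit_add n m x) (hblock n s y)"
    using inj_digit_add[OF assms(1)] by (rule inj_on_subset) simp
  thus "card (digit_add n m x ` hblock n s y) = card (hblock n s (digit_add n m x y))"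
    using assms by (simp add: card_image)
qed

lemma Eop_digit_add:
  assumes "n \<ge> 2" "s \<le> m"
  shows "Eop n s (\<lambda>y. \<psi> (digit_add n m x y)) y = Eop n s \<psi> (digit_add n m x y)"
proof -
  have n: "n > 0" using assms by simp
  have "inj_on (digit_add n m x) (hblock n s y)"
    using inj_digit_add[OF n] by (rule inj_on_subset) simp
  thus ?thesis using assms n
    by (simp add: Eop_eq_hblock digit_add_image_hblock[symmetric] sum.reindex)
qed

context hierarchical_model
begin

text \<open>The digit shift commutes with all averages up to level m, so the column at
  \<open>x\<close>, pulled back along it, is the column at 0 for the pulled-back potential.\<close>

lemma G_digit_add:
  assumes z: "Im z > 0"
  shows "G m \<omega> z x = G m (\<lambda>y. \<omega> (digit_add n m x y)) z 0"
proof -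
  let ?\<pi> = "digit_add n m x" and ?\<psi> = "R m \<omega> z x"
  have \<pi>0: "?\<pi> 0 = x" by (rule digit_add_0_right)
  have "fv_resolvent n p m (\<lambda>y. \<omega> (?\<pi> y)) z 0 (\<lambda>y. ?\<psi> (?\<pi> y))"
    unfolding fv_resolvent_def
  proof (intro conjI allI impI ballI)
    fix y assume "y \<notin> hblock n m 0"
    hence "?\<pi> y \<notin> hblock n m x"
      using digit_add_div_eq_iff[OF n_pos order_refl, of m x y 0] \<pi>0 by (simp add: hblock_def)
    thus "?\<psi> (?\<pi> y) = 0" using R_spec[OF z, of m \<omega> x] by (simp add: fv_resolvent_def)
  next
    fix y
    have "Hfin n p m (\<lambda>y. \<omega> (?\<pi> y)) (\<lambda>y. ?\<psi> (?\<pi> y)) y = Hfin n p m \<omega> ?\<psi> (?\<pi> y)"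
      unfolding Hfin_def using n2 by (simp add: Eop_digit_add)
    moreover have "?\<pi> y = x \<longleftrightarrow> y = 0" using digit_add_eq_iff[OF n_pos, of m x y 0] \<pi>0 by simp
    ultimately show "Hfin n p m (\<lambda>y. \<omega> (?\<pi> y)) (\<lambda>y. ?\<psi> (?\<pi> y)) y - z * ?\<psi> (?\<pi> y) = (if y = 0 then 1 else 0)"
      using fv_resolvent_eq[OF n2 R_spec[OF z], of m \<omega> x "?\<pi> y"] by simp
  qed
  from R_eqI[OF z this] show ?thesis by (simp add: G_def \<pi>0)
qed

text \<open>The choice in \<open>R\<close> is made from a predicate that reads the potential only in
  the block of \<open>x\<close>. This locality is the source of independence.\<close>

lemma G_cong:
  assumes "\<And>y. y \<in> hblock n m x \<Longrightarrow> \<omega> y = \<omega>' y"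
  shows "G m \<omega> z x = G m \<omega>' z x"
proof -
  have "fv_resolvent n p m \<omega> z x = fv_resolvent n p m \<omega>' z x"
    unfolding fv_resolvent_def Hfin_def using assms by (auto simp: fun_eq_iff)
  thus ?thesis by (simp add: G_def R_def)
qed

lemma cmod_G_potential_diff_le:
  assumes z: "Im z > 0"
  shows "cmod (G m \<omega> z x - G m \<omega>' z x) \<le> (\<Sum>y\<in>hblock n m x. \<bar>\<omega> y - \<omega>' y\<bar>) / (Im z)\<^sup>2"
proof -
  let ?B = "hblock n m x" and ?d = "\<lambda>y. R m \<omega> z x y - R m \<omega>' z x y"
  let ?f = "\<lambda>y. of_real (\<omega> y - \<omega>' y) * R m \<omega>' z x y"
  have "Im z * L2_set (\<lambda>y. cmod (?d y)) ?B \<le> L2_set (\<lambda>y. cmod (- ?f y)) ?B"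
  proof (rule Hfin_resolvent_bound[OF n2 order_refl z])
    fix y
    have "Hfin n p m \<omega> (R m \<omega>' z x) y = Hfin n p m \<omega>' (R m \<omega>' z x) y + ?f y"
      by (simp add: Hfin_def algebra_simps)
    thus "Hfin n p m \<omega> ?d y - z * ?d y = - ?f y"
      using fv_resolvent_eq[OF n2 R_spec[OF z], of m \<omega> x y] fv_resolvent_eq[OF n2 R_spec[OF z], of m \<omega>' x y]
      by (simp only: Hfin_diff[OF n2] right_diff_distrib) (simp add: algebra_simps)
  qed
  also have "\<dots> \<le> (\<Sum>y\<in>?B. \<bar>cmod (- ?f y)\<bar>)" by (rule L2_set_le_sum_abs)
  also have "\<dots> \<le> (\<Sum>y\<in>?B. \<bar>\<omega> y - \<omega>' y\<bar> * (1 / Im z))"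
  proof (rule sum_mono)
    fix y
    show "\<bar>cmod (- ?f y)\<bar> \<le> \<bar>\<omega> y - \<omega>' y\<bar> * (1 / Im z)"
      using mult_left_mono[OF cmod_R_le[OF z, of m \<omega>' x y], of "\<bar>\<omega> y - \<omega>' y\<bar>"]
      by (simp only: norm_minus_cancel norm_mult norm_of_real abs_mult abs_norm_cancel abs_idempotent abs_ge_zero)
  qed
  finally have "Im z * L2_set (\<lambda>y. cmod (?d y)) ?B \<le> (\<Sum>y\<in>?B. \<bar>\<omega> y - \<omega>' y\<bar>) / Im z"
    by (simp add: sum_divide_distrib)
  hence "L2_set (\<lambda>y. cmod (?d y)) ?B \<le> (\<Sum>y\<in>?B. \<bar>\<omega> y - \<omega>' y\<bar>) / (Im z)\<^sup>2"
    using z by (simp add: field_simps power2_eq_square)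
  thus ?thesis unfolding G_def using norm_le_L2_set[OF finite_hblock[OF n_pos] hblock_self, of ?d x m] by linarith
qed

text \<open>Measurability of an object defined by choice comes from continuity in the product
  topology, whose Borel sets form the product sigma-algebra.\<close>

lemma continuous_G:
  assumes z: "Im z > 0"
  shows "continuous_on UNIV (\<lambda>\<omega>. G m \<omega> z x)"
  unfolding continuous_on_def
proof
  fix \<omega>0 :: "nat \<Rightarrow> real"
  let ?h = "\<lambda>\<omega>. (\<Sum>y\<in>hblock n m x. \<bar>\<omega> y - \<omega>0 y\<bar>) / (Im z)\<^sup>2"
  have "continuous_on UNIV ?h" using z by (intro continuous_intros continuous_on_product_coordinates) auto
  hence "(?h \<longlongrightarrow> ?h \<omega>0) (at \<omega>0 within UNIV)" unfolding continuous_on_def by blast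
  hence h: "(?h \<longlongrightarrow> 0) (at \<omega>0 within UNIV)" by simp
  have "((\<lambda>\<omega>. G m \<omega> z x - G m \<omega>0 z x) \<longlongrightarrow> 0) (at \<omega>0 within UNIV)"
    by (rule Lim_null_comparison[OF always_eventually h]) (intro allI cmod_G_potential_diff_le z)
  thus "((\<lambda>\<omega>. G m \<omega> z x) \<longlongrightarrow> G m \<omega>0 z x) (at \<omega>0 within UNIV)" by (simp add: LIM_zero_iff)
qed

end

section \<open>The law of large numbers\<close>

lemma borel_measurable_cnj:
  "f \<in> borel_measurable M \<Longrightarrow> (\<lambda>x. cnj (f x)) \<in> borel_measurable M"
  by (rule borel_measurable_continuous_on) (auto intro: continuous_intros)

text \<open>By monotone convergence the series of the \<open>X k\<close> has finite integral; almost
  surely it converges, so its terms tend to 0.\<close>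

lemma AE_tendsto_zero_of_summable_integrals:
  fixes X :: "nat \<Rightarrow> 'a \<Rightarrow> real"
  assumes int: "\<And>k. integrable M (X k)" and nonneg: "\<And>k \<omega>. 0 \<le> X k \<omega>"
    and le: "\<And>k. (\<integral>\<omega>. X k \<omega> \<partial>M) \<le> a k" and a: "summable a"
  shows "AE \<omega> in M. (\<lambda>k. X k \<omega>) \<longlonglongrightarrow> 0"
proof -
  have [measurable]: "X k \<in> borel_measurable M" for k using int by simp
  have a0: "0 \<le> a k" for k using le[of k] Bochner_Integration.integral_nonneg[of M "X k"] nonneg[of k] by (meson order_trans)
  have "(\<integral>\<^sup>+\<omega>. (\<Sum>k. ennreal (X k \<omega>)) \<partial>M) = (\<Sum>k. \<integral>\<^sup>+\<omega>. ennreal (X k \<omega>) \<partial>M)"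
    by (rule nn_integral_suminf) simp
  also have "\<dots> \<le> (\<Sum>k. ennreal (a k))"
  proof (rule suminf_le)
    show "(\<integral>\<^sup>+\<omega>. ennreal (X k \<omega>) \<partial>M) \<le> ennreal (a k)" for k
      using int nonneg le by (simp add: nn_integral_eq_integral ennreal_leI)
  qed auto
  also have "\<dots> = ennreal (\<Sum>k. a k)" by (rule suminf_ennreal2[OF a0 a])
  finally have "(\<integral>\<^sup>+\<omega>. (\<Sum>k. ennreal (X k \<omega>)) \<partial>M) \<noteq> \<infinity>" by (auto simp: top_unique)
  hence "AE \<omega> in M. (\<Sum>k. ennreal (X k \<omega>)) \<noteq> \<infinity>" by (intro nn_integral_noteq_infinite) auto
  thus ?thesis
  proof eventually_elim
    case (elim \<omega>)
    have "summable (\<lambda>k. X k \<omega>)" by (rule summable_suminf_not_top) (use nonneg elim in \<open>auto simp: infinity_ennreal_def\<close>)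
    thus ?case by (rule summable_LIMSEQ_zero)
  qed
qed

locale hierarchical_anderson = hierarchical_model +
  fixes D :: "real measure"
  assumes prob_D: "prob_space D" and sets_D: "sets D = sets borel"
begin

definition "P \<equiv> PiM (UNIV :: nat set) (\<lambda>_. D)"

sublocale P: prob_space P
  unfolding P_def by (rule prob_space_PiM) (rule prob_D)

lemma sets_P: "sets P = sets borel"
proof -
  have "sets P = sets (PiM UNIV (\<lambda>_::nat. borel :: real measure))"
    unfolding P_def by (rule sets_PiM_cong) (auto simp: sets_D)
  thus ?thesis using sets_PiM_equal_borel by simp
qed

lemma measurable_G:
  assumes "Im z > 0"
  shows "(\<lambda>\<omega>. G m \<omega> z x) \<in> borel_measurable P"
  using borel_measurable_continuous_onI[OF continuous_G[OF assms]] measurable_cong_sets[OF sets_P refl] by blast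

lemma integrable_G: "Im z > 0 \<Longrightarrow> integrable P (\<lambda>\<omega>. G m \<omega> z x)"
  by (rule P.integrable_const_bound[of _ "1 / Im z"]) (auto intro: cmod_G_le measurable_G)

definition mean_G :: "nat \<Rightarrow> complex \<Rightarrow> complex" where
  "mean_G m z = (\<integral>\<omega>. G m \<omega> z 0 \<partial>P)"

text \<open>Reindexing i.i.d. coordinates by an injective map preserves the product measure, and the
  digit shift carries 0 to \<open>x\<close>.\<close>

lemma integral_G:
  assumes z: "Im z > 0"
  shows "(\<integral>\<omega>. G m \<omega> z x \<partial>P) = mean_G m z"
proof -
  let ?\<pi> = "digit_add n m x"
  let ?t = "\<lambda>\<omega>::nat \<Rightarrow> real. \<lambda>y\<in>UNIV. \<omega> (?\<pi> y)"
  have d: "distr P P ?t = P"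
    unfolding P_def
    by (rule distr_PiM_reindex[where M = "\<lambda>_. D"]) (auto intro: prob_D inj_digit_add n_pos)
  have t: "?t \<in> measurable P P"
    unfolding P_def by (rule measurable_restrict) (rule measurable_component_singleton, simp)
  have "(\<integral>\<omega>. G m \<omega> z x \<partial>P) = (\<integral>\<omega>. G m (?t \<omega>) z 0 \<partial>P)"
    using G_digit_add[OF z, of m _ x] by (simp add: restrict_def)
  also have "\<dots> = (\<integral>\<omega>. G m \<omega> z 0 \<partial>distr P P ?t)"
    by (rule integral_distr[symmetric, OF t measurable_G[OF z]])
  finally show ?thesis by (simp add: d mean_G_def)
qed

lemma indep_coordinates: "P.indep_vars (\<lambda>_. D) (\<lambda>i \<omega>. \<omega> i) (UNIV :: nat set)"
proof (subst P.indep_vars_iff_distr_eq_PiM)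
  show "(UNIV :: nat set) \<noteq> {}" by simp
  show rv: "(\<lambda>\<omega>. \<omega> i) \<in> measurable P D" for i unfolding P_def by (rule measurable_component_singleton) simp
  have "distr P D (\<lambda>\<omega>. \<omega> i) = D" for i
    unfolding P_def by (rule distr_PiM_component) (auto intro: prob_D)
  thus "distr P (PiM UNIV (\<lambda>i. D)) (\<lambda>x. \<lambda>i\<in>UNIV. x i) = PiM UNIV (\<lambda>i. distr P D (\<lambda>\<omega>. \<omega> i))"
    by (simp add: restrict_UNIV P_def[symmetric] distr_id)
qed

text \<open>Independence concerns restrictions to blocks, which live on a product over the block.
  Extension by 0 returns to the full product without changing \<open>G\<close>.\<close>

lemma measurable_G_restrict:
  assumes "Im z > 0"
  shows "(\<lambda>\<eta>. G m \<eta> z x) \<in> borel_measurable (PiM (hblock n m x) (\<lambda>_. D))"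
proof -
  let ?K = "hblock n m x"
  let ?ext = "\<lambda>\<eta> i. if i \<in> ?K then \<eta> i else 0"
  have "?ext \<in> measurable (PiM ?K (\<lambda>_. D)) P"
    unfolding P_def
  proof (rule measurable_PiM_single')
    show "(\<lambda>\<eta>. ?ext \<eta> i) \<in> measurable (PiM ?K (\<lambda>_. D)) D" for i
    proof (cases "i \<in> ?K")
      case True
      thus ?thesis using measurable_component_singleton[OF True, of "\<lambda>_. D"] by simp
    qed (use sets_eq_imp_space_eq[OF sets_D] in auto)
    show "?ext \<in> space (PiM ?K (\<lambda>_. D)) \<rightarrow> UNIV \<rightarrow>\<^sub>E space D"
      using sets_eq_imp_space_eq[OF sets_D] by auto
  qed
  from measurable_compose[OF this measurable_G[OF assms, of m x]]
  have "(\<lambda>\<eta>. G m (?ext \<eta>) z x) \<in> borel_measurable (PiM ?K (\<lambda>_. D))" .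
  moreover have "G m (?ext \<eta>) z x = G m \<eta> z x" for \<eta> by (rule G_cong) simp
  ultimately show ?thesis by simp
qed

text \<open>Different blocks of one level are disjoint, so the two entries read disjoint sets of
  independent coordinates and the expectation factorises into centred factors.\<close>

lemma uncorrelated_G:
  assumes z: "Im z > 0" and y: "y \<notin> hblock n m x"
  shows "(\<integral>\<omega>. (G m \<omega> z x - mean_G m z) * cnj (G m \<omega> z y - mean_G m z) \<partial>P) = 0"
proof -
  have xy: "x \<noteq> y" using y by auto
  \<comment> \<open>One family with the second variable already conjugated, as the product formula
    for independent variables expects.\<close>
  define Y where "Y j = (\<lambda>\<eta>. if j = x then G m \<eta> z x - mean_G m z else cnj (G m \<eta> z y - mean_G m z))" for j
  have "P.indep_vars (\<lambda>j. PiM (hblock n m j) (\<lambda>_. D)) (\<lambda>j \<omega>. restrict (\<lambda>i. \<omega> i) (hblock n m j)) {x, y}"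
    by (rule P.indep_vars_restrict[OF indep_coordinates])
      (use y in \<open>auto simp: disjoint_family_on_def hblock_def\<close>)
  hence "P.indep_vars (\<lambda>_. borel) (\<lambda>j \<omega>. Y j (restrict (\<lambda>i. \<omega> i) (hblock n m j))) {x, y}"
  proof (rule P.indep_vars_compose2)
    fix j assume "j \<in> {x, y}"
    thus "Y j \<in> measurable (PiM (hblock n m j) (\<lambda>_. D)) borel"
      using measurable_G_restrict[OF z, of m x] measurable_G_restrict[OF z, of m y] xy
      by (auto simp: Y_def intro!: borel_measurable_diff borel_measurable_cnj)
  qed
  moreover have "Y j (restrict (\<lambda>i. \<omega> i) (hblock n m j)) = Y j \<omega>" if "j \<in> {x, y}" for j \<omega>
    using that G_cong[of m x "restrict \<omega> (hblock n m x)" \<omega> z] G_cong[of m y "restrict \<omega> (hblock n m y)" \<omega> z] xy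
    by (auto simp: Y_def)
  ultimately have ind: "P.indep_vars (\<lambda>_. borel) Y {x, y}"
    using P.indep_vars_cong[of "{x, y}" "{x, y}" "\<lambda>j \<omega>. Y j (restrict (\<lambda>i. \<omega> i) (hblock n m j))" Y] by simp
  have int: "integrable P (\<lambda>\<omega>. G m \<omega> z v - mean_G m z)" for v by (intro Bochner_Integration.integrable_diff integrable_G z) simp
  have "(\<integral>\<omega>. (\<Prod>j\<in>{x, y}. Y j \<omega>) \<partial>P) = (\<Prod>j\<in>{x, y}. \<integral>\<omega>. Y j \<omega> \<partial>P)"
    by (rule P.indep_vars_lebesgue_integral[OF _ ind])
      (use int xy in \<open>auto simp: Y_def simp del: complex_cnj_diff intro!: integrable_cnj\<close>)
  moreover have "(\<integral>\<omega>. Y x \<omega> \<partial>P) = 0"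
    using integrable_G[OF z, of m x] by (simp add: Y_def integral_G[OF z] P.prob_space)
  ultimately show ?thesis using xy by (simp add: Y_def)
qed

text \<open>Of the n^(2k) covariances only those of pairs in a common block survive, at most n^k *
  n^m of them, each bounded by (2 / Im z)^2 because an entry and its mean are both bounded by 1 / Im
  z.\<close>

lemma variance_average_G:
  assumes z: "Im z > 0"
  shows "(\<integral>\<omega>. (cmod ((\<Sum>x<n ^ k. G m \<omega> z x - mean_G m z) / of_nat (n ^ k)))\<^sup>2 \<partial>P)
    \<le> (2 / Im z)\<^sup>2 * real n ^ m * (1 / real n) ^ k"
    and "integrable P (\<lambda>\<omega>. (cmod ((\<Sum>x<n ^ k. G m \<omega> z x - mean_G m z) / of_nat (n ^ k)))\<^sup>2)"
proof -
  define F where "F x \<omega> = G m \<omega> z x - mean_G m z" for x \<omega>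
  let ?N = "n ^ k" and ?C = "2 / Im z"
  have mean: "cmod (mean_G m z) \<le> 1 / Im z"
  proof -
    have "cmod (mean_G m z) \<le> (\<integral>\<omega>. cmod (G m \<omega> z 0) \<partial>P)" unfolding mean_G_def by (rule integral_norm_bound)
    also have "\<dots> \<le> (\<integral>\<omega>. 1 / Im z \<partial>P)" using z integrable_G[OF z, of m 0] by (intro integral_mono cmod_G_le) auto
    finally show ?thesis by (simp add: P.prob_space)
  qed
  have F: "cmod (F x \<omega>) \<le> ?C" for x \<omega>
    using norm_triangle_ineq4[of "G m \<omega> z x" "mean_G m z"] cmod_G_le[OF z, of m \<omega> x] mean by (simp add: F_def)
  have Fm [measurable]: "F x \<in> borel_measurable P" for x
    unfolding F_def by (intro borel_measurable_diff measurable_G z borel_measurable_const)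
  have FF: "cmod (F x \<omega> * cnj (F y \<omega>)) \<le> ?C\<^sup>2" for x y \<omega>
    unfolding norm_mult complex_mod_cnj power2_eq_square using z by (intro mult_mono F) auto
  have intFF: "integrable P (\<lambda>\<omega>. F x \<omega> * cnj (F y \<omega>))" for x y
    by (rule P.integrable_const_bound[of _ "?C\<^sup>2"])
      (auto intro!: AE_I2 FF borel_measurable_times borel_measurable_cnj Fm)
  \<comment> \<open>As a complex double sum the squared modulus can be integrated term by
    term.\<close>
  have sq: "complex_of_real ((cmod ((\<Sum>x<?N. F x \<omega>) / of_nat ?N))\<^sup>2)
      = (\<Sum>x<?N. \<Sum>y<?N. F x \<omega> * cnj (F y \<omega>)) / of_nat (?N\<^sup>2)" for \<omega>
  proof -
    have "complex_of_real ((cmod ((\<Sum>x<?N. F x \<omega>) / of_nat ?N))\<^sup>2)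
        = ((\<Sum>x<?N. F x \<omega>) / of_nat ?N) * cnj ((\<Sum>x<?N. F x \<omega>) / of_nat ?N)"
      by (rule complex_norm_square)
    also have "\<dots> = ((\<Sum>x<?N. F x \<omega>) * (\<Sum>y<?N. cnj (F y \<omega>))) / of_nat (?N\<^sup>2)"
      by (simp add: power2_eq_square)
    finally show ?thesis by (simp only: sum_product)
  qed
  have "integrable P (\<lambda>\<omega>. complex_of_real ((cmod ((\<Sum>x<?N. F x \<omega>) / of_nat ?N))\<^sup>2))"
    unfolding sq by (intro integrable_divide_zero Bochner_Integration.integrable_sum intFF)
  hence "integrable P (\<lambda>\<omega>. (cmod ((\<Sum>x<?N. F x \<omega>) / of_nat ?N))\<^sup>2)"
    using complex_of_real_integrable_eq by blast
  thus "integrable P (\<lambda>\<omega>. (cmod ((\<Sum>x<?N. G m \<omega> z x - mean_G m z) / of_nat ?N))\<^sup>2)" by (simp only: F_def)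
  have cov: "cmod (\<integral>\<omega>. F x \<omega> * cnj (F y \<omega>) \<partial>P) \<le> (if y \<in> hblock n m x then ?C\<^sup>2 else 0)" for x y
  proof (cases "y \<in> hblock n m x")
    case True
    have "cmod (\<integral>\<omega>. F x \<omega> * cnj (F y \<omega>) \<partial>P) \<le> (\<integral>\<omega>. cmod (F x \<omega> * cnj (F y \<omega>)) \<partial>P)" by (rule integral_norm_bound)
    also have "\<dots> \<le> (\<integral>\<omega>. ?C\<^sup>2 \<partial>P)" using intFF by (intro integral_mono FF) auto
    finally show ?thesis using True by (simp add: P.prob_space)
  qed (use uncorrelated_G[OF z] in \<open>simp add: F_def\<close>)
  have eq: "complex_of_real (\<integral>\<omega>. (cmod ((\<Sum>x<?N. F x \<omega>) / of_nat ?N))\<^sup>2 \<partial>P)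
      = (\<Sum>x<?N. \<Sum>y<?N. \<integral>\<omega>. F x \<omega> * cnj (F y \<omega>) \<partial>P) / of_nat (?N\<^sup>2)"
    unfolding integral_complex_of_real[symmetric] sq using intFF
    by (simp add: Bochner_Integration.integral_sum Bochner_Integration.integrable_sum)
  have "\<bar>\<integral>\<omega>. (cmod ((\<Sum>x<?N. F x \<omega>) / of_nat ?N))\<^sup>2 \<partial>P\<bar>
      = cmod (\<Sum>x<?N. \<Sum>y<?N. \<integral>\<omega>. F x \<omega> * cnj (F y \<omega>) \<partial>P) / real (?N\<^sup>2)"
    using arg_cong[OF eq, of cmod] by (simp only: norm_of_real norm_divide norm_of_nat)
  also have "\<dots> \<le> (real ?N * (real n ^ m * ?C\<^sup>2)) / real (?N\<^sup>2)"
  proof (rule divide_right_mono)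
    have "cmod (\<Sum>x<?N. \<Sum>y<?N. \<integral>\<omega>. F x \<omega> * cnj (F y \<omega>) \<partial>P)
        \<le> (\<Sum>x<?N. \<Sum>y<?N. if y \<in> hblock n m x then ?C\<^sup>2 else 0)"
      by (intro sum_norm_le cov)
    also have "\<dots> \<le> (\<Sum>x<?N. real n ^ m * ?C\<^sup>2)"
    proof (rule sum_mono)
      fix x
      have "(\<Sum>y<?N. if y \<in> hblock n m x then ?C\<^sup>2 else 0) = real (card ({..<?N} \<inter> hblock n m x)) * ?C\<^sup>2"
        by (simp add: sum.inter_restrict[symmetric])
      also have "\<dots> \<le> real (card (hblock n m x)) * ?C\<^sup>2"
        using card_mono[of "hblock n m x" "{..<?N} \<inter> hblock n m x"] n_pos
        by (intro mult_right_mono of_nat_mono) auto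
      finally show "(\<Sum>y<?N. if y \<in> hblock n m x then ?C\<^sup>2 else 0) \<le> real n ^ m * ?C\<^sup>2"
        using n_pos by simp
    qed
    finally show "cmod (\<Sum>x<?N. \<Sum>y<?N. \<integral>\<omega>. F x \<omega> * cnj (F y \<omega>) \<partial>P) \<le> real ?N * (real n ^ m * ?C\<^sup>2)" by simp
  qed simp
  also have "\<dots> = ?C\<^sup>2 * real n ^ m * (1 / real n) ^ k"
    using n_pos by (simp add: power2_eq_square power_divide field_simps)
  finally show "(\<integral>\<omega>. (cmod ((\<Sum>x<?N. G m \<omega> z x - mean_G m z) / of_nat ?N))\<^sup>2 \<partial>P)
    \<le> ?C\<^sup>2 * real n ^ m * (1 / real n) ^ k" by (simp only: F_def)
qed

text \<open>The variance bound is geometric in k, hence summable, and convergence holds along the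
  full sequence of blocks.\<close>

lemma AE_average_G:
  assumes z: "Im z > 0"
  shows "AE \<omega> in P. (\<lambda>k. (\<Sum>x<n ^ k. G m \<omega> z x) / of_nat (n ^ k)) \<longlonglongrightarrow> mean_G m z"
proof -
  have "AE \<omega> in P. (\<lambda>k. (cmod ((\<Sum>x<n ^ k. G m \<omega> z x - mean_G m z) / of_nat (n ^ k)))\<^sup>2) \<longlonglongrightarrow> 0"
    using n2 by (intro AE_tendsto_zero_of_summable_integrals[OF variance_average_G(2)[OF z] _ variance_average_G(1)[OF z]]
        summable_mult summable_geometric) auto
  thus ?thesis
  proof eventually_elim
    case (elim \<omega>)
    hence "(\<lambda>k. cmod ((\<Sum>x<n ^ k. G m \<omega> z x - mean_G m z) / of_nat (n ^ k))) \<longlonglongrightarrow> 0"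
      using tendsto_real_sqrt[OF elim] by simp
    hence "(\<lambda>k. (\<Sum>x<n ^ k. G m \<omega> z x - mean_G m z) / of_nat (n ^ k)) \<longlonglongrightarrow> 0"
      by (rule tendsto_norm_zero_cancel)
    moreover have "(\<Sum>x<n ^ k. G m \<omega> z x - mean_G m z) / of_nat (n ^ k)
        = (\<Sum>x<n ^ k. G m \<omega> z x) / of_nat (n ^ k) - mean_G m z" for k
      using n_pos by (simp add: sum_subtractf diff_divide_distrib)
    ultimately show ?case by (simp add: LIM_zero_iff)
  qed
qed

end

section \<open>Convergence of the eigenvalue distributions\<close>

lemma continuous_on_resolvent: "Im z > 0 \<Longrightarrow> continuous_on UNIV (\<lambda>t. 1 / (complex_of_real t - z))"
  by (intro continuous_intros) (auto simp: complex_eq_iff)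

lemma resolvent_vanishes_at_infinity: "((\<lambda>t. 1 / (complex_of_real t - z)) \<longlongrightarrow> 0) at_infinity"
proof (rule tendstoI)
  fix e :: real assume e: "e > 0"
  show "\<forall>\<^sub>F t in at_infinity. dist (1 / (complex_of_real t - z)) 0 < e"
    unfolding eventually_at_infinity
  proof (intro exI allI impI)
    fix t :: real assume t: "cmod z + 1 / e + 1 \<le> norm t"
    have "norm t - cmod z \<le> cmod (complex_of_real t - z)"
      using norm_triangle_ineq2[of "complex_of_real t" z] by simp
    hence gt: "1 / e < cmod (complex_of_real t - z)" using t by linarith
    moreover have "0 < 1 / e" using e by simp
    ultimately have "0 < cmod (complex_of_real t - z)" by linarith
    thus "dist (1 / (complex_of_real t - z)) 0 < e"
      using gt e by (simp add: norm_divide divide_simps mult.commute split: if_splits)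
  qed
qed

context hierarchical_model
begin

lemma int_mu_k_eigenvalues:
  assumes "Hk_eigs n p x k \<omega> = image_mset e (mset_set {..<n ^ k})"
  shows "int_mu_k n p x k \<omega> f = (\<Sum>i<n ^ k. f (e i)) / of_nat (n ^ k)"
  using n_pos by (simp add: int_mu_k_def assms hball_eq_hblock[OF n2] image_mset.compositionality o_def
      sum_unfold_sum_mset[symmetric])

lemma Hk_eigs_enumeration:
  obtains e where "Hk_eigs n p x k \<omega> = image_mset e (mset_set {..<n ^ k})"
  by (rule G_spectral[of k x \<omega>]) (rule that)

lemma is_mean_int_mu_k: "is_mean (int_mu_k n p x k \<omega>)"
proof -
  obtain e where "Hk_eigs n p x k \<omega> = image_mset e (mset_set {..<n ^ k})" by (rule Hk_eigs_enumeration)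
  note I = int_mu_k_eigenvalues[OF this]
  have "cmod ((\<Sum>i<n ^ k. f (e i)) / of_nat (n ^ k)) \<le> B" if "\<forall>t. cmod (f t) \<le> B" for f :: "real \<Rightarrow> complex" and B
  proof -
    have "cmod (\<Sum>i<n ^ k. f (e i)) \<le> (\<Sum>i<n ^ k. B)" by (rule sum_norm_le) (use that in blast)
    hence "cmod (\<Sum>i<n ^ k. f (e i)) \<le> B * real (n ^ k)" by (simp add: mult.commute)
    thus ?thesis using n_pos by (simp only: norm_divide norm_of_nat) (simp add: pos_divide_le_eq)
  qed
  thus ?thesis unfolding is_mean_def I using n_pos
    by (auto simp: sum.distrib add_divide_distrib sum_distrib_left[symmetric])
qed

text \<open>Both sides are the normalised trace of the resolvent, once over eigenvalues and once
  over sites; the unit column sums of the weights identify them.\<close>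

lemma int_mu_k_resolvent:
  assumes z: "Im z > 0"
  shows "int_mu_k n p x k \<omega> (\<lambda>t. 1 / (of_real t - z)) = (\<Sum>y\<in>hblock n k x. G k \<omega> z y) / of_nat (n ^ k)"
proof -
  obtain W e where W: "\<And>y i. 0 \<le> W y i"
    "\<And>y. y \<in> hblock n k x \<Longrightarrow> (\<Sum>i<n ^ k. W y i) = 1"
    "\<And>i. i < n ^ k \<Longrightarrow> (\<Sum>y\<in>hblock n k x. W y i) = 1"
    "\<And>y. y \<in> hblock n k x \<Longrightarrow> (\<Sum>i<n ^ k. W y i * (e i)\<^sup>2) = (\<Sum>y'\<in>hblock n k x. (Hkernel n p k \<omega> y y')\<^sup>2)"
    "\<And>y z. y \<in> hblock n k x \<Longrightarrow> Im z > 0 \<Longrightarrow> G k \<omega> z y = (\<Sum>i<n ^ k. of_real (W y i) / (of_real (e i) - z))"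
    "Hk_eigs n p x k \<omega> = image_mset e (mset_set {..<n ^ k})"
    by (rule G_spectral[of k x \<omega>]) (rule that)
  have "(\<Sum>y\<in>hblock n k x. G k \<omega> z y) = (\<Sum>y\<in>hblock n k x. \<Sum>i<n ^ k. of_real (W y i) / (of_real (e i) - z))"
    by (intro sum.cong refl W(5) z)
  also have "\<dots> = (\<Sum>i<n ^ k. \<Sum>y\<in>hblock n k x. of_real (W y i) / (of_real (e i) - z))" by (rule sum.swap)
  also have "\<dots> = (\<Sum>i<n ^ k. of_real (\<Sum>y\<in>hblock n k x. W y i) / (of_real (e i) - z))"
    by (simp add: sum_divide_distrib)
  also have "\<dots> = (\<Sum>i<n ^ k. 1 / (of_real (e i) - z))"
    by (intro sum.cong refl) (simp only: W(3) lessThan_iff of_real_1)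
  finally show ?thesis unfolding int_mu_k_eigenvalues[OF W(6)] by simp
qed

end

section \<open>Almost sure convergence for all test functions\<close>

context hierarchical_anderson
begin

lemma measurable_green:
  assumes z: "Im z > 0"
  shows "(\<lambda>\<omega>. green n p x \<omega> z) \<in> borel_measurable P"
  by (rule borel_measurable_LIMSEQ_metric[OF measurable_G[OF z]]) (rule G_tendsto_green[OF z])

lemma cmod_integral_green_diff_le:
  assumes z: "Im z > 0"
  shows "cmod (mean_G m z - (\<integral>\<omega>. green n p x \<omega> z \<partial>P)) \<le> tail m / (Im z)\<^sup>2"
proof -
  have "cmod (green n p x \<omega> z) \<le> 1 / Im z" for \<omega>
    by (rule LIMSEQ_le_const2[OF tendsto_norm[OF G_tendsto_green[OF z]]]) (intro exI allI impI cmod_G_le z)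
  hence int: "integrable P (\<lambda>\<omega>. green n p x \<omega> z)"
    by (intro P.integrable_const_bound[of _ "1 / Im z"] measurable_green z) auto
  have "mean_G m z - (\<integral>\<omega>. green n p x \<omega> z \<partial>P) = (\<integral>\<omega>. G m \<omega> z x - green n p x \<omega> z \<partial>P)"
    using integrable_G[OF z, of m x] int by (simp add: integral_G[OF z])
  also have "cmod \<dots> \<le> (\<integral>\<omega>. cmod (G m \<omega> z x - green n p x \<omega> z) \<partial>P)" by (rule integral_norm_bound)
  also have "\<dots> \<le> (\<integral>\<omega>. tail m / (Im z)\<^sup>2 \<partial>P)"
    using integrable_G[OF z, of m x] int cmod_green_diff_le[OF z, of x _ m]
    by (intro integral_mono) (auto simp: norm_minus_commute)
  finally show ?thesis by (simp add: P.prob_space)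
qed

text \<open>k tends to infinity at fixed m, on one event that serves all m. The level m is then
  chosen to make both truncation errors small, that of the entries and that of their mean.\<close>

lemma AE_stieltjes_tendsto:
  assumes z: "Im z > 0"
  shows "AE \<omega> in P. (\<lambda>k. int_mu_k n p x k \<omega> (\<lambda>t. 1 / (of_real t - z))) \<longlonglongrightarrow> (\<integral>\<omega>. green n p x \<omega> z \<partial>P)"
proof -
  have "AE \<omega> in P. \<forall>m. (\<lambda>k. (\<Sum>x<n ^ k. G m \<omega> z x) / of_nat (n ^ k)) \<longlonglongrightarrow> mean_G m z"
    unfolding AE_all_countable using AE_average_G[OF z] by blast
  thus ?thesis
  proof eventually_elim
    case (elim \<omega>)
    show ?case
    proof (rule tendsto_of_uniform_approx)
      fix e :: real assume e: "e > 0"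
      have "(\<lambda>m. tail m / (Im z)\<^sup>2) \<longlonglongrightarrow> 0 / (Im z)\<^sup>2" using z by (intro tendsto_intros tail_tendsto) auto
      hence "\<forall>\<^sub>F m in sequentially. tail m / (Im z)\<^sup>2 < e" using e by (intro order_tendstoD(2)) auto
      then obtain m where m: "tail m / (Im z)\<^sup>2 < e" using eventually_happens'[OF sequentially_bot] by blast
      \<comment> \<open>Once x < n^k, the ball around \<open>x\<close> is the initial segment over
        which \<open>AE_average_G\<close> averages.\<close>
      have "\<forall>\<^sub>F k in sequentially. cmod (int_mu_k n p x k \<omega> (\<lambda>t. 1 / (of_real t - z))
          - (\<Sum>x<n ^ k. G m \<omega> z x) / of_nat (n ^ k)) \<le> e"
        using eventually_less_power[OF n2, of x] eventually_ge_at_top[of m]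
      proof eventually_elim
        case (elim k)
        have "cmod (\<Sum>y<n ^ k. G k \<omega> z y - G m \<omega> z y) \<le> (\<Sum>y<n ^ k. tail m / (Im z)\<^sup>2)"
          by (rule sum_norm_le) (rule cmod_G_diff_le[OF z elim(2)])
        hence "cmod (\<Sum>y<n ^ k. G k \<omega> z y - G m \<omega> z y) / real (n ^ k) \<le> tail m / (Im z)\<^sup>2"
          using n_pos by (simp add: pos_divide_le_eq mult.commute)
        moreover have "int_mu_k n p x k \<omega> (\<lambda>t. 1 / (of_real t - z)) - (\<Sum>x<n ^ k. G m \<omega> z x) / of_nat (n ^ k)
            = (\<Sum>y<n ^ k. G k \<omega> z y - G m \<omega> z y) / of_nat (n ^ k)"
          by (simp only: int_mu_k_resolvent[OF z] hblock_eq_initial[OF n_pos elim(1)] sum_subtractf diff_divide_distrib)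
        ultimately show ?case using m by (simp only: norm_divide norm_of_nat)
      qed
      moreover have "cmod (mean_G m z - (\<integral>\<omega>. green n p x \<omega> z \<partial>P)) \<le> e"
        using cmod_integral_green_diff_le[OF z, of m x] m by linarith
      ultimately show "\<exists>y L'. y \<longlonglongrightarrow> L' \<and> (\<forall>\<^sub>F k in sequentially. cmod (int_mu_k n p x k \<omega> (\<lambda>t. 1 / (of_real t - z)) - y k) \<le> e)
          \<and> cmod (L' - (\<integral>\<omega>. green n p x \<omega> z \<partial>P)) \<le> e"
        using elim by (intro exI[of _ "\<lambda>k. (\<Sum>x<n ^ k. G m \<omega> z x) / of_nat (n ^ k)"] exI[of _ "mean_G m z"] conjI) auto
    qed
  qed
qed

lemma fH_diag_resolvent: "Im z > 0 \<Longrightarrow> fH_diag n p x \<omega> (\<lambda>t. 1 / (complex_of_real t - z)) = green n p x \<omega> z"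
  unfolding fH_diag_def by (rule spec_meas_stieltjes)

text \<open>One null set covers a countable dense set of poles; off it, convergence for every
  \<open>f\<close> follows deterministically. The assumption on \<mu> enters at resolvents, where
  \<open>fH_diag\<close> is the Green function.\<close>

theorem AE_eigenvalue_distribution_tendsto:
  assumes \<mu>: "prob_space \<mu>" "sets \<mu> = sets borel"
    and av: "\<And>f :: real \<Rightarrow> complex. continuous_on UNIV f \<Longrightarrow> (f \<longlongrightarrow> 0) at_infinity \<Longrightarrow>
      (\<integral>t. f t \<partial>\<mu>) = (\<integral>\<omega>. fH_diag n p x \<omega> f \<partial>P)"
  shows "AE \<omega> in P. \<forall>f :: real \<Rightarrow> complex. continuous_on UNIV f \<longrightarrow> (f \<longlongrightarrow> 0) at_infinity \<longrightarrow>
    (\<lambda>k. int_mu_k n p x k \<omega> f) \<longlonglongrightarrow> (\<integral>t. f t \<partial>\<mu>)"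
proof -
  obtain D :: "complex set" where D: "countable D" "\<And>X. open X \<Longrightarrow> X \<noteq> {} \<Longrightarrow> \<exists>d\<in>D. d \<in> X"
    by (rule countable_dense_setE) (rule that)
  have dense: "\<exists>w\<in>D. dist w z < e" if "e > 0" for z e
    using D(2)[of "ball z e"] that by (auto simp: dist_commute)
  have st: "(\<integral>t. 1 / (complex_of_real t - z) \<partial>\<mu>) = (\<integral>\<omega>. green n p x \<omega> z \<partial>P)" if z: "Im z > 0" for z
    using av[OF continuous_on_resolvent[OF z] resolvent_vanishes_at_infinity] by (simp add: fH_diag_resolvent[OF z])
  have "AE \<omega> in P. \<forall>z\<in>D. Im z > 0 \<longrightarrow>
      (\<lambda>k. int_mu_k n p x k \<omega> (\<lambda>t. 1 / (of_real t - z))) \<longlonglongrightarrow> (\<integral>t. 1 / (complex_of_real t - z) \<partial>\<mu>)"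
    unfolding AE_ball_countable[OF D(1)]
  proof
    fix z assume "z \<in> D"
    show "AE \<omega> in P. Im z > 0 \<longrightarrow>
        (\<lambda>k. int_mu_k n p x k \<omega> (\<lambda>t. 1 / (of_real t - z))) \<longlonglongrightarrow> (\<integral>t. 1 / (complex_of_real t - z) \<partial>\<mu>)"
      using AE_stieltjes_tendsto[of z x] by (cases "Im z > 0") (simp_all add: st)
  qed
  thus ?thesis
  proof eventually_elim
    case (elim \<omega>)
    show ?case
    proof (intro allI impI)
      fix f :: "real \<Rightarrow> complex" assume f: "continuous_on UNIV f" "(f \<longlongrightarrow> 0) at_infinity"
      show "(\<lambda>k. int_mu_k n p x k \<omega> f) \<longlonglongrightarrow> (\<integral>t. f t \<partial>\<mu>)"
        by (rule is_mean_tendsto_dense[OF is_mean_int_mu_k is_mean_integral[OF \<mu>] dense _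
              resolvent_algebra_vanishing_at_infinity[OF f]]) (use elim in auto)
    qed
  qed
qed

end

theorem theorem3p3:
  fixes n :: nat and \<rho> :: real and p :: "nat \<Rightarrow> real" and C1 C2 :: real
    and \<gamma> :: "real \<Rightarrow> real" and x0 :: nat and \<mu>av :: "real measure"
  defines "M \<equiv> PiM (UNIV :: nat set) (\<lambda>_. density lborel (\<lambda>t. ennreal (\<gamma> t)))"
  assumes n2: "n \<ge> 2" and rho: "\<rho> > 1"
    and p_pos: "\<And>r. r \<ge> 1 \<Longrightarrow> p r > 0"
    and p_sum: "(\<lambda>r. p (Suc r)) sums 1"
    and C_pos: "C1 > 0" "C2 > 0"
    and p_bounds: "\<And>r. r \<ge> 1 \<Longrightarrow> C1 * \<rho> powr (- real r) \<le> p r \<and> p r \<le> C2 * \<rho> powr (- real r)"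
    and \<gamma>_meas: "\<gamma> \<in> borel_measurable borel"
    and \<gamma>_nonneg: "\<And>t. \<gamma> t \<ge> 0"
    and \<gamma>_int: "integrable lborel \<gamma>" "(\<integral>t. \<gamma> t \<partial>lborel) = 1"
    and \<gamma>_bdd: "\<exists>B. \<forall>t. \<gamma> t \<le> B"
    and \<mu>av_sets: "sets \<mu>av = sets borel"
    and \<mu>av_prob: "prob_space \<mu>av"
    and \<mu>av_def: "\<And>f :: real \<Rightarrow> complex. continuous_on UNIV f \<Longrightarrow> (f \<longlongrightarrow> 0) at_infinity \<Longrightarrow>
        (\<integral>t. f t \<partial>\<mu>av) = (\<integral>\<omega>. fH_diag n p x0 \<omega> f \<partial>M)"
  shows "\<exists>\<Omega>' \<in> sets M. emeasure M \<Omega>' = 1 \<and>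
           (\<forall>\<omega>\<in>\<Omega>'. \<forall>f :: real \<Rightarrow> complex. continuous_on UNIV f \<longrightarrow> (f \<longlongrightarrow> 0) at_infinity \<longrightarrow>
              (\<lambda>k. int_mu_k n p x0 k \<omega> f) \<longlonglongrightarrow> (\<integral>t. f t \<partial>\<mu>av))"
proof -
  let ?D = "density lborel (\<lambda>t. ennreal (\<gamma> t))"
  have "prob_space ?D"
  proof (rule prob_spaceI)
    have "emeasure ?D (space ?D) = (\<integral>\<^sup>+t. ennreal (\<gamma> t) \<partial>lborel)"
      using \<gamma>_meas by (subst emeasure_density) auto
    also have "\<dots> = ennreal (\<integral>t. \<gamma> t \<partial>lborel)" using \<gamma>_int(1) \<gamma>_nonneg by (intro nn_integral_eq_integral) auto
    finally show "emeasure ?D (space ?D) = 1" by (simp add: \<gamma>_int(2))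
  qed
  then interpret hierarchical_anderson n p ?D
    by (intro hierarchical_anderson.intro hierarchical_model.intro hierarchical_anderson_axioms.intro)
      (simp_all add: n2 p_sum p_pos less_imp_le)
  have M: "M = P" unfolding M_def P_def ..
  let ?Q = "\<lambda>\<omega>. \<forall>f :: real \<Rightarrow> complex. continuous_on UNIV f \<longrightarrow> (f \<longlongrightarrow> 0) at_infinity \<longrightarrow>
      (\<lambda>k. int_mu_k n p x0 k \<omega> f) \<longlonglongrightarrow> (\<integral>t. f t \<partial>\<mu>av)"
  have "AE \<omega> in M. ?Q \<omega>"
    unfolding M by (rule AE_eigenvalue_distribution_tendsto[OF \<mu>av_prob \<mu>av_sets]) (rule \<mu>av_def[unfolded M])
  then obtain N where N: "\<And>\<omega>. \<omega> \<in> space M - N \<Longrightarrow> ?Q \<omega>" "N \<in> null_sets M" by (rule AE_E3) (rule that)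
  show ?thesis
  proof (intro bexI conjI ballI allI impI)
    show "(\<lambda>k. int_mu_k n p x0 k \<omega> f) \<longlonglongrightarrow> (\<integral>t. f t \<partial>\<mu>av)"
      if "continuous_on UNIV f" "(f \<longlongrightarrow> 0) at_infinity" "\<omega> \<in> space M - N" for \<omega> and f :: "real \<Rightarrow> complex"
      using N(1) that by blast
    show "emeasure M (space M - N) = 1"
      using N(2) P.emeasure_space_1 by (simp add: M emeasure_Diff_null_set)
    show "space M - N \<in> sets M" using N(2) by auto
  qed
qed

end
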